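(* Let $I\subset\mathbb{R}$ be an interval, let $\alpha>\tfrac12$ with $\alpha\notin\mathbb{N}$, $\kappa,\sigma^2>0$, $m\in\mathbb{N}$, and let $u_0,u_1,\ldots,u_m$ be the Gaussian processes defined in the context, with multivariate covariance functions $\boldsymbol{r}_0,\ldots,\boldsymbol{r}_m$. Consider a set of unique locations $t_1,\ldots,t_n\in I$. For $j=1,\ldots,n$ define the vectors $$\boldsymbol{u}_{0,j}=\bigl[u_0(t_j),u_0'(t_j),\ldots,u_0^{(\max(\lfloor\alpha\rfloor-1,0))}(t_j)\bigr],\qquad \boldsymbol{u}_{i,j}=\bigl[u_i(t_j),u_i'(t_j),\ldots,u_i^{(\lfloor\alpha\rfloor)}(t_j)\bigr],\quad i\in\{1,\ldots,m\}.$$ Then, for $i=0,1,\ldots,m$, the concatenated vector $\boldsymbol{u}_i=[\boldsymbol{u}_{i,1},\ldots,\boldsymbol{u}_{i,n}]$ is a centered Gaussian random variable with a block tridiagonal precision (inverse covariance) matrix $$\boldsymbol{Q}_i=\begin{bmatrix}\boldsymbol{Q}_{1,1}&\boldsymbol{Q}_{1,2}&&&\\ \boldsymbol{Q}_{2,1}&\boldsymbol{Q}_{2,2}&\boldsymbol{Q}_{2,3}&&\\ &\boldsymbol{Q}_{3,2}&\boldsymbol{Q}_{3,3}&\boldsymbol{Q}_{3,4}&\\ &&\ddots&\ddots&\ddots\\ &&\boldsymbol{Q}_{n-1,n-2}&\boldsymbol{Q}_{n-1,n-1}&\boldsymbol{Q}_{n-1,n}\\ &&&\boldsymbol{Q}_{n,n-1}&\boldsymbol{Q}_{n,n}\end{bmatrix}.$$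 The first set of blocks, $\boldsymbol{Q}_{1,1},\boldsymbol{Q}_{1,2}$ and $\boldsymbol{Q}_{2,1}$, are obtained as $$\begin{bmatrix}\boldsymbol{Q}_{1,1}&\boldsymbol{Q}_{1,2}\\ \boldsymbol{Q}_{2,1}&\boldsymbol{M}\end{bmatrix}=\begin{bmatrix}\boldsymbol{r}_i(t_1,t_1)&\boldsymbol{r}_i(t_1,t_2)\\ \boldsymbol{r}_i(t_2,t_1)&\boldsymbol{r}_i(t_2,t_2)\end{bmatrix}^{-1},$$ where $\boldsymbol{M}$ is a dummy variable that is discarded. For $j\in\{2,\ldots,n-1\}$, the subsequent blocks $\boldsymbol{Q}_{j,j},\boldsymbol{Q}_{j,j+1},\boldsymbol{Q}_{j+1,j}$ and $\boldsymbol{Q}_{j+1,j+1}$ are obtained as $$\begin{bmatrix}\boldsymbol{M}_1&\boldsymbol{M}_2&\boldsymbol{0}\\ \boldsymbol{M}_2^\top&\boldsymbol{Q}_{j,j}&\boldsymbol{Q}_{j,j+1}\\ \boldsymbol{0}&\boldsymbol{Q}_{j+1,j}&\boldsymbol{Q}_{j+1,j+1}\end{bmatrix}=\begin{bmatrix}\boldsymbol{r}_i(t_{j-1},t_{j-1})&\boldsymbol{r}_i(t_{j-1},t_j)&\boldsymbol{r}_i(t_{j-1},t_{j+1})\\ \boldsymbol{r}_i(t_j,t_{j-1})&\boldsymbol{r}_i(t_j,t_j)&\boldsymbol{r}_i(t_j,t_{j+1})\\ \boldsymbol{r}_i(t_{j+1},t_{j-1})&\boldsymbol{r}_i(t_{j+1},t_j)&\boldsymbol{r}_i(t_{j+1},t_{j+1})\end{bmatrix}^{-1},$$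 where $\boldsymbol{M}_1$ and $\boldsymbol{M}_2$ are dummy variables that are also discarded.
   Context: Put $\nu=\alpha-\tfrac12$, $A=\sqrt2\,\kappa^{2\nu}\Gamma(\nu+\tfrac12)/\Gamma(\nu)$, $\{\alpha\}=\alpha-\lfloor\alpha\rfloor$. Let $\frac{\sum_{i=0}^m a_ix^i}{\sum_{i=0}^m b_ix^i}$ be the best supremum-norm approximation of $x^{\{\alpha\}}$ on $[0,1]$ among rational functions with numerator and denominator of degree at most $m$, put $P_m(x)=\sum_{i=0}^m a_ix^{m-i}$, $Q_m(x)=\sum_{i=0}^m b_ix^{m-i}$, and let $k,c_i>0$, $p_i<0$ be the numbers with $\frac{P_m(x)}{Q_m(x)}=k+\sum_{i=1}^m\frac{c_i}{x-p_i}$. The processes $u_0,\ldots,u_m$ are independent centered stationary Gaussian processes with spectral densities $$f_{m,0,\alpha}(w)=\frac{A\sigma^2\kappa^{-2\alpha}k}{(1+\kappa^{-2}w^2)^{\lfloor\alpha\rfloor}},\qquad f_{m,i,\alpha}(w)=\frac{A\sigma^2\kappa^{-2\alpha}c_i}{(1+\kappa^{-2}w^2)^{\lfloor\alpha\rfloor}(1+\kappa^{-2}w^2-p_i)},\ i=1,\ldots,m.$$ Explicitly, let $\varrho(h;\nu,\kappa,\sigma^2)=\frac{\sigma^2}{2^{\nu-1}\Gamma(\nu)}(\kappa |h|)^\nu K_\nu(\kappa |h|)$ be the Matérn covariance ($K_\nu$ the modified Bessel function of the second kind), $\gamma(a)=\Gamma(a)/\Gamma(a-\tfrac12)$ and $\kappa_i=\kappa\sqrt{1-p_i}$.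 The covariance functions $\varrho_{m,i,\alpha}$ of $u_i$ are as follows. If $\alpha<1$: $\varrho_{m,0,\alpha}(h)=k\sigma^2\frac{\gamma(\alpha)\sqrt{4\pi}}{\kappa}1_{[h=0]}$ and $\varrho_{m,i,\alpha}(h)=c_i\sigma^2\varrho\bigl(h;\tfrac12,\kappa_i,\frac{\gamma(\alpha)\sqrt\pi}{\sqrt{1-p_i}}\bigr)$ for $i\ge1$. If $\alpha\ge1$: $\varrho_{m,0,\alpha}(h)=k\sigma^2\varrho\bigl(h;\lfloor\alpha\rfloor-\tfrac12,\kappa,\frac{\gamma(\alpha)}{\gamma(\lfloor\alpha\rfloor)}\bigr)$ and, for $i\ge1$, $$\varrho_{m,i,\alpha}(h)=c_i\sigma^2\Bigl[\frac{1}{p_i^{\lfloor\alpha\rfloor}}\varrho\Bigl(h;\tfrac12,\kappa_i,\frac{\gamma(\alpha)\sqrt\pi}{\sqrt{1-p_i}}\Bigr)-\sum_{j=1}^{\lfloor\alpha\rfloor}\frac{1}{p_i^{\lfloor\alpha\rfloor+1-j}}\varrho\Bigl(h;j-\tfrac12,\kappa,\frac{\gamma(\alpha)}{\gamma(j)}\Bigr)\Bigr].$$ Derivatives of the processes are in the mean-squared sense: $u_0$ is $\max(\lfloor\alpha\rfloor-1,0)$ times and each $u_i$, $i\ge1$, is $\lfloor\alpha\rfloor$ times mean-square differentiable (for $\lfloor\alpha\rfloor=0$ no derivatives are involved). The multivariate covariance functions are $\boldsymbol{r}_0(s,t)=\bigl[\partial_s^{k-1}\partial_t^{\ell-1}\varrho_{m,0,\alpha}(s-t)\bigr]_{k,\ell\in\{1,\ldots,\max(\lfloor\alpha\rfloor,1)\}}$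 and, for $i\ge1$, $\boldsymbol{r}_i(s,t)=\bigl[\partial_s^{k-1}\partial_t^{\ell-1}\varrho_{m,i,\alpha}(s-t)\bigr]_{k,\ell\in\{1,\ldots,\lceil\alpha\rceil\}}$ (here $k,\ell$ are matrix indices).
   Formalization: The locations are taken in increasing order t_1<...<t_n (the claim fails for arbitrary labellings), and the lower-right block of step j is asserted to equal Q_{j+1,j+1} only at the last step j=n-1, since for earlier j this is false and step j+1 overwrites it. *)

theory Defs
  imports "HOL-Probability.Probability" "Jordan_Normal_Form.Matrix"
begin

section \<open>Best rational approximation\<close>

definition rational_fun :: "nat \<Rightarrow> (nat \<Rightarrow> real) \<Rightarrow> (nat \<Rightarrow> real) \<Rightarrow> real \<Rightarrow> real" where
  "rational_fun m a b x = (\<Sum>i\<le>m. a i * x ^ i) / (\<Sum>i\<le>m. b i * x ^ i)"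

text \<open>
  Only quotients whose denominator has no zero on the unit interval compete; on that set a
  rational function without poles has such a representation after cancelling common factors,
  and one with poles is at infinite distance.
\<close>

definition admissible_denominator :: "nat \<Rightarrow> (nat \<Rightarrow> real) \<Rightarrow> bool" where
  "admissible_denominator m b \<longleftrightarrow> (\<forall>x\<in>{0..1}. (\<Sum>i\<le>m. b i * x ^ i) \<noteq> 0)"

definition sup_error :: "real \<Rightarrow> nat \<Rightarrow> (nat \<Rightarrow> real) \<Rightarrow> (nat \<Rightarrow> real) \<Rightarrow> real" where
  "sup_error \<beta> m a b = (SUP x\<in>{0..1}. \<bar>x powr \<beta> - rational_fun m a b x\<bar>)"

definition best_rational_approx :: "real \<Rightarrow> nat \<Rightarrow> (nat \<Rightarrow> real) \<Rightarrow> (nat \<Rightarrow> real) \<Rightarrow> bool" where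
  "best_rational_approx \<beta> m a b \<longleftrightarrow> admissible_denominator m b \<and>
     (\<forall>a' b'. admissible_denominator m b' \<longrightarrow> sup_error \<beta> m a b \<le> sup_error \<beta> m a' b')"

definition reversed_poly :: "nat \<Rightarrow> (nat \<Rightarrow> real) \<Rightarrow> real \<Rightarrow> real" where
  "reversed_poly m a x = (\<Sum>i\<le>m. a i * x ^ (m - i))"

definition partial_fractions ::
    "nat \<Rightarrow> (nat \<Rightarrow> real) \<Rightarrow> (nat \<Rightarrow> real) \<Rightarrow> real \<Rightarrow> (nat \<Rightarrow> real) \<Rightarrow> (nat \<Rightarrow> real) \<Rightarrow> bool" where
  "partial_fractions m a b k c p \<longleftrightarrow>
     (\<forall>x. reversed_poly m b x \<noteq> 0 \<longrightarrow>
        reversed_poly m a x / reversed_poly m b x = k + (\<Sum>i=1..m. c i / (x - p i)))"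


section \<open>Matern covariance\<close>

text \<open>Modified Bessel functions of real order, for positive arguments. The reciprocal Gamma
  function \<^const>\<open>rGamma\<close> vanishes at the poles of \<^const>\<open>Gamma\<close>.\<close>

definition bessel_I :: "real \<Rightarrow> real \<Rightarrow> real" where
  "bessel_I \<nu> x = (\<Sum>j. (x / 2) powr (\<nu> + 2 * real j) * rGamma (\<nu> + real j + 1) / fact j)"

definition bessel_K :: "real \<Rightarrow> real \<Rightarrow> real" where
  "bessel_K \<nu> x =
     (let K = (\<lambda>\<mu>. pi / 2 * (bessel_I (- \<mu>) x - bessel_I \<mu> x) / sin (\<mu> * pi))
      in if \<nu> \<in> \<int> then Lim (at \<nu>) K else K \<nu>)"

text \<open>The value at lag zero is the continuous extension of the formula.\<close>

definition matern :: "real \<Rightarrow> real \<Rightarrow> real \<Rightarrow> real \<Rightarrow> real" where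
  "matern h \<nu> \<kappa> s2 =
     (if h = 0 then s2
      else s2 / (2 powr (\<nu> - 1) * Gamma \<nu>) * (\<kappa> * \<bar>h\<bar>) powr \<nu> * bessel_K \<nu> (\<kappa> * \<bar>h\<bar>))"

definition gamma_ratio :: "real \<Rightarrow> real" where
  "gamma_ratio a = Gamma a / Gamma (a - 1/2)"

definition approx_cov ::
    "real \<Rightarrow> real \<Rightarrow> real \<Rightarrow> real \<Rightarrow> (nat \<Rightarrow> real) \<Rightarrow> (nat \<Rightarrow> real) \<Rightarrow> nat \<Rightarrow> real \<Rightarrow> real" where
  "approx_cov \<alpha> \<kappa> s2 k c p i h =
    (let N = nat \<lfloor>\<alpha>\<rfloor>;
         \<kappa>' = \<kappa> * sqrt (1 - p i);
         E = matern h (1/2) \<kappa>' (gamma_ratio \<alpha> * sqrt pi / sqrt (1 - p i))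
     in if \<alpha> < 1 then
          (if i = 0 then k * s2 * (gamma_ratio \<alpha> * sqrt (4 * pi) / \<kappa>) * (if h = 0 then 1 else 0)
           else c i * s2 * E)
        else
          (if i = 0 then
             k * s2 * matern h (real N - 1/2) \<kappa> (gamma_ratio \<alpha> / gamma_ratio (real N))
           else
             c i * s2 * (1 / p i ^ N * E -
               (\<Sum>j=1..N. 1 / p i ^ (N + 1 - j) *
                  matern h (real j - 1/2) \<kappa> (gamma_ratio \<alpha> / gamma_ratio (real j))))))"


section \<open>Gaussian processes\<close>

definition covariance :: "'a measure \<Rightarrow> ('a \<Rightarrow> real) \<Rightarrow> ('a \<Rightarrow> real) \<Rightarrow> real" where
  "covariance M X Y =
     (\<integral>\<omega>. (X \<omega> - (\<integral>\<omega>'. X \<omega>' \<partial>M)) * (Y \<omega> - (\<integral>\<omega>'. Y \<omega>' \<partial>M)) \<partial>M)"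

text \<open>Univariate normal distributions, including the degenerate ones.\<close>

definition normal_rv :: "'a measure \<Rightarrow> ('a \<Rightarrow> real) \<Rightarrow> bool" where
  "normal_rv M X \<longleftrightarrow> X \<in> borel_measurable M \<and>
     (\<exists>\<mu>. (AE \<omega> in M. X \<omega> = \<mu>) \<or> (\<exists>s>0. distributed M lborel X (normal_density \<mu> s)))"

text \<open>Random vectors are given by the lists of their components.\<close>

definition gaussian_vector :: "'a measure \<Rightarrow> ('a \<Rightarrow> real) list \<Rightarrow> bool" where
  "gaussian_vector M Xs \<longleftrightarrow> (\<forall>X\<in>set Xs. X \<in> borel_measurable M) \<and>
     (\<forall>a. normal_rv M (\<lambda>\<omega>. \<Sum>j<length Xs. a j * (Xs ! j) \<omega>))"

definition centered_gaussian_vector :: "'a measure \<Rightarrow> ('a \<Rightarrow> real) list \<Rightarrow> bool" where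
  "centered_gaussian_vector M Xs \<longleftrightarrow>
     gaussian_vector M Xs \<and> (\<forall>X\<in>set Xs. (\<integral>\<omega>. X \<omega> \<partial>M) = 0)"

definition cov_matrix :: "'a measure \<Rightarrow> ('a \<Rightarrow> real) list \<Rightarrow> real mat" where
  "cov_matrix M Xs = Matrix.mat (length Xs) (length Xs) (\<lambda>(a, b). covariance M (Xs ! a) (Xs ! b))"

definition centered_stationary_gaussian_process ::
    "'a measure \<Rightarrow> real set \<Rightarrow> (real \<Rightarrow> 'a \<Rightarrow> real) \<Rightarrow> (real \<Rightarrow> real) \<Rightarrow> bool" where
  "centered_stationary_gaussian_process M I X \<rho> \<longleftrightarrow>
     (\<forall>ts. set ts \<subseteq> I \<longrightarrow> centered_gaussian_vector M (map X ts)) \<and>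
     (\<forall>s\<in>I. \<forall>t\<in>I. covariance M (X s) (X t) = \<rho> (s - t))"

definition independent_processes ::
    "'a measure \<Rightarrow> real set \<Rightarrow> nat set \<Rightarrow> (nat \<Rightarrow> real \<Rightarrow> 'a \<Rightarrow> real) \<Rightarrow> bool" where
  "independent_processes M I J u \<longleftrightarrow>
     prob_space.indep_vars M (\<lambda>_. PiM I (\<lambda>_. borel)) (\<lambda>i \<omega>. \<lambda>t\<in>I. u i t \<omega>) J"

definition square_integrable_rv :: "'a measure \<Rightarrow> ('a \<Rightarrow> real) \<Rightarrow> bool" where
  "square_integrable_rv M X \<longleftrightarrow> X \<in> borel_measurable M \<and> integrable M (\<lambda>\<omega>. (X \<omega>)\<^sup>2)"

text \<open>Without the limit point condition the limit would be vacuous on a one-point set.\<close>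

definition has_ms_derivative ::
    "'a measure \<Rightarrow> real set \<Rightarrow> (real \<Rightarrow> 'a \<Rightarrow> real) \<Rightarrow> (real \<Rightarrow> 'a \<Rightarrow> real) \<Rightarrow> bool" where
  "has_ms_derivative M I X Y \<longleftrightarrow>
     (\<forall>t\<in>I. square_integrable_rv M (X t) \<and> square_integrable_rv M (Y t) \<and> t islimpt I \<and>
        ((\<lambda>s. \<integral>\<omega>. ((X s \<omega> - X t \<omega>) / (s - t) - Y t \<omega>)\<^sup>2 \<partial>M) \<longlongrightarrow> 0) (at t within I))"

definition max_deriv_order :: "real \<Rightarrow> nat \<Rightarrow> nat" where
  "max_deriv_order \<alpha> i = (if i = 0 then nat (max (\<lfloor>\<alpha>\<rfloor> - 1) 0) else nat \<lfloor>\<alpha>\<rfloor>)"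

text \<open>\<open>D l t\<close> is the value at \<open>t\<close> of the derivative of order \<open>l\<close>.\<close>

definition concatenated_vector ::
    "nat \<Rightarrow> nat \<Rightarrow> (nat \<Rightarrow> real) \<Rightarrow> (nat \<Rightarrow> real \<Rightarrow> 'a \<Rightarrow> real) \<Rightarrow> ('a \<Rightarrow> real) list" where
  "concatenated_vector n L t D = concat (map (\<lambda>j. map (\<lambda>l. D l (t j)) [0..<L + 1]) [1..<n + 1])"


section \<open>Multivariate covariance functions and block matrices\<close>

definition block_size :: "real \<Rightarrow> nat \<Rightarrow> nat" where
  "block_size \<alpha> i = (if i = 0 then nat (max \<lfloor>\<alpha>\<rfloor> 1) else nat \<lceil>\<alpha>\<rceil>)"

text \<open>Matrix indices start at 0, so the entry \<open>(a, b)\<close> carries derivatives of orders \<open>a\<close> and \<open>b\<close>.\<close>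

definition multi_cov :: "nat \<Rightarrow> (real \<Rightarrow> real) \<Rightarrow> real \<Rightarrow> real \<Rightarrow> real mat" where
  "multi_cov d \<rho> s t = Matrix.mat d d
     (\<lambda>(a, b). (deriv ^^ a) (\<lambda>s'. (deriv ^^ b) (\<lambda>t'. \<rho> (s' - t')) t) s)"

text \<open>The matrix assembled from the rows of blocks \<open>Bs\<close>, all of size \<open>d\<close> by \<open>d\<close>.\<close>

definition block_matrix :: "nat \<Rightarrow> real mat list list \<Rightarrow> real mat" where
  "block_matrix d Bs = Matrix.mat (length Bs * d) (length Bs * d)
     (\<lambda>(a, b). (Bs ! (a div d) ! (b div d)) $$ (a mod d, b mod d))"

definition is_inverse_mat :: "real mat \<Rightarrow> real mat \<Rightarrow> bool" where
  "is_inverse_mat A B \<longleftrightarrow> square_mat A \<and> square_mat B \<and> inverts_mat A B \<and> inverts_mat B A"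

end

theory Submission
  imports Defs "Jordan_Normal_Form.Determinant"
begin

text \<open>
  Apart from the white noise \<open>u\<^sub>0\<close> in the case \<open>\<alpha> < 1\<close>, whose covariance matrix is diagonal, the following
  applies. For lags \<open>h \<ge> 0\<close> the covariance function of each process is the restriction of a smooth function
  \<open>f\<close> (an exponential polynomial, because the Bessel functions of half-integer order are elementary)
  which solves a homogeneous linear differential equation of order \<open>d\<close>, the block size. Its odd
  derivatives at 0 vanish below order \<open>2d - 1\<close>, and \<open>(-1)\<^sup>d\<close> times the derivative of order \<open>2d - 1\<close> is
  positive. Let \<open>r(h)\<close> be the matrix of covariances of derivatives at lag \<open>h\<close>, and \<open>R = r(0)\<close>.
  A vector in the kernel of \<open>R\<close> gives a linear combination of derivatives of \<open>f\<close> with zero initial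
  data, hence the zero function; the sign conditions then force the vector to be zero. So \<open>R\<close> is
  invertible, and uniqueness for the differential equation gives the Markov property
  \<open>r(x + h) = r(x) R\<^sup>-\<^sup>1 r(h)\<close>. The innovation covariance \<open>R - r(h) R\<^sup>-\<^sup>1 r(h)\<^sup>T\<close>
  vanishes at \<open>h = 0\<close> and has a derivative of rank one, from which its invertibility for \<open>h > 0\<close>
  follows. The inverse of the full covariance matrix is then an explicit block tridiagonal matrix in
  which each block involves neighbouring locations only, and the same formula for two or three
  locations gives the local inverses of the statement.
\<close>

section \<open>Bessel functions of half-integer order\<close>

text \<open>The conditions at lag 0 come from the spectral densities. Apart from the white noise,
  each is up to a constant the reciprocal of a polynomial of degree d in w^2, so the process is the
  stationary solution of a linear equation of order d driven by white noise. The driving noise is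
  visible in the covariance function only as a jump of the derivative of order 2d - 1 across lag 0,
  and the sign condition says that its intensity is positive. The noise acts on the highest
  derivative alone, which is why the innovation covariance grows at rank one; its invertibility
  after any positive time is controllability of the companion system. That stochastic equation is
  never solved: everything is read off the explicit covariance functions. A second argument is
  needed to see that these matrices belong to a Gaussian vector. Mean-square derivatives are limits
  of linear combinations of the process, and normality given by a density is not visibly stable
  under limits, so it is transferred through characteristic functions.\<close>

lemma bessel_I_summable:
  assumes "x > 0"
  shows "summable (\<lambda>j. (x / 2) powr (\<nu> + 2 * real j) * rGamma (\<nu> + real j + 1) / fact j)"
proof -
  let ?f = "\<lambda>j. (x / 2) powr (\<nu> + 2 * real j) * rGamma (\<nu> + real j + 1) / fact j"
  \<comment> \<open>From this index on, \<open>\<nu> + j + 1\<close> is at least 1 and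
    \<open>x\<^sup>2\<close> is at most \<open>j\<close>, so the quotient of consecutive terms,
    \<open>x\<^sup>2 / 4\<close> over \<open>(\<nu> + j + 1) * (j + 1)\<close>, is at most 1/4 in
    absolute value.\<close>
  obtain N :: nat where N: "real N \<ge> \<bar>\<nu>\<bar> + x\<^sup>2" using real_arch_simple by blast
  show ?thesis
  proof (rule summable_ratio_test)
    show "(1/2::real) < 1" by simp
    fix j assume "j \<ge> N"
    then have j: "real j \<ge> \<bar>\<nu>\<bar> + x\<^sup>2" using N by linarith
    have den: "\<nu> + real j + 1 \<ge> 1" using j zero_le_power2[of x] by linarith
    have G: "rGamma (\<nu> + real j + 1) = (\<nu> + real j + 1) * rGamma (\<nu> + real (Suc j) + 1)"
      using rGamma_plus1[of "\<nu> + real j + 1"] by (simp add: algebra_simps)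
    have P: "(x / 2) powr (\<nu> + 2 * real (Suc j)) = (x/2) powr (\<nu> + 2 * real j) * (x\<^sup>2/4)"
    proof -
      have "(x / 2) powr (\<nu> + 2 * real (Suc j)) = (x/2) powr (\<nu> + 2 * real j) * (x/2) powr 2"
        by (simp add: powr_add[symmetric] algebra_simps)
      also have "(x/2) powr 2 = x\<^sup>2/4" using assms by (simp add: power2_eq_square powr_numeral)
      finally show ?thesis .
    qed
    have eq: "?f j * (x\<^sup>2/4) = ?f (Suc j) * ((\<nu> + real j + 1) * (real j + 1))"
    proof -
      have gen: "p * (l * r) / f * q = p * q * r / (i * f) * (l * i)" if "i \<noteq> 0" for p l r f q i :: real
        using that by simp
      show ?thesis unfolding G P unfolding fact_Suc of_nat_mult of_nat_Suc add.commute[of 1] by (rule gen) simp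
    qed
    have "\<bar>?f j\<bar> * (x\<^sup>2/4) = \<bar>?f (Suc j)\<bar> * ((\<nu> + real j + 1) * (real j + 1))"
      using arg_cong[OF eq, of abs] den by (simp only: abs_mult) simp
    moreover have "(\<nu> + real j + 1) * (real j + 1) \<ge> 1 * (real j + 1)"
      using den by (intro mult_right_mono) auto
    ultimately have "\<bar>?f j\<bar> * (x\<^sup>2/4) \<ge> \<bar>?f (Suc j)\<bar> * (real j + 1)"
      by (metis abs_ge_zero mult_1 mult_left_mono)
    moreover have "\<bar>?f j\<bar> * (x\<^sup>2/4) \<le> \<bar>?f j\<bar> * ((real j + 1)/4)"
      using j by (intro mult_left_mono) auto
    ultimately have "\<bar>?f (Suc j)\<bar> * (real j + 1) \<le> (1/4 * \<bar>?f j\<bar>) * (real j + 1)" by simp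
    then have "\<bar>?f (Suc j)\<bar> \<le> 1/4 * \<bar>?f j\<bar>" by (rule mult_right_le_imp_le) simp
    also have "1/4 * \<bar>?f j\<bar> \<le> 1/2 * \<bar>?f j\<bar>" by (intro mult_right_mono) auto
    finally show "norm (?f (Suc j)) \<le> 1/2 * norm (?f j)" by (simp only: real_norm_def)
  qed
qed

text \<open>Termwise comparison of the series. The powers of \<open>x\<close> in the series of order
  \<open>\<nu> + 1\<close> run one index ahead of those of order \<open>\<nu> - 1\<close>, hence the
  shifted sequence \<open>V\<close>. No order is exceptional, since \<open>rGamma\<close> satisfies
  its functional equation everywhere.\<close>

lemma bessel_I_recurrence:
  assumes "x > 0"
  shows "bessel_I (\<nu> - 1) x - bessel_I (\<nu> + 1) x = 2 * \<nu> / x * bessel_I \<nu> x"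
proof -
  define T where "T = (\<lambda>\<nu> j. (x / 2) powr (\<nu> + 2 * real j) * rGamma (\<nu> + real j + 1) / fact j)"
  have sums: "T \<nu> sums bessel_I \<nu> x" for \<nu>
    unfolding T_def bessel_I_def using bessel_I_summable[OF assms] by (rule summable_sums)
  define V where "V = (\<lambda>j. if j = 0 then 0 else T (\<nu> + 1) (j - 1))"
  have V: "V sums bessel_I (\<nu> + 1) x"
    using sums_Suc[of V "bessel_I (\<nu> + 1) x"] sums[of "\<nu> + 1"] by (simp add: V_def)
  have "T (\<nu> - 1) j - V j = 2 * \<nu> / x * T \<nu> j" for j
  proof -
    define W where "W = (x / 2) powr (\<nu> - 1 + 2 * real j) * rGamma (\<nu> + real j + 1)"
    have x: "(x / 2) powr (\<nu> + 2 * real j) = (x / 2) powr (\<nu> - 1 + 2 * real j) * (x/2)"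
      using assms powr_add[of "x/2" "\<nu> - 1 + 2 * real j" 1] by simp
    have a: "T \<nu> j = W * (x/2) / fact j" unfolding T_def W_def x by simp
    have b: "T (\<nu> - 1) j = W * (\<nu> + real j) / fact j"
    proof -
      have "rGamma (\<nu> - 1 + real j + 1) = (\<nu> + real j) * rGamma (\<nu> + real j + 1)"
        using rGamma_plus1[of "\<nu> + real j"] by simp
      then show ?thesis unfolding T_def W_def by simp
    qed
    have c: "V j = W * real j / fact j"
    proof (cases j)
      case (Suc i)
      have gen: "q = q * l / (l * i) * i" if "i \<noteq> 0" "l \<noteq> 0" for q l i :: real
        using that by simp
      have "T (\<nu> + 1) i = W / fact i" unfolding T_def W_def Suc by (simp add: algebra_simps)
      then show ?thesis unfolding V_def Suc by (simp del: of_nat_Suc)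
    qed (simp add: V_def)
    show ?thesis unfolding a b c using assms by (simp add: field_simps)
  qed
  moreover have "(\<lambda>j. T (\<nu> - 1) j - V j) sums (bessel_I (\<nu> - 1) x - bessel_I (\<nu> + 1) x)"
    by (intro sums_diff sums V)
  moreover have "(\<lambda>j. 2 * \<nu> / x * T \<nu> j) sums (2 * \<nu> / x * bessel_I \<nu> x)"
    by (intro sums_mult sums)
  ultimately show ?thesis by (simp add: sums_unique2)
qed

lemma bessel_K_nonint:
  "\<nu> \<notin> \<int> \<Longrightarrow> bessel_K \<nu> x = pi / 2 * (bessel_I (- \<nu>) x - bessel_I \<nu> x) / sin (\<nu> * pi)"
  by (simp add: bessel_K_def Let_def)

text \<open>Orders \<open>\<nu> + 1\<close> and \<open>\<nu> - 1\<close> share the denominator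
  \<open>- sin (\<nu> * pi)\<close>, so the recurrences of \<open>bessel_I\<close> at
  \<open>\<nu>\<close> and at \<open>- \<nu>\<close> can be subtracted. Non-integrality avoids the
  limit in the definition of \<open>bessel_K\<close>.\<close>

lemma bessel_K_recurrence:
  assumes "x > 0" "\<nu> \<notin> \<int>"
  shows "bessel_K (\<nu> + 1) x = bessel_K (\<nu> - 1) x + 2 * \<nu> / x * bessel_K \<nu> x"
proof -
  have ni: "\<nu> + 1 \<notin> \<int>" "\<nu> - 1 \<notin> \<int>"
    using assms(2) Ints_diff[of "\<nu> + 1" 1] Ints_add[of "\<nu> - 1" 1] by auto
  have s: "sin ((\<nu> + 1) * pi) = - sin (\<nu> * pi)" "sin ((\<nu> - 1) * pi) = - sin (\<nu> * pi)"
    by (simp_all add: algebra_simps sin_add sin_diff)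
  have nz: "sin (\<nu> * pi) \<noteq> 0"
    using assms(2) by (auto simp: sin_zero_iff_int2)
  have r1: "bessel_I (\<nu> - 1) x = bessel_I (\<nu> + 1) x + 2 * \<nu> / x * bessel_I \<nu> x"
    using bessel_I_recurrence[OF assms(1), of \<nu>] by simp
  have r2: "bessel_I (- \<nu> - 1) x = bessel_I (- \<nu> + 1) x - 2 * \<nu> / x * bessel_I (- \<nu>) x"
    using bessel_I_recurrence[OF assms(1), of "-\<nu>"] by simp
  have m: "- (\<nu> + 1) = - \<nu> - 1" "- (\<nu> - 1) = - \<nu> + 1" by simp_all
  show ?thesis
    unfolding bessel_K_nonint[OF assms(2)] bessel_K_nonint[OF ni(1)] bessel_K_nonint[OF ni(2)] s m r1 r2
    using nz assms(1) by (simp add: field_simps)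
qed

text \<open>Duplication formula in the shape that turns the series of orders -1/2 and 1/2 into those
  of \<open>cosh\<close> and \<open>sinh\<close>.\<close>

lemma rGamma_half:
  "rGamma (real j + 1/2) / fact j = 4 ^ j / (sqrt pi * fact (2 * j))"
  "rGamma (real j + 3/2) / fact j = 2 * 4 ^ j / (sqrt pi * fact (2 * j + 1))"
proof -
  show A: "rGamma (real j + 1/2) / fact j = 4 ^ j / (sqrt pi * fact (2 * j))" for j
  proof (induction j)
    case 0
    then show ?case by (simp add: rGamma_inverse_Gamma Gamma_one_half_real field_simps)
  next
    case (Suc j)
    have "rGamma (real j + 1/2) = (real j + 1/2) * rGamma (real (Suc j) + 1/2)"
      using rGamma_plus1[of "real j + 1/2"] by (simp add: algebra_simps)
    then have "rGamma (real (Suc j) + 1/2) / fact (Suc j)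
      = (rGamma (real j + 1/2) / fact j) / ((real j + 1/2) * (real j + 1))"
    proof -
      assume *: "rGamma (real j + 1/2) = (real j + 1/2) * rGamma (real (Suc j) + 1/2)"
      have gen: "R / (i * f) = (k * R) / f / (k * i)" if "k \<noteq> 0" for k R f i :: real
        using that by simp
      show ?thesis unfolding * fact_Suc by (simp only: of_nat_mult of_nat_Suc add.commute[of 1]) (rule gen, simp)
    qed
    also have "\<dots> = 4 ^ Suc j / (sqrt pi * fact (2 * Suc j))"
      unfolding Suc.IH by (simp add: divide_simps) (simp add: algebra_simps)
    finally show ?case .
  qed
  have "rGamma (real j + 1/2) = (real j + 1/2) * rGamma (real j + 3/2)"
    using rGamma_plus1[of "real j + 1/2"] by (simp add: algebra_simps)
  then have "rGamma (real j + 3/2) = rGamma (real j + 1/2) / (real j + 1/2)"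
    by (simp add: eq_divide_eq)
  then have "rGamma (real j + 3/2) / fact j = (rGamma (real j + 1/2) / fact j) / (real j + 1/2)"
    by simp
  then show "rGamma (real j + 3/2) / fact j = 2 * 4 ^ j / (sqrt pi * fact (2 * j + 1))"
    unfolding A by (simp add: divide_simps) (simp add: algebra_simps)
qed

lemma half_not_Ints: "real n + 1/2 \<notin> \<int>"
proof
  assume "real n + 1/2 \<in> \<int>"
  then obtain z :: int where "real n + 1/2 = of_int z" by (auto elim: Ints_cases)
  then have "of_int (2 * int n + 1) = (of_int (2 * z) :: real)" by simp
  then have "2 * int n + 1 = 2 * z" by (simp only: of_int_eq_iff)
  then show False by presburger
qed

lemma bessel_K_half:
  assumes "x > 0"
  shows "bessel_K (1/2) x = sqrt (pi / 2) * x powr (- 1/2) * exp (- x)"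
proof -
  let ?z = "(x / 2) powr (- 1/2) / sqrt pi"
  have pw: "(x/2) powr (- 1/2 + 2 * real j) = (x/2) powr (- 1/2) * (x/2) ^ (2 * j)" 
    "(x/2) powr (1/2 + 2 * real j) = (x/2) powr (- 1/2) * (x/2) ^ (2 * j + 1)" for j
  proof -
    have "(x/2) powr (2 * real j) = (x/2) ^ (2 * j)"
      using assms powr_realpow[of "x/2" "2 * j"] by simp
    moreover have "(x/2) powr (1 + 2 * real j) = (x/2) ^ (2 * j + 1)"
      using assms powr_realpow[of "x/2" "2 * j + 1"] by (simp add: algebra_simps)
    moreover have "(x/2) powr (1/2 + 2 * real j) = (x/2) powr (- 1/2 + (1 + 2 * real j))"
      by (simp add: algebra_simps)
    ultimately show "(x/2) powr (- 1/2 + 2 * real j) = (x/2) powr (- 1/2) * (x/2) ^ (2 * j)" 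
      "(x/2) powr (1/2 + 2 * real j) = (x/2) powr (- 1/2) * (x/2) ^ (2 * j + 1)"
      by (simp_all only: powr_add)
  qed
  have q: "(x/2) ^ (2 * j) * 4 ^ j = x ^ (2 * j)" for j :: nat
  proof -
    have "(x/2) ^ (2 * j) * 4 ^ j = ((x/2)\<^sup>2 * 4) ^ j" by (simp only: power_mult power_mult_distrib)
    also have "(x/2)\<^sup>2 * 4 = x\<^sup>2" by (simp add: power2_eq_square)
    finally show ?thesis by (simp only: power_mult)
  qed
  have e: "bessel_I (- 1/2) x = (\<Sum>j. ?z * (x ^ (2 * j) / fact (2 * j)))"
    unfolding bessel_I_def
  proof (intro suminf_cong)
    fix j
    have "(x/2) powr (- 1/2 + 2 * real j) * rGamma (- 1/2 + real j + 1) / fact j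
      = (x/2) powr (- 1/2) * (x/2) ^ (2 * j) * (rGamma (real j + 1/2) / fact j)"
      unfolding pw by (simp add: algebra_simps)
    also have "\<dots> = ?z * (x ^ (2 * j) / fact (2 * j))"
      unfolding rGamma_half by (simp add: q[symmetric])
    finally show "(x/2) powr (- 1/2 + 2 * real j) * rGamma (- 1/2 + real j + 1) / fact j
      = ?z * (x ^ (2 * j) / fact (2 * j))" .
  qed
  have o: "bessel_I (1/2) x = (\<Sum>j. ?z * (x ^ (2 * j + 1) / fact (2 * j + 1)))"
    unfolding bessel_I_def
  proof (intro suminf_cong)
    fix j
    have "(x/2) powr (1/2 + 2 * real j) * rGamma (1/2 + real j + 1) / fact j
      = (x/2) powr (- 1/2) * (x/2) ^ (2 * j + 1) * (rGamma (real j + 3/2) / fact j)"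
      unfolding pw by (simp add: algebra_simps)
    also have "\<dots> = ?z * (x ^ (2 * j + 1) / fact (2 * j + 1))"
      unfolding rGamma_half by (simp add: q[symmetric])
    finally show "(x/2) powr (1/2 + 2 * real j) * rGamma (1/2 + real j + 1) / fact j
      = ?z * (x ^ (2 * j + 1) / fact (2 * j + 1))" .
  qed
  have ce: "(\<lambda>j. x ^ (2 * j) / fact (2 * j)) sums cosh x"
  proof -
    have "(\<lambda>j. (\<lambda>n. if even n then x ^ n /\<^sub>R fact n else 0) (2 * j)) sums cosh x"
      using cosh_converges[of x]
      by (subst sums_mono_reindex) (auto simp: strict_mono_def dvd_def)
    then show ?thesis by (simp add: field_simps)
  qed
  have so: "(\<lambda>j. x ^ (2 * j + 1) / fact (2 * j + 1)) sums sinh x"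
  proof -
    have "(\<lambda>j. (\<lambda>n. if even n then 0 else x ^ n /\<^sub>R fact n) (2 * j + 1)) sums sinh x"
      using sinh_converges[of x]
      by (subst sums_mono_reindex) (auto simp: strict_mono_def image_iff elim!: oddE)
    then show ?thesis by (simp add: field_simps)
  qed
  have e': "bessel_I (- 1/2) x = ?z * cosh x" unfolding e
    using sums_mult[OF ce, of ?z] by (simp add: sums_iff)
  have o': "bessel_I (1/2) x = ?z * sinh x" unfolding o
    using sums_mult[OF so, of ?z] by (simp add: sums_iff)
  have ni: "(1/2::real) \<notin> \<int>"
    using half_not_Ints[of 0] by simp
  have "bessel_K (1/2) x = pi / 2 * ?z * (cosh x - sinh x)"
    unfolding bessel_K_nonint[OF ni] minus_divide_left e' o' by (simp add: right_diff_distrib)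
  also have "cosh x - sinh x = exp (- x)" by (simp add: cosh_def sinh_def field_simps)
  also have "?z = x powr (- 1/2) * (sqrt 2 / sqrt pi)"
  proof -
    have "(x/2) powr (- 1/2) = x powr (- 1/2) / 2 powr (- 1/2)"
      using assms by (simp add: powr_divide)
    also have "2 powr (- 1/2) = 1 / sqrt (2::real)"
      by (simp add: powr_minus powr_half_sqrt field_simps)
    finally show ?thesis by simp
  qed
  also have "pi / 2 * (x powr (- 1/2) * (sqrt 2 / sqrt pi)) * exp (- x)
    = (pi / 2 * (sqrt 2 / sqrt pi)) * x powr (- 1/2) * exp (- x)" by simp
  also have "pi / 2 * (sqrt 2 / sqrt pi) = sqrt (pi / 2)"
  proof -
    have "sqrt (pi/2) * sqrt (pi/2) = pi / 2" by simp
    then have "pi / 2 * (sqrt 2 / sqrt pi) = sqrt (pi/2) * (sqrt (pi/2) * (sqrt 2 / sqrt pi))"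
      by (simp only: mult.assoc[symmetric])
    also have "sqrt (pi/2) * (sqrt 2 / sqrt pi) = 1" by (simp add: real_sqrt_divide)
    finally show ?thesis by simp
  qed
  finally show ?thesis .
qed

text \<open>The reverse Bessel polynomials: for \<open>\<nu> = n + 1/2\<close> the function
  \<open>x powr \<nu> * bessel_K \<nu> x\<close> is a constant times \<open>exp (- x)\<close> times
  such a polynomial, and the recursion is \<open>bessel_K_recurrence\<close> multiplied by a power
  of \<open>x\<close>.\<close>

fun rev_bessel :: "nat \<Rightarrow> real poly" where
  "rev_bessel 0 = 1"
| "rev_bessel (Suc 0) = [:1, 1:]"
| "rev_bessel (Suc (Suc n)) = Polynomial.smult (2 * real n + 3) (rev_bessel (Suc n)) + [:0, 0, 1:] * rev_bessel n"

lemma bessel_K_half_integer: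
  assumes "x > 0"
  shows "x powr (real n + 1/2) * bessel_K (real n + 1/2) x
           = sqrt (pi / 2) * exp (- x) * poly (rev_bessel n) x"
proof (induction n rule: rev_bessel.induct)
  case 1
  have "x powr (real 0 + 1/2) * bessel_K (real 0 + 1/2) x
    = (x powr (1/2) * x powr (- 1/2)) * (sqrt (pi / 2) * exp (- x))"
    by (simp add: bessel_K_half[OF assms])
  also have "x powr (1/2) * x powr (- 1/2) = 1" using assms by (simp add: powr_add[symmetric])
  finally show ?case by simp
next
  case 2
  \<comment> \<open>The recurrence at order 1/2 reaches down to -1/2, so evenness in the order
    closes this case.\<close>
  have e: "bessel_K (- 1/2) x = bessel_K (1/2) x"
  proof -
    have "(1/2::real) \<notin> \<int>" "(- 1/2::real) \<notin> \<int>"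
      using half_not_Ints[of 0] minus_in_Ints_iff[of "1/2::real"] by auto
    then show ?thesis by (simp add: bessel_K_nonint right_diff_distrib diff_divide_distrib)
  qed
  have "bessel_K (1/2 + 1) x = bessel_K (1/2 - 1) x + 2 * (1/2) / x * bessel_K (1/2) x"
    by (intro bessel_K_recurrence assms) (use half_not_Ints[of 0] in simp)
  then have K: "bessel_K (3/2) x = bessel_K (1/2) x * (1 + 1 / x)"
    using e by (simp add: ring_distribs)
  have "x powr (real (Suc 0) + 1/2) * bessel_K (real (Suc 0) + 1/2) x
    = (x powr (3/2) * x powr (- 1/2)) * (1 + 1/x) * (sqrt (pi / 2) * exp (- x))"
    by (simp add: K bessel_K_half[OF assms])
  also have "x powr (3/2) * x powr (- 1/2) = x" using assms by (simp add: powr_add[symmetric])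
  also have "x * (1 + 1/x) = 1 + x" using assms by (simp add: field_simps)
  finally show ?case by simp
next
  case (3 n)
  have "bessel_K (real (Suc n) + 1/2 + 1) x
    = bessel_K (real (Suc n) + 1/2 - 1) x + 2 * (real (Suc n) + 1/2) / x * bessel_K (real (Suc n) + 1/2) x"
    by (intro bessel_K_recurrence assms half_not_Ints)
  then have K: "bessel_K (real (Suc (Suc n)) + 1/2) x
    = bessel_K (real n + 1/2) x + (2 * real n + 3) / x * bessel_K (real (Suc n) + 1/2) x"
    by (simp add: algebra_simps)
  have p1: "x powr (real (Suc (Suc n)) + 1/2) = x powr (real (Suc n) + 1/2) * x"
    using assms powr_add[of x "real (Suc n) + 1/2" 1] by (simp add: algebra_simps)
  have p2: "x powr (real (Suc n) + 1/2) = x powr (real n + 1/2) * x"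
    using assms powr_add[of x "real n + 1/2" 1] by (simp add: algebra_simps)
  have "x powr (real (Suc (Suc n)) + 1/2) * bessel_K (real (Suc (Suc n)) + 1/2) x
    = x * x * (x powr (real n + 1/2) * bessel_K (real n + 1/2) x)
      + (2 * real n + 3) * (x powr (real (Suc n) + 1/2) * bessel_K (real (Suc n) + 1/2) x)"
  proof -
    have gen: "a * x * x * (y + l / x * z) = x * x * (a * y) + l * (a * x * z)" for a y z l :: real
      using assms by (simp add: ring_distribs)
    show ?thesis unfolding K p1 p2 by (rule gen)
  qed
  then show ?case unfolding 3 by (simp add: algebra_simps)
qed

text \<open>The value is the double factorial (2n - 1)!!. It makes the closed form for positive lags
  reproduce the prescribed variance at lag 0.\<close>

lemma poly_rev_bessel_0:
  "poly (rev_bessel n) 0 = fact n * 2 ^ n * Gamma (real n + 1/2) / (Gamma (real n + 1) * sqrt pi)"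
proof -
  have "poly (rev_bessel n) 0 = 2 ^ n * Gamma (real n + 1/2) / sqrt pi"
  proof (induction n rule: rev_bessel.induct)
    case 1
    then show ?case by (simp add: Gamma_one_half_real)
  next
    case 2
    have "Gamma (1/2 + 1) = (1/2::real) * Gamma (1/2)"
      by (intro Gamma_plus1) (use nonpos_Ints_nonpos[of "1/2::real"] in auto)
    then show ?case by (simp add: Gamma_one_half_real)
  next
    case (3 n)
    have "Gamma (real (Suc (Suc n)) + 1/2) = (real (Suc n) + 1/2) * Gamma (real (Suc n) + 1/2)"
    proof -
      have "real (Suc n) + 1/2 \<notin> \<int>\<^sub>\<le>\<^sub>0"
        using nonpos_Ints_nonpos[of "real (Suc n) + 1/2"] by auto
      from Gamma_plus1[OF this] show ?thesis by (simp add: algebra_simps)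
    qed
    then have "2 ^ Suc (Suc n) * Gamma (real (Suc (Suc n)) + 1/2) / sqrt pi
      = (2 * real n + 3) * (2 ^ Suc n * Gamma (real (Suc n) + 1/2) / sqrt pi)"
      by (simp add: ring_distribs add_divide_distrib)
    then show ?case unfolding 3(1)[symmetric] by simp
  qed
  then show ?thesis using Gamma_fact[of n, where ?'a = real] by (simp add: add.commute)
qed

text \<open>Dividing the variance by \<open>gamma_ratio\<close> cancels the Gamma values at
  half-integers. Both branches of \<open>matern\<close> are covered, so on nonnegative lags the
  covariance is the restriction of a smooth function.\<close>

lemma matern_half_integer:
  assumes "\<kappa> > 0"
  shows "matern h (real n + 1/2) \<kappa> (g / gamma_ratio (real n + 1))
    = g * sqrt pi / (2 ^ n * fact n) * exp (- (\<kappa> * \<bar>h\<bar>)) * poly (rev_bessel n) (\<kappa> * \<bar>h\<bar>)"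
proof -
  have G: "Gamma (real n + 1) = fact n" "Gamma (1 + real n) = fact n" using Gamma_fact[of n, where ?'a = real] by (simp_all add: add.commute)
  have p: "Gamma (real n + 1/2) > 0" by (intro Gamma_real_pos) simp
  have gr: "gamma_ratio (real n + 1) = fact n / Gamma (real n + 1/2)"
    unfolding gamma_ratio_def G by (simp add: algebra_simps)
  show ?thesis
  proof (cases "h = 0")
    case True
    then show ?thesis
      unfolding gr matern_def by (simp add: poly_rev_bessel_0 G)
  next
    case False
    have w: "2 powr (real n + 1/2 - 1) = 2 ^ n / sqrt 2"
    proof -
      have "2 powr (real n + 1/2 - 1) = 2 powr real n * (2::real) powr (- (1/2))"
        by (simp add: powr_add[symmetric])
      then show ?thesis by (simp add: powr_realpow powr_minus powr_half_sqrt) (simp only: divide_inverse)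
    qed
    have "(\<kappa> * \<bar>h\<bar>) powr (real n + 1/2) * bessel_K (real n + 1/2) (\<kappa> * \<bar>h\<bar>)
           = sqrt (pi / 2) * exp (- (\<kappa> * \<bar>h\<bar>)) * poly (rev_bessel n) (\<kappa> * \<bar>h\<bar>)"
      using False assms by (intro bessel_K_half_integer) auto
    then have "matern h (real n + 1/2) \<kappa> (g / gamma_ratio (real n + 1))
      = g / gamma_ratio (real n + 1) / (2 powr (real n + 1/2 - 1) * Gamma (real n + 1/2)) *
       (sqrt (pi / 2) * exp (- (\<kappa> * \<bar>h\<bar>)) * poly (rev_bessel n) (\<kappa> * \<bar>h\<bar>))"
      using False by (simp add: matern_def)
    also have "\<dots> = g * sqrt pi / (2 ^ n * fact n) * exp (- (\<kappa> * \<bar>h\<bar>)) * poly (rev_bessel n) (\<kappa> * \<bar>h\<bar>)"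
    proof -
      have nz: "Gamma (real n + 1/2) \<noteq> 0" using p by linarith
      have "a / (f / G) / (q / r * G) * (z / r * e * y) = a * z / (q * f) * e * y"
        if "f \<noteq> 0" "G \<noteq> 0" "q \<noteq> 0" "r \<noteq> 0" for a f G q r z e y :: real
        using that by (simp add: divide_simps)
      then show ?thesis unfolding w gr real_sqrt_divide 
        by this (rule nz | simp)+
    qed
    finally show ?thesis .
  qed
qed

section \<open>Differential equations with constant coefficients\<close>

text \<open>A smooth function is represented by the sequence of all its derivatives, so that differential
  operators act by index shifts; \<open>annihilated ls f\<close> says that \<open>f 0\<close> is killed by the product of the
  operators \<open>D + l\<close>, \<open>l\<close> in \<open>ls\<close>.\<close>

definition deriv_tower :: "(nat \<Rightarrow> real \<Rightarrow> real) \<Rightarrow> bool" where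
  "deriv_tower f \<longleftrightarrow> (\<forall>k x. (f k has_real_derivative f (Suc k) x) (at x))"

fun annihilated :: "real list \<Rightarrow> (nat \<Rightarrow> real \<Rightarrow> real) \<Rightarrow> bool" where
  "annihilated [] f \<longleftrightarrow> (\<forall>k x. f k x = 0)"
| "annihilated (l # ls) f \<longleftrightarrow> annihilated ls (\<lambda>k x. f (Suc k) x + l * f k x)"

lemma annihilated_zero: "(\<And>k x. f k x = 0) \<Longrightarrow> annihilated ls f"
  by (induction ls arbitrary: f) auto

lemma annihilated_scale: "annihilated ls f \<Longrightarrow> annihilated ls (\<lambda>k x. C * f k x)"
proof (induction ls arbitrary: f)
  case (Cons l ls)
  from Cons.IH[OF Cons.prems[unfolded annihilated.simps]] show ?case
    by (simp add: algebra_simps)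
qed simp

lemma annihilated_add:
  "annihilated ls f \<Longrightarrow> annihilated ls g \<Longrightarrow> annihilated ls (\<lambda>k x. f k x + g k x)"
proof (induction ls arbitrary: f g)
  case (Cons l ls)
  from Cons.IH[OF Cons.prems[unfolded annihilated.simps]] show ?case
    by (simp add: algebra_simps)
qed simp

lemma annihilated_sum:
  "(\<And>i. i \<in> A \<Longrightarrow> annihilated ls (f i)) \<Longrightarrow> annihilated ls (\<lambda>k x. \<Sum>i\<in>A. f i k x)"
  by (induction A rule: infinite_finite_induct) (auto intro: annihilated_zero annihilated_add)

lemma annihilated_shift: "annihilated ls f \<Longrightarrow> annihilated ls (\<lambda>k x. f (j + k) x)"
proof (induction ls arbitrary: f)
  case (Cons l ls)
  from Cons.IH[OF Cons.prems[unfolded annihilated.simps]] show ?case by simp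
qed simp

lemma annihilated_translate: "annihilated ls f \<Longrightarrow> annihilated ls (\<lambda>k x. f k (h + x))"
proof (induction ls arbitrary: f)
  case (Cons l ls)
  from Cons.IH[OF Cons.prems[unfolded annihilated.simps]] show ?case by simp
qed simp

text \<open>The operators have constant coefficients: applying \<open>D + l\<close> keeps a function
  in the kernel of the remaining product.\<close>

lemma annihilated_Cons: "annihilated ls f \<Longrightarrow> annihilated (l # ls) f"
  using annihilated_add[OF annihilated_shift[of ls f 1] annihilated_scale[of ls f l]] by simp

lemma annihilated_dilate:
  "annihilated ls f \<Longrightarrow> annihilated (map ((*) \<kappa>) ls) (\<lambda>k x. C * \<kappa> ^ k * f k (\<kappa> * x))"
proof (induction ls arbitrary: f C)
  case (Cons l ls)
  from Cons.IH[OF Cons.prems[unfolded annihilated.simps], of "C * \<kappa>"] show ?case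
    by (simp add: algebra_simps)
qed simp

lemma deriv_tower_D: "deriv_tower f \<Longrightarrow> (f k has_real_derivative f (Suc k) x) (at x)"
  by (simp add: deriv_tower_def)

lemma deriv_tower_add:
  "deriv_tower f \<Longrightarrow> deriv_tower g \<Longrightarrow> deriv_tower (\<lambda>k x. f k x + g k x)"
  unfolding deriv_tower_def by (auto intro!: derivative_eq_intros)

lemma deriv_tower_scale: "deriv_tower f \<Longrightarrow> deriv_tower (\<lambda>k x. C * f k x)"
  unfolding deriv_tower_def by (auto intro!: derivative_eq_intros)

lemma deriv_tower_sum:
  "(\<And>i. i \<in> A \<Longrightarrow> deriv_tower (f i)) \<Longrightarrow> deriv_tower (\<lambda>k x. \<Sum>i\<in>A. f i k x)"
  unfolding deriv_tower_def by (auto intro!: DERIV_sum)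

lemma deriv_tower_shift: "deriv_tower f \<Longrightarrow> deriv_tower (\<lambda>k x. f (j + k) x)"
  unfolding deriv_tower_def by simp

lemma deriv_tower_dilate:
  "deriv_tower f \<Longrightarrow> deriv_tower (\<lambda>k x. C * \<kappa> ^ k * f k (\<kappa> * x))"
  unfolding deriv_tower_def
proof (intro allI)
  fix k x assume f: "\<forall>k x. (f k has_real_derivative f (Suc k) x) (at x)"
  have "((\<lambda>x. f k (\<kappa> * x)) has_real_derivative f (Suc k) (\<kappa> * x) * \<kappa>) (at x)"
    by (rule DERIV_chain2[where g = "(*) \<kappa>"]) (use f in \<open>auto intro!: derivative_eq_intros\<close>)
  from DERIV_cmult[OF this, of "C * \<kappa> ^ k"]
  show "((\<lambda>x. C * \<kappa> ^ k * f k (\<kappa> * x)) has_real_derivative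
    C * \<kappa> ^ Suc k * f (Suc k) (\<kappa> * x)) (at x)"
    by (simp add: mult_ac)
qed

lemma deriv_tower_translate: "deriv_tower f \<Longrightarrow> deriv_tower (\<lambda>k x. f k (h + x))"
  unfolding deriv_tower_def
proof (intro allI)
  fix k x assume f: "\<forall>k x. (f k has_real_derivative f (Suc k) x) (at x)"
  then have "(f k has_real_derivative f (Suc k) (x + h)) (at (x + h))" by blast
  then have "((\<lambda>x. f k (x + h)) has_real_derivative f (Suc k) (x + h)) (at x)"
    by (simp only: DERIV_shift)
  then show "((\<lambda>x. f k (h + x)) has_real_derivative f (Suc k) (h + x)) (at x)"
    by (simp add: add.commute)
qed

text \<open>Induction on the factors: \<open>D + l\<close> maps \<open>f\<close> to a solution of
  the shorter equation with zero initial data, so \<open>f\<close> solves a first-order equation,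
  for which \<open>exp (l * x)\<close> is the integrating factor.\<close>

lemma annihilated_unique_zero:
  assumes "deriv_tower f" "annihilated ls f" "\<And>k. k < length ls \<Longrightarrow> f k x0 = 0"
  shows "f k x = 0"
  using assms
proof (induction ls arbitrary: f k x)
  case (Cons l ls)
  let ?g = "\<lambda>k x. f (Suc k) x + l * f k x"
  have g: "deriv_tower ?g"
    using deriv_tower_add[OF deriv_tower_shift[of f 1] deriv_tower_scale[of f l]] Cons.prems(1)
    by simp
  have "?g k x = 0" for k x
  proof (rule Cons.IH[OF g])
    show "annihilated ls ?g" using Cons.prems(2) by simp
    show "?g k x0 = 0" if "k < length ls" for k
      using Cons.prems(3)[of k] Cons.prems(3)[of "Suc k"] that by simp
  qed
  then have rec: "f (Suc k) x = - l * f k x" for k x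
    by (simp add: eq_neg_iff_add_eq_0)
  have "((\<lambda>x. f 0 x * exp (l * x)) has_real_derivative 0) (at x)" for x
    using rec[of 0 x]
    by (auto intro!: derivative_eq_intros deriv_tower_D[OF Cons.prems(1)] simp: algebra_simps)
  then have "f 0 x * exp (l * x) = f 0 x0 * exp (l * x0)" for x
    using DERIV_isconst_all by blast
  then have f0: "f 0 x = 0" for x
    using Cons.prems(3)[of 0] by simp
  show ?case
    by (induction k arbitrary: x) (simp_all add: f0 rec)
qed simp

lemma annihilated_unique:
  assumes "deriv_tower f" "deriv_tower g" "annihilated ls f" "annihilated ls g"
    and "\<And>k. k < length ls \<Longrightarrow> f k x0 = g k x0"
  shows "f k x = g k x"
proof -
  let ?h = "\<lambda>k x. f k x + (- 1) * g k x"
  have "deriv_tower ?h" by (rule deriv_tower_add[OF assms(1) deriv_tower_scale[OF assms(2)]])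
  moreover have "annihilated ls ?h" by (rule annihilated_add[OF assms(3) annihilated_scale[OF assms(4)]])
  ultimately have "?h k x = 0"
    by (rule annihilated_unique_zero[where ?x0.0 = x0]) (use assms(5) in simp)
  then show ?thesis by simp
qed

text \<open>\<open>f\<close> is the covariance function at nonnegative lags. \<open>odd_zero\<close>
  says that its even extension is \<open>2 * d - 2\<close> times continuously differentiable, as
  suits a process with \<open>d - 1\<close> mean-square derivatives; \<open>top\<close> says that
  the derivative of order \<open>2 * d - 1\<close> jumps with the sign of a positive noise
  intensity.\<close>

locale markov_tower =
  fixes d :: nat and ls :: "real list" and f :: "nat \<Rightarrow> real \<Rightarrow> real"
  assumes tower: "deriv_tower f" and ann: "annihilated ls f" and len: "length ls = d"
    and d_pos: "d > 0"
    and odd_zero: "\<And>k. odd k \<Longrightarrow> k < 2 * d - 1 \<Longrightarrow> f k 0 = 0"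
    and top: "(- 1) ^ d * f (2 * d - 1) 0 > 0"
begin

text \<open>Terms with \<open>b + c\<close> odd cancel against their mirror images because of the sign, those with
  \<open>b + c\<close> even involve an odd derivative, which vanishes unless it is the top one.\<close>

lemma quadratic_form:
  assumes "0 < e" "e \<le> d"
  shows "(\<Sum>b<e. \<Sum>c<e. (- 1) ^ b * w b * w c * f (b + c + 1 + 2 * (d - e)) 0)
    = (- 1) ^ (e - 1) * (w (e - 1))\<^sup>2 * f (2 * d - 1) 0"
proof -
  define T where "T = (\<lambda>b c. (- 1) ^ b * w b * w c * f (b + c + 1 + 2 * (d - e)) 0)"
  define X where "X = (- 1) ^ (e - 1) * (w (e - 1))\<^sup>2 * f (2 * d - 1) 0"
  \<comment> \<open>The shift by \<open>2 * (d - e)\<close> makes the corner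
    \<open>b = c = e - 1\<close> carry the derivative of order \<open>2 * d - 1\<close> for a
    truncated form as well, which permits peeling off coordinates later.\<close>
  have TT: "T b c + T c b = (if c = e - 1 then if b = e - 1 then 2 * X else 0 else 0)"
    if "b < e" "c < e" for b c
  proof (cases "b = e - 1 \<and> c = e - 1")
    case True
    have "e - 1 + (e - 1) + 1 + 2 * (d - e) = 2 * d - 1" using assms by simp
    then have "T (e - 1) (e - 1) = X" by (simp only: T_def X_def power2_eq_square mult.assoc)
    then show ?thesis using True by simp
  next
    case False
    have i: "b + c + 1 + 2 * (d - e) < 2 * d - 1" using False that assms by auto
    have "((- 1) ^ b + (- 1) ^ c) * f (b + c + 1 + 2 * (d - e)) 0 = 0"
    proof (cases "even (b + c)")
      case True
      then show ?thesis using odd_zero[OF _ i] by simp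
    next
      case False
      then have "(- 1) ^ b + (- 1) ^ c = (0 :: real)" by (cases "even b") auto
      then show ?thesis by simp
    qed
    then have "w b * w c * (((- 1) ^ b + (- 1) ^ c) * f (b + c + 1 + 2 * (d - e)) 0) = 0" by simp
    then have "T b c + T c b = 0" by (simp add: T_def algebra_simps)
    with False show ?thesis by auto
  qed
  have "2 * (\<Sum>b<e. \<Sum>c<e. T b c) = (\<Sum>b<e. \<Sum>c<e. T b c) + (\<Sum>b<e. \<Sum>c<e. T c b)"
    using sum.swap[of T "{..<e}" "{..<e}"] by simp
  also have "\<dots> = (\<Sum>b<e. \<Sum>c<e. T b c + T c b)" by (simp add: sum.distrib)
  also have "\<dots> = (\<Sum>b<e. \<Sum>c<e. if c = e - 1 then if b = e - 1 then 2 * X else 0 else 0)"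
    by (intro sum.cong refl TT) auto
  also have "\<dots> = 2 * X" using assms by simp
  finally show ?thesis by (simp add: T_def X_def)
qed

text \<open>If only the first \<open>e\<close> weights may be nonzero, suitable hypotheses weighted
  by \<open>(- 1) ^ b * w b\<close> add up to the quadratic form above, a nonzero multiple of the
  square of \<open>w (e - 1)\<close>. So the weights vanish from the top downwards.\<close>

lemma hankel_injective:
  assumes "\<And>k. (\<Sum>c<d. w c * f (c + k) 0) = 0"
  shows "c < d \<Longrightarrow> w c = 0"
proof -
  have "\<forall>c. d - j \<le> c \<and> c < d \<longrightarrow> w c = 0" if "j \<le> d" for j
    using that
  proof (induction j)
    case (Suc j)
    let ?e = "d - j"
    have e: "0 < ?e" "?e \<le> d" using Suc.prems by auto
    have z: "(\<Sum>c<?e. w c * f (c + k) 0) = 0" for k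
    proof -
      have "(\<Sum>c<d. w c * f (c + k) 0) = (\<Sum>c<?e. w c * f (c + k) 0)"
        using Suc by (intro sum.mono_neutral_right) auto
      then show ?thesis using assms by simp
    qed
    have "(\<Sum>b<?e. \<Sum>c<?e. (- 1) ^ b * w b * w c * f (b + c + 1 + 2 * (d - ?e)) 0)
      = (\<Sum>b<?e. (- 1) ^ b * w b * (\<Sum>c<?e. w c * f (c + (b + 1 + 2 * (d - ?e))) 0))"
      by (simp add: sum_distrib_left mult.assoc add_ac)
    also have "\<dots> = 0" by (simp only: z mult_zero_right sum.neutral_const)
    finally have "(w (?e - 1))\<^sup>2 * f (2 * d - 1) 0 = 0"
      unfolding quadratic_form[OF e] by simp
    then have "w (?e - 1) = 0" using top by auto
    moreover have "c = ?e - 1 \<or> d - j \<le> c" if "d - Suc j \<le> c" for c using that by auto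
    ultimately show ?case using Suc by (metis Suc_leD)
  qed simp
  from this[of d] show "c < d \<Longrightarrow> w c = 0" by simp
qed

text \<open>The sign comes from differentiating the covariance at lag \<open>s - t\<close> in
  \<open>t\<close>; the entry is the covariance of the derivatives of orders \<open>a\<close> and
  \<open>b\<close> at one location.\<close>

definition R :: "nat \<Rightarrow> nat \<Rightarrow> real" where "R a b = (- 1) ^ b * f (a + b) 0"

lemma R_sym: "a < d \<Longrightarrow> b < d \<Longrightarrow> R a b = (- 1) ^ a * f (a + b) 0"
proof (cases "even (a + b)")
  case True
  then have "(- 1) ^ a = ((- 1) ^ b :: real)" by (cases "even a") auto
  then show ?thesis by (simp add: R_def)
next
  case False
  moreover assume "a < d" "b < d"
  ultimately have "f (a + b) 0 = 0" by (intro odd_zero) auto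
  then show ?thesis by (simp add: R_def)
qed

lemma combination_tower:
  "deriv_tower (\<lambda>k x. \<Sum>c\<in>A. w c * f (c + k) x)"
  "annihilated ls (\<lambda>k x. \<Sum>c\<in>A. w c * f (c + k) x)"
proof -
  show "deriv_tower (\<lambda>k x. \<Sum>c\<in>A. w c * f (c + k) x)"
    by (rule deriv_tower_sum, rule deriv_tower_scale, rule deriv_tower_shift[OF tower])
  show "annihilated ls (\<lambda>k x. \<Sum>c\<in>A. w c * f (c + k) x)"
    by (rule annihilated_sum, rule annihilated_scale, rule annihilated_shift[OF ann])
qed

lemma R_kernel:
  assumes "\<And>a. a < d \<Longrightarrow> (\<Sum>b<d. R a b * v b) = 0" "c < d"
  shows "v c = 0"
proof -
  define w where "w = (\<lambda>c. (- 1) ^ c * v c)"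
  have "(\<Sum>c<d. w c * f (c + k) x) = 0" for k x
  proof (rule annihilated_unique_zero[OF combination_tower])
    fix k assume "k < length ls"
    with assms(1)[of k] show "(\<Sum>c<d. w c * f (c + k) 0) = 0"
      by (simp add: len R_def w_def mult_ac add_ac)
  qed
  from hankel_injective[OF this assms(2)] show ?thesis by (simp add: w_def)
qed

text \<open>As functions of \<open>z\<close> both sides solve the differential equation, so it
  suffices to match derivatives of order below \<open>d\<close> at \<open>z = 0\<close>. Since
  \<open>R\<close> is invertible, the derivatives of \<open>f\<close> of orders 0 to
  \<open>d - 1\<close> span all solutions, and \<open>W\<close> gives the coordinates; for
  \<open>v\<close> a unit vector this is the Markov property.\<close>

lemma propagate:
  assumes R_Ri: "\<And>a b. a < d \<Longrightarrow> b < d \<Longrightarrow> (\<Sum>c<d. R a c * Ri c b) = (if a = b then 1 else 0)"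
    and "y0 = (\<lambda>k. \<Sum>a<d. v a * f (a + k) x)"
  defines "W \<equiv> \<lambda>c. \<Sum>b<d. Ri c b * ((- 1) ^ b * y0 b)"
  shows "(\<Sum>a<d. v a * f (a + k) (x + z)) = (\<Sum>c<d. W c * f (c + k) z)"
proof (rule annihilated_unique[where ls = ls and ?x0.0 = 0 and k = k and x = z
      and f = "\<lambda>k z. \<Sum>a<d. v a * f (a + k) (x + z)" and g = "\<lambda>k z. \<Sum>c<d. W c * f (c + k) z"])
  show "deriv_tower (\<lambda>k z. \<Sum>a<d. v a * f (a + k) (x + z))"
    by (rule deriv_tower_translate[OF combination_tower(1)])
  show "annihilated ls (\<lambda>k z. \<Sum>a<d. v a * f (a + k) (x + z))"
    by (rule annihilated_translate[OF combination_tower(2)])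
  fix k assume "k < length ls"
  then have k: "k < d" by (simp add: len)
  have sgn: "(- 1) ^ k * (- 1) ^ k = (1 :: real)" by (simp flip: power_mult_distrib)
  have "(\<Sum>c<d. W c * f (c + k) 0) = (- 1) ^ k * (\<Sum>c<d. R k c * W c)"
    unfolding sum_distrib_left
  proof (intro sum.cong refl)
    fix c assume "c \<in> {..<d}"
    then have "(- 1) ^ k * (R k c * W c) = ((- 1) ^ k * (- 1) ^ k) * (W c * f (c + k) 0)"
      using k by (simp add: R_sym add.commute)
    then show "W c * f (c + k) 0 = (- 1) ^ k * (R k c * W c)" by (simp only: sgn mult_1)
  qed
  also have "(\<Sum>c<d. R k c * W c) = (\<Sum>b<d. (\<Sum>c<d. R k c * Ri c b) * ((- 1) ^ b * y0 b))"
    unfolding W_def sum_distrib_left sum_distrib_right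
    by (subst sum.swap) (simp add: mult.assoc)
  also have "\<dots> = (\<Sum>b<d. if k = b then (- 1) ^ b * y0 b else 0)"
    using k by (intro sum.cong refl) (simp add: R_Ri)
  also have "\<dots> = (- 1) ^ k * y0 k" using k by simp
  finally show "(\<Sum>a<d. v a * f (a + k) (x + 0)) = (\<Sum>c<d. W c * f (c + k) 0)"
    using sgn by (simp add: assms(2) flip: mult.assoc)
qed (rule combination_tower)+

text \<open>The quadratic form \<open>Q x\<close> below is \<open>v\<close> applied to \<open>r(x) Ri r(x)\<^sup>T\<close>. Its derivative is, up to a
  negative factor, the square of the last coordinate \<open>W x (d - 1)\<close> of \<open>Ri r(x)\<^sup>T v\<close>. If \<open>Q h = Q 0\<close>, this coordinate
  vanishes on the interval between, and \<open>v\<close> is read off from its derivatives at 0, since \<open>y\<close>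
  has the initial data of the fundamental solution.\<close>

lemma schur_kernel:
  fixes v :: "nat \<Rightarrow> real"
  assumes R_Ri: "\<And>a b. a < d \<Longrightarrow> b < d \<Longrightarrow> (\<Sum>c<d. R a c * Ri c b) = (if a = b then 1 else 0)"
    and Ri_sym: "\<And>a b. a < d \<Longrightarrow> b < d \<Longrightarrow> Ri a b = Ri b a"
    and h: "h > 0"
  defines "Y \<equiv> \<lambda>b x. (- 1) ^ b * (\<Sum>a<d. v a * f (a + b) x)"
  assumes q0: "(\<Sum>b<d. \<Sum>c<d. Ri b c * Y b h * Y c h) = (\<Sum>b<d. \<Sum>c<d. Ri b c * Y b 0 * Y c 0)"
    and c: "c < d"
  shows "v c = 0"
proof -
  define Q where "Q = (\<lambda>x. \<Sum>b<d. \<Sum>c<d. Ri b c * Y b x * Y c x)"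
  define W where "W = (\<lambda>x c. \<Sum>b<d. Ri c b * Y b x)"
  define Y' where "Y' = (\<lambda>b x. (- 1) ^ b * (\<Sum>a<d. v a * f (a + Suc b) x))"
  \<comment> \<open>Twice the quantity in \<open>top\<close>: symmetry of \<open>Ri\<close> makes
    the two halves of the product rule equal. This is the intensity of the driving noise.\<close>
  define g where "g = 2 * ((- 1) ^ d * f (2 * d - 1) 0)"
  have g: "g > 0" using top by (simp add: g_def)
  have DY: "(Y b has_real_derivative Y' b x) (at x)" for b x
    unfolding Y_def Y'_def
    using deriv_tower_D[OF combination_tower(1)] by (auto intro!: DERIV_cmult)
  have moved: "(\<Sum>a<d. v a * f (a + k) (x + z)) = (\<Sum>c<d. W x c * f (c + k) z)" for k x z
    unfolding W_def Y_def by (rule propagate[OF R_Ri]) simp_all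
  have DQ: "(Q has_real_derivative - g * (W x (d - 1))\<^sup>2) (at x)" for x
  proof -
    have "(Q has_real_derivative (\<Sum>b<d. \<Sum>c<d. Ri b c * Y' b x * Y c x + Ri b c * Y b x * Y' c x)) (at x)"
      unfolding Q_def by (auto intro!: derivative_eq_intros DERIV_sum DY sum.cong simp: algebra_simps)
    moreover have "(\<Sum>b<d. \<Sum>c<d. Ri b c * Y b x * Y' c x) = (\<Sum>b<d. \<Sum>c<d. Ri b c * Y' b x * Y c x)"
      by (subst sum.swap) (auto intro!: sum.cong simp: Ri_sym mult_ac)
    moreover have "(\<Sum>b<d. \<Sum>c<d. Ri b c * Y' b x * Y c x) = (\<Sum>b<d. W x b * Y' b x)"
      unfolding W_def sum_distrib_right by (auto intro!: sum.cong simp: mult_ac)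
    \<comment> \<open>Differentiating \<open>Y b\<close> raises the order by one;
      \<open>moved\<close> with \<open>z = 0\<close> expresses the result through \<open>W x\<close>
      and derivatives at 0, a full quadratic form with \<open>e = d\<close>.\<close>
    moreover have "(\<Sum>b<d. W x b * Y' b x)
      = (\<Sum>b<d. \<Sum>c<d. (- 1) ^ b * W x b * W x c * f (b + c + 1 + 2 * (d - d)) 0)"
    proof -
      have "(\<Sum>a<d. v a * f (a + Suc b) x) = (\<Sum>c<d. W x c * f (c + Suc b) 0)" for b
        using moved[where x = x and z = 0 and k = "Suc b"] by simp
      then show ?thesis
        unfolding Y'_def by (simp add: sum_distrib_left mult_ac add_ac)
    qed
    moreover have "\<dots> = (- 1) ^ (d - 1) * (W x (d - 1))\<^sup>2 * f (2 * d - 1) 0"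
      by (rule quadratic_form) (use d_pos in auto)
    moreover have "(- 1) ^ d = - ((- 1) ^ (d - 1) :: real)"
      using d_pos by (cases d) auto
    ultimately show ?thesis by (simp add: sum.distrib g_def mult_ac)
  qed
  have mono: "Q y \<le> Q x" if "x \<le> y" for x y
    using that
  proof (rule DERIV_nonpos_imp_nonincreasing)
    fix u
    show "\<exists>D. (Q has_real_derivative D) (at u) \<and> D \<le> 0"
      using DQ[of u] g by (intro exI[of _ "- g * (W u (d - 1))\<^sup>2"]) auto
  qed
  have const: "Q x = Q 0" if "0 \<le> x" "x \<le> h" for x
    using mono[OF that(1)] mono[OF that(2)] q0 by (simp add: Q_def)
  have W0: "W x (d - 1) = 0" if x: "0 < x" "x < h" for x
  proof -
    have "((\<lambda>_. Q 0) has_real_derivative - g * (W x (d - 1))\<^sup>2) (at x)"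
    proof (rule has_field_derivative_transform_within_open[OF DQ])
      show "open {0<..<h}" "x \<in> {0<..<h}" using x by auto
      show "Q y = Q 0" if "y \<in> {0<..<h}" for y using const[of y] that by auto
    qed
    then have "- g * (W x (d - 1))\<^sup>2 = 0"
      using DERIV_unique DERIV_const by blast
    then show ?thesis using g by simp
  qed
  \<comment> \<open>Row \<open>d - 1\<close> of \<open>Ri\<close> combines the derivatives of
    \<open>f\<close> into the solution with initial data 0, ..., 0, 1, chosen so that
    \<open>Z 0 x\<close> is \<open>W x (d - 1)\<close>.\<close>
  define y where "y = (\<lambda>k x. \<Sum>b<d. (Ri (d - 1) b * (- 1) ^ b) * f (b + k) x)"
  define Z where "Z = (\<lambda>k x. \<Sum>a<d. v a * y (a + k) x)"
  have yt: "deriv_tower y" "annihilated ls y"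
    unfolding y_def by (rule combination_tower)+
  have Zt: "deriv_tower Z" "annihilated ls Z"
    unfolding Z_def
    by (rule deriv_tower_sum, rule deriv_tower_scale, rule deriv_tower_shift[OF yt(1)])
      (rule annihilated_sum, rule annihilated_scale, rule annihilated_shift[OF yt(2)])
  have ZW: "Z 0 x = W x (d - 1)" for x
    unfolding Z_def W_def Y_def y_def sum_distrib_left
    by (subst sum.swap) (auto intro!: sum.cong simp: mult_ac add_ac)
  have Zin: "Z k x = 0" if "0 < x" "x < h" for k x
    using that
  proof (induction k arbitrary: x)
    case 0
    then show ?case using ZW W0 by simp
  next
    case (Suc k)
    have "((\<lambda>_. 0) has_real_derivative Z (Suc k) x) (at x)"
    proof (rule has_field_derivative_transform_within_open[OF deriv_tower_D[OF Zt(1)]])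
      show "open {0<..<h}" "x \<in> {0<..<h}" using Suc.prems by auto
      show "Z k y = 0" if "y \<in> {0<..<h}" for y using Suc.IH that by auto
    qed
    then show ?case using DERIV_unique DERIV_const by blast
  qed
  \<comment> \<open>All derivatives vanish at an interior point, so uniqueness carries the zero
    function back to 0, where the initial data of \<open>y\<close> are known.\<close>
  have Z0: "Z k 0 = 0" for k
    using annihilated_unique_zero[OF Zt, of "h / 2"] Zin[of "h/2"] h by simp
  have y0: "y k 0 = (if k = d - 1 then 1 else 0)" if "k < d" for k
  proof -
    have "y k 0 = (\<Sum>b<d. R k b * Ri b (d - 1))"
      unfolding y_def R_def
    proof (intro sum.cong refl)
      fix b assume "b \<in> {..<d}"
      then have "Ri (d - 1) b = Ri b (d - 1)" using d_pos by (intro Ri_sym) auto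
      then show "Ri (d - 1) b * (- 1) ^ b * f (b + k) 0 = (- 1) ^ b * f (k + b) 0 * Ri b (d - 1)"
        by (simp add: add.commute)
    qed
    then show ?thesis using R_Ri[OF that, of "d - 1"] d_pos by simp
  qed
  have "\<forall>c. d - j \<le> c \<and> c < d \<longrightarrow> v c = 0" if "j \<le> d" for j
    using that
  proof (induction j)
    case (Suc j)
    let ?e = "d - j"
    have e: "0 < ?e" "?e \<le> d" using Suc.prems by auto
    \<comment> \<open>Triangular solution: only coefficients with \<open>a < d - j\<close> remain,
      so the orders \<open>a + j\<close> stay below \<open>d\<close> and just
      \<open>a = d - j - 1\<close> contributes.\<close>
    have "Z j 0 = (\<Sum>a<?e. v a * y (a + j) 0)"
      unfolding Z_def using Suc by (intro sum.mono_neutral_right) auto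
    also have "\<dots> = (\<Sum>a<?e. if a = ?e - 1 then v a else 0)"
      using e by (intro sum.cong refl) (auto simp: y0)
    also have "\<dots> = v (?e - 1)" using e by simp
    finally have "v (?e - 1) = 0" using Z0 by simp
    moreover have "c = ?e - 1 \<or> d - j \<le> c" if "d - Suc j \<le> c" for c using that by auto
    ultimately show ?case using Suc by (metis Suc_leD)
  qed simp
  from this[of d] c show ?thesis by simp
qed

end

section \<open>Precision matrices of Markov kernels\<close>

definition mat_inv :: "nat \<Rightarrow> real mat \<Rightarrow> real mat" where
  "mat_inv d A = (SOME B. B \<in> carrier_mat d d \<and> A * B = 1\<^sub>m d \<and> B * A = 1\<^sub>m d)"

lemma mat_inv:
  assumes "A \<in> carrier_mat d d" "Determinant.det A \<noteq> 0"
  shows "mat_inv d A \<in> carrier_mat d d" "A * mat_inv d A = 1\<^sub>m d" "mat_inv d A * A = 1\<^sub>m d"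
proof -
  have "A \<in> Units (ring_mat TYPE(real) d ())"
    using assms by (rule det_non_zero_imp_unit)
  then have "\<exists>B. B \<in> carrier_mat d d \<and> A * B = 1\<^sub>m d \<and> B * A = 1\<^sub>m d"
    by (auto simp: Units_def ring_mat_def)
  from someI_ex[OF this] show "mat_inv d A \<in> carrier_mat d d" "A * mat_inv d A = 1\<^sub>m d" "mat_inv d A * A = 1\<^sub>m d"
    by (auto simp: mat_inv_def)
qed

lemma mat_inv_transpose:
  assumes A: "A \<in> carrier_mat d d" and det: "Determinant.det A \<noteq> 0" and sym: "transpose_mat A = A"
  shows "transpose_mat (mat_inv d A) = mat_inv d A"
proof -
  note B = mat_inv[OF A det]
  let ?B = "mat_inv d A"
  have T: "transpose_mat ?B \<in> carrier_mat d d" using B(1) by simp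
  have "transpose_mat ?B * A = transpose_mat (A * ?B)"
    using transpose_mult[OF A B(1)] sym by simp
  then have "transpose_mat ?B * A = 1\<^sub>m d" using B(2) by simp
  then have "transpose_mat ?B * A * ?B = ?B" using B(1) by simp
  moreover have "transpose_mat ?B * A * ?B = transpose_mat ?B"
    using assoc_mult_mat[OF T A B(1)] B(2) T by simp
  ultimately show ?thesis by simp
qed

lemma det_nonzeroI:
  assumes A: "A \<in> carrier_mat d d"
    and inj: "\<And>v b. (\<And>a. a < d \<Longrightarrow> (\<Sum>b<d. A $$ (a, b) * v b) = 0) \<Longrightarrow> b < d \<Longrightarrow> v b = (0 :: real)"
  shows "Determinant.det A \<noteq> 0"
proof
  assume "Determinant.det A = 0"
  then obtain w where w: "w \<in> carrier_vec d" "w \<noteq> 0\<^sub>v d" "A *\<^sub>v w = 0\<^sub>v d"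
    using det_0_iff_vec_prod_zero_field[OF A] by blast
  have "(\<Sum>b<d. A $$ (a, b) * (w $ b)) = 0" if "a < d" for a
  proof -
    have "(A *\<^sub>v w) $ a = (\<Sum>b<d. A $$ (a, b) * (w $ b))"
      using A w(1) that by (simp add: scalar_prod_def lessThan_atLeast0)
    then show ?thesis using w(3) that by simp
  qed
  then have "w $ b = 0" if "b < d" for b
    using inj[of "\<lambda>b. w $ b"] that by blast
  then have "w = 0\<^sub>v d" using w(1) by (intro eq_vecI) auto
  with w(2) show False by simp
qed

section \<open>Block matrices\<close>

lemma sum_lessThan_times:
  "(\<Sum>x<n * d. f x) = (\<Sum>j<n. \<Sum>c<d. f (j * d + c))" for f :: "nat \<Rightarrow> 'a :: comm_monoid_add"
proof -
  have "(\<Sum>x<n * d. f x) = (\<Sum>j<n. sum f {j * d..<j * d + d})"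
    by (rule sum.nat_group[symmetric])
  also have "\<dots> = (\<Sum>j<n. \<Sum>c<d. f (j * d + c))"
  proof (rule sum.cong[OF refl])
    fix j
    show "sum f {j * d..<j * d + d} = (\<Sum>c<d. f (j * d + c))"
      using sum.shift_bounds_nat_ivl[of f 0 "j * d" d] by (simp add: add.commute lessThan_atLeast0)
  qed
  finally show ?thesis .
qed

definition block_square :: "nat \<Rightarrow> nat \<Rightarrow> (nat \<Rightarrow> nat \<Rightarrow> real mat) \<Rightarrow> real mat" where
  "block_square d n A = block_matrix d (map (\<lambda>j. map (\<lambda>l. A j l) [1..<n + 1]) [1..<n + 1])"

lemma block_square_dim [simp]:
  "dim_row (block_square d n A) = n * d" "dim_col (block_square d n A) = n * d"
  by (simp_all add: block_square_def block_matrix_def)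

lemma block_square_index:
  assumes "x < n * d" "y < n * d"
  shows "block_square d n A $$ (x, y) = A (x div d + 1) (y div d + 1) $$ (x mod d, y mod d)"
proof -
  have "x div d < n" "y div d < n" using assms by (auto simp: less_mult_imp_div_less)
  then show ?thesis
    using assms by (simp add: block_square_def block_matrix_def del: upt_Suc)
qed

lemma block_square_inverse:
  assumes d: "d > 0"
    and A: "\<And>i j. i \<in> {1..n} \<Longrightarrow> j \<in> {1..n} \<Longrightarrow> A i j \<in> carrier_mat d d"
    and B: "\<And>i j. i \<in> {1..n} \<Longrightarrow> j \<in> {1..n} \<Longrightarrow> B i j \<in> carrier_mat d d"
    and AB: "\<And>i l a b. i \<in> {1..n} \<Longrightarrow> l \<in> {1..n} \<Longrightarrow> a < d \<Longrightarrow> b < d \<Longrightarrow>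
      (\<Sum>j\<in>{1..n}. (A i j * B j l) $$ (a, b)) = (if i = l \<and> a = b then 1 else 0)"
  shows "is_inverse_mat (block_square d n A) (block_square d n B)"
proof -
  let ?A = "block_square d n A" and ?B = "block_square d n B"
  have cA: "?A \<in> carrier_mat (n * d) (n * d)" and cB: "?B \<in> carrier_mat (n * d) (n * d)" by auto
  have 1: "?A * ?B = 1\<^sub>m (n * d)"
  proof (rule eq_matI)
    fix x y assume "x < dim_row (1\<^sub>m (n * d) :: real mat)" "y < dim_col (1\<^sub>m (n * d) :: real mat)"
    then have xy: "x < n * d" "y < n * d" by auto
    let ?i = "x div d + 1" and ?l = "y div d + 1" and ?a = "x mod d" and ?b = "y mod d"
    have il: "?i \<in> {1..n}" "?l \<in> {1..n}" and ab: "?a < d" "?b < d"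
      using xy d by (auto simp: less_mult_imp_div_less Suc_le_eq)
    have "(?A * ?B) $$ (x, y) = (\<Sum>z<n * d. ?A $$ (x, z) * ?B $$ (z, y))"
      using xy by (simp add: scalar_prod_def lessThan_atLeast0)
    also have "\<dots> = (\<Sum>j<n. \<Sum>c<d. A ?i (j + 1) $$ (?a, c) * B (j + 1) ?l $$ (c, ?b))"
      unfolding sum_lessThan_times
    proof (intro sum.cong refl)
      fix j c assume "j \<in> {..<n}" "c \<in> {..<d}"
      then have jc: "j < n" "c < d" by auto
      then have "(j + 1) * d \<le> n * d" by (intro mult_right_mono) auto
      then have "j * d + c < n * d" using jc by simp
      then show "?A $$ (x, j * d + c) * ?B $$ (j * d + c, y) = A ?i (j + 1) $$ (?a, c) * B (j + 1) ?l $$ (c, ?b)"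
        using xy jc by (simp add: block_square_index)
    qed
    also have "\<dots> = (\<Sum>j<n. (A ?i (j + 1) * B (j + 1) ?l) $$ (?a, ?b))"
    proof (intro sum.cong refl)
      fix j assume "j \<in> {..<n}"
      then have "A ?i (j + 1) \<in> carrier_mat d d" "B (j + 1) ?l \<in> carrier_mat d d"
        using A[OF il(1)] B[OF _ il(2)] by auto
      then show "(\<Sum>c<d. A ?i (j + 1) $$ (?a, c) * B (j + 1) ?l $$ (c, ?b)) = (A ?i (j + 1) * B (j + 1) ?l) $$ (?a, ?b)"
        using ab by (simp add: scalar_prod_def lessThan_atLeast0)
    qed
    also have "\<dots> = (\<Sum>j\<in>{1..n}. (A ?i j * B j ?l) $$ (?a, ?b))"
      by (simp add: sum.atLeast1_atMost_eq)
    also have "\<dots> = (if ?i = ?l \<and> ?a = ?b then 1 else 0)"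
      by (rule AB[OF il ab])
    also have "\<dots> = 1\<^sub>m (n * d) $$ (x, y)"
      using xy by (auto, metis div_mult_mod_eq)
    finally show "(?A * ?B) $$ (x, y) = 1\<^sub>m (n * d) $$ (x, y)" .
  qed auto
  have 2: "?B * ?A = 1\<^sub>m (n * d)"
    by (rule mat_mult_left_right_inverse[OF cA cB 1])
  show ?thesis
    unfolding is_inverse_mat_def inverts_mat_def using 1 2 by simp
qed

text \<open>What the inversion uses, isolated so that it also covers white noise, whose covariance
  function is not continuous. \<open>K_diag\<close> is stationarity, so the single matrix
  \<open>Ri\<close> serves all locations; \<open>det_schur\<close> says that the innovation over a
  positive time step is nondegenerate.\<close>

locale markov_kernel =
  fixes d :: nat and K :: "real \<Rightarrow> real \<Rightarrow> real mat"
  assumes d_pos: "d > 0"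
    and K_carrier [simp]: "K s t \<in> carrier_mat d d"
    and K_diag: "K t t = K 0 0"
    and K_transpose: "transpose_mat (K s t) = K t s"
    and det_K: "Determinant.det (K 0 0) \<noteq> 0"
    and markov: "t < q \<Longrightarrow> q < s \<Longrightarrow> K s t = K s q * mat_inv d (K 0 0) * K q t"
    and det_schur: "t < s \<Longrightarrow> Determinant.det (K 0 0 - K s t * mat_inv d (K 0 0) * K t s) \<noteq> 0"
begin

abbreviation "Ri \<equiv> mat_inv d (K 0 0)"
abbreviation "S s t \<equiv> K 0 0 - K s t * Ri * K t s"

lemma Ri [simp]: "Ri \<in> carrier_mat d d" and R_Ri: "K t t * Ri = 1\<^sub>m d" and Ri_R: "Ri * K t t = 1\<^sub>m d"
  using mat_inv[OF K_carrier det_K] K_diag[of t] by auto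

lemma Ri_transpose: "transpose_mat Ri = Ri"
  by (rule mat_inv_transpose[OF K_carrier det_K K_transpose])

lemma S_carrier [simp]: "S s t \<in> carrier_mat d d"
  by (intro minus_carrier_mat mult_carrier_mat[of _ d d]) auto

lemma S_transpose: "transpose_mat (S s t) = S s t"
proof -
  have "transpose_mat (K s t * Ri * K t s) = K s t * (Ri * K t s)"
    by (simp add: transpose_mult[of _ d d _ d] mult_carrier_mat[of _ d d] K_transpose Ri_transpose)
  then show ?thesis
    by (subst transpose_minus[of _ d d])
      (auto simp: K_transpose mult_carrier_mat[of _ d d] assoc_mult_mat[of _ d d _ d _ d])
qed

definition Si :: "real \<Rightarrow> real \<Rightarrow> real mat" where "Si s t = mat_inv d (S s t)"

lemma Si:
  assumes "t < s"
  shows "Si s t \<in> carrier_mat d d" "S s t * Si s t = 1\<^sub>m d" "Si s t * S s t = 1\<^sub>m d"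
    "transpose_mat (Si s t) = Si s t"
  unfolding Si_def
  by (rule mat_inv[OF S_carrier det_schur[OF assms]] mat_inv_transpose[OF S_carrier det_schur[OF assms] S_transpose])+

lemma markov_le:
  assumes "t \<le> q" "q \<le> s"
  shows "K s t = K s q * Ri * K q t"
proof (cases "q = s")
  case True
  then show ?thesis by (simp add: R_Ri left_mult_one_mat[of _ d d])
next
  case q: False
  show ?thesis
  proof (cases "t = q")
    case True
    then show ?thesis
      by (simp add: assoc_mult_mat[of _ d d _ d _ d] Ri_R right_mult_one_mat[of _ d d])
  next
    case False
    then show ?thesis using q assms by (intro markov) auto
  qed
qed

lemma markov_ge:
  assumes "t \<le> q" "q \<le> s"
  shows "K t s = K t q * Ri * K q s"
proof -
  have "K t s = transpose_mat (K s q * Ri * K q t)"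
    unfolding markov_le[OF assms, symmetric] K_transpose ..
  also have "\<dots> = K t q * (Ri * K q s)"
    by (simp add: transpose_mult[of _ d d _ d] mult_carrier_mat[of _ d d] K_transpose Ri_transpose)
  finally show ?thesis by (simp add: assoc_mult_mat[of _ d d _ d _ d])
qed

lemma mat_assoc: "A \<in> carrier_mat d d \<Longrightarrow> B \<in> carrier_mat d d \<Longrightarrow> C \<in> carrier_mat d d \<Longrightarrow>
    A * B * C = A * (B * C)" for A B C :: "real mat"
  by (rule assoc_mult_mat)

lemma mult_carrier [simp]:
  "A \<in> carrier_mat d d \<Longrightarrow> B \<in> carrier_mat d d \<Longrightarrow> A * B \<in> carrier_mat d d" for A B :: "real mat"
  by (rule mult_carrier_mat)

lemma K_dim [simp]: "dim_row (K s t) = d" "dim_col (K s t) = d"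
  using K_carrier[of s t] by (auto simp del: K_carrier)

lemma Ri_dim [simp]: "dim_row Ri = d" "dim_col Ri = d"
  using Ri by (auto simp del: Ri)

lemma uminus_mult:
  fixes A B :: "real mat"
  assumes "A \<in> carrier_mat d d" "B \<in> carrier_mat d d"
  shows "A * (- B) = - (A * B)"
  using assms by (intro eq_matI) (auto simp: scalar_prod_def sum_negf)

text \<open>\<open>Si s t\<close> is the inverse covariance of the innovation \<open>X(s) - K s t Ri X(t)\<close>, which is
  uncorrelated with everything up to time \<open>t\<close>.\<close>

lemma innovation:
  assumes "t < s" "i \<ge> s \<or> i \<le> t"
  shows "K i s * Si s t - K i t * (Ri * K t s * Si s t) = (if i \<ge> s then K i s * Ri else 0\<^sub>m d d)"
proof -
  note [simp] = Si(1)[OF assms(1)]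
  show ?thesis
  proof (cases "i \<ge> s")
    case True
    \<comment> \<open>Dependence on times before \<open>s\<close> passes through \<open>s\<close>,
      so \<open>K i s * Ri\<close> factors out and leaves \<open>S s t * Si s t\<close>.\<close>
    have a: "K i t = K i s * Ri * K s t" using markov_le[of t s i] assms True by simp
    have b: "K i s = K i s * Ri * K 0 0" by (simp add: mat_assoc Ri_R right_mult_one_mat[of _ d d])
    have "K i s * Si s t - K i t * (Ri * K t s * Si s t)
      = K i s * Ri * (K 0 0 * Si s t) - K i s * Ri * (K s t * Ri * K t s * Si s t)"
      unfolding a by (subst b) (simp add: mat_assoc)
    also have "\<dots> = K i s * Ri * (K 0 0 * Si s t - K s t * Ri * K t s * Si s t)"
      by (rule mult_minus_distrib_mat[of _ d d _ d, symmetric]) auto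
    also have "K 0 0 * Si s t - K s t * Ri * K t s * Si s t = S s t * Si s t"
      by (rule minus_mult_distrib_mat[of _ d d _ _ d, symmetric]) auto
    also have "K i s * Ri * (S s t * Si s t) = K i s * Ri"
      unfolding Si(2)[OF assms(1)] by (rule right_mult_one_mat[of _ d]) simp
    finally show ?thesis using True by simp
  next
    case False
    then have "K i s = K i t * Ri * K t s" using markov_ge[of i t s] assms by auto
    then have "K i s * Si s t = K i t * (Ri * K t s * Si s t)" by (simp add: mat_assoc)
    then show ?thesis using False by (auto intro!: eq_matI)
  qed
qed

text \<open>The precision matrix is the inverse covariance of \<open>X(t 1)\<close> plus, for each further location, the
  inverse covariance of the innovation pulled back to the two neighbouring locations. Thus \<open>gain\<close>
  depends on the preceding location only, and the first block uses the stationary inverse.\<close>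

definition gain :: "(nat \<Rightarrow> real) \<Rightarrow> nat \<Rightarrow> real mat" where
  "gain t l = (if l = 1 then Ri else Si (t l) (t (l - 1)))"

definition precision :: "nat \<Rightarrow> (nat \<Rightarrow> real) \<Rightarrow> nat \<Rightarrow> nat \<Rightarrow> real mat" where
  "precision n t j l =
    (if j = l then
       if l < n then gain t l + Ri * K (t l) (t (Suc l)) * gain t (Suc l) * (K (t (Suc l)) (t l) * Ri)
       else gain t l
     else if l = Suc j then - (Ri * K (t j) (t l) * gain t l)
     else if j = Suc l then - (gain t j * (K (t j) (t l) * Ri))
     else 0\<^sub>m d d)"

context
  fixes n :: nat and t :: "nat \<Rightarrow> real"
  assumes t: "strict_mono_on {1..n} t"
begin

lemma t_less: "j < l \<Longrightarrow> 1 \<le> j \<Longrightarrow> l \<le> n \<Longrightarrow> t j < t l"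
  using t by (auto simp: strict_mono_on_def)

lemma t_le: "j \<le> l \<Longrightarrow> 1 \<le> j \<Longrightarrow> l \<le> n \<Longrightarrow> t j \<le> t l"
  using t_less[of j l] by (cases "j = l") auto

lemma gain:
  assumes "1 \<le> l" "l \<le> n"
  shows "gain t l \<in> carrier_mat d d" "transpose_mat (gain t l) = gain t l"
proof -
  have "t (l - 1) < t l" if "l \<noteq> 1" using assms that by (intro t_less) auto
  then show "gain t l \<in> carrier_mat d d" "transpose_mat (gain t l) = gain t l"
    using Si[of "t (l - 1)" "t l"] Ri_transpose by (auto simp: gain_def)
qed

lemma precision_carrier:
  assumes "j \<in> {1..n}" "l \<in> {1..n}"
  shows "precision n t j l \<in> carrier_mat d d"
  using assms gain(1)[of l] gain(1)[of j] gain(1)[of "Suc l"]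
  by (auto simp: precision_def)

lemma precision_transpose:
  assumes "j \<in> {1..n}" "Suc j \<in> {1..n}"
  shows "precision n t (Suc j) j = transpose_mat (precision n t j (Suc j))"
  using assms gain[of "Suc j"]
  by (simp add: precision_def transpose_uminus transpose_mult[of _ d d _ d] K_transpose Ri_transpose mat_assoc)

text \<open>Column \<open>l\<close> splits into \<open>P\<close>, the contribution of the innovation
  at \<open>l\<close> to rows \<open>l - 1\<close> and \<open>l\<close>, and \<open>N\<close>, that
  of the innovation at \<open>l + 1\<close> to rows \<open>l\<close> and \<open>l + 1\<close>. By
  \<open>innovation\<close> the first sum is \<open>K (t i) (t l) * Ri\<close> for
  \<open>i \<ge> l\<close>, the second cancels it for \<open>i > l\<close>, and only the identity at
  \<open>i = l\<close> remains.\<close>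

lemma kernel_mult_precision:
  assumes i: "i \<in> {1..n}" and l: "l \<in> {1..n}" and ab: "a < d" "b < d"
  shows "(\<Sum>j\<in>{1..n}. (K (t i) (t j) * precision n t j l) $$ (a, b)) = (if i = l \<and> a = b then 1 else 0)"
proof -
  let ?K = "\<lambda>i j. K (t i) (t j)" and ?G = "gain t"
  define P where "P = (\<lambda>j. if j = l then ?G l else if Suc j = l then - (Ri * ?K j l * ?G l) else 0\<^sub>m d d)"
  define N where "N = (\<lambda>j. if j = l \<and> l < n then Ri * ?K l (Suc l) * ?G (Suc l) * (?K (Suc l) l * Ri)
    else if j = Suc l then - (?G j * (?K j l * Ri)) else 0\<^sub>m d d)"
  have G [simp]: "?G j \<in> carrier_mat d d" if "j \<in> {1..n}" for j using gain(1)[of j] that by simp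
  have PN: "P j \<in> carrier_mat d d" "N j \<in> carrier_mat d d" "precision n t j l = P j + N j" if "j \<in> {1..n}" for j
    using that l by (auto simp: P_def N_def precision_def left_add_zero_mat[of _ d d] right_add_zero_mat[of _ d d])
  have "(\<Sum>j\<in>{1..n}. (?K i j * precision n t j l) $$ (a, b))
    = (\<Sum>j\<in>{1..n}. (?K i j * P j) $$ (a, b)) + (\<Sum>j\<in>{1..n}. (?K i j * N j) $$ (a, b))"
    unfolding sum.distrib[symmetric]
  proof (intro sum.cong refl)
    fix j assume j: "j \<in> {1..n}"
    note [simp] = PN(1,2)[OF j] PN(1,2)[OF j, THEN carrier_matD(1)] PN(1,2)[OF j, THEN carrier_matD(2)]
    have "?K i j * precision n t j l = ?K i j * P j + ?K i j * N j"
      unfolding PN(3)[OF j] by (rule mult_add_distrib_mat[of _ d d _ d]) auto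
    then show "(?K i j * precision n t j l) $$ (a, b) = (?K i j * P j) $$ (a, b) + (?K i j * N j) $$ (a, b)"
      using ab by simp
  qed
  also have "(\<Sum>j\<in>{1..n}. (?K i j * P j) $$ (a, b)) = (if i \<ge> l then (?K i l * Ri) $$ (a, b) else 0)"
  proof -
    have "(\<Sum>j\<in>{1..n}. (?K i j * P j) $$ (a, b))
      = (\<Sum>j\<in>{1..n}. (if j = l then (?K i l * ?G l) $$ (a, b) else 0)
          + (if j = l - 1 then - (?K i j * (Ri * ?K j l * ?G l)) $$ (a, b) else 0))"
    proof (intro sum.cong refl)
      fix j assume j: "j \<in> {1..n}"
      have "- (?K i j * (Ri * ?K j l * ?G l)) $$ (a, b) = (?K i j * - (Ri * ?K j l * ?G l)) $$ (a, b)"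
        using ab l by (simp add: uminus_mult carrier_matD[of _ d d])
      then show "(?K i j * P j) $$ (a, b) = (if j = l then (?K i l * ?G l) $$ (a, b) else 0)
          + (if j = l - 1 then - (?K i j * (Ri * ?K j l * ?G l)) $$ (a, b) else 0)"
        using ab j l by (auto simp: P_def right_mult_zero_mat[of _ d d])
    qed
    \<comment> \<open>For \<open>l = 1\<close> the index \<open>l - 1\<close> is 0 and lies outside
      the range, so the second term disappears; \<open>gain\<close> is then the stationary
      inverse.\<close>
    also have "\<dots> = (?K i l * ?G l) $$ (a, b)
        + (if l = 1 then 0 else - (?K i (l - 1) * (Ri * ?K (l - 1) l * ?G l)) $$ (a, b))"
      using l by (auto simp: sum.distrib)
    also have "\<dots> = (if i \<ge> l then (?K i l * Ri) $$ (a, b) else 0)"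
    proof (cases "l = 1")
      case True
      then show ?thesis using i by (simp add: gain_def)
    next
      case False
      have lt: "t (l - 1) < t l" using False l by (intro t_less) auto
      have i': "(t l \<le> t i) = (l \<le> i)" "t l \<le> t i \<or> t i \<le> t (l - 1)"
        using t_le[of l i] t_less[of i l] t_le[of i "l - 1"] i l by (cases "l \<le> i"; auto)+
      have "?K i l * ?G l - ?K i (l - 1) * (Ri * ?K (l - 1) l * ?G l)
        = (if l \<le> i then ?K i l * Ri else 0\<^sub>m d d)"
        using innovation[OF lt i'(2)] False by (simp add: gain_def i'(1))
      from arg_cong[OF this, of "\<lambda>A. A $$ (a, b)"] show ?thesis
        using False ab l by (auto simp: carrier_matD[of _ d d] split: if_splits)
    qed
    finally show ?thesis .
  qed
  also have "(\<Sum>j\<in>{1..n}. (?K i j * N j) $$ (a, b)) = (if i \<ge> Suc l then - (?K i l * Ri) $$ (a, b) else 0)"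
  proof (cases "l < n")
    case False
    then have "?K i j * N j = 0\<^sub>m d d" if "j \<in> {1..n}" for j
      using that by (simp add: N_def right_mult_zero_mat[of _ d d])
    then show ?thesis using ab i False by auto
  next
    case True
    let ?m = "Suc l"
    let ?X = "?K ?m l * Ri"
    have m: "?m \<in> {1..n}" using True by simp
    note [simp] = G[OF m]
    have "(\<Sum>j\<in>{1..n}. (?K i j * N j) $$ (a, b))
      = (\<Sum>j\<in>{1..n}. (if j = l then (?K i l * (Ri * ?K l ?m * ?G ?m * ?X)) $$ (a, b) else 0)
          + (if j = ?m then - (?K i ?m * (?G ?m * ?X)) $$ (a, b) else 0))"
    proof (intro sum.cong refl)
      fix j assume j: "j \<in> {1..n}"
      have "- (?K i ?m * (?G ?m * ?X)) $$ (a, b) = (?K i ?m * - (?G ?m * ?X)) $$ (a, b)"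
        using ab l by (simp add: uminus_mult carrier_matD[of _ d d])
      then show "(?K i j * N j) $$ (a, b) = (if j = l then (?K i l * (Ri * ?K l ?m * ?G ?m * ?X)) $$ (a, b) else 0)
          + (if j = ?m then - (?K i ?m * (?G ?m * ?X)) $$ (a, b) else 0)"
        using ab j l True by (auto simp: N_def right_mult_zero_mat[of _ d d])
    qed
    also have "\<dots> = (?K i l * (Ri * ?K l ?m * ?G ?m * ?X)) $$ (a, b) - (?K i ?m * (?G ?m * ?X)) $$ (a, b)"
      using l m by (simp add: sum.distrib)
    also have "\<dots> = - ((?K i ?m * ?G ?m - ?K i l * (Ri * ?K l ?m * ?G ?m)) * ?X) $$ (a, b)"
    proof -
      have "(?K i ?m * ?G ?m - ?K i l * (Ri * ?K l ?m * ?G ?m)) * ?X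
        = ?K i ?m * ?G ?m * ?X - ?K i l * (Ri * ?K l ?m * ?G ?m) * ?X"
        by (rule minus_mult_distrib_mat[of _ d d _ _ d]) auto
      also have "\<dots> = ?K i ?m * (?G ?m * ?X) - ?K i l * (Ri * ?K l ?m * ?G ?m * ?X)"
        by (simp add: mat_assoc)
      finally show ?thesis using ab by (simp add: carrier_matD[of _ d d])
    qed
    also have "?K i ?m * ?G ?m - ?K i l * (Ri * ?K l ?m * ?G ?m)
        = (if ?m \<le> i then ?K i ?m * Ri else 0\<^sub>m d d)"
    proof -
      have lt: "t l < t ?m" using m l by (intro t_less) auto
      have i': "(t ?m \<le> t i) = (?m \<le> i)" "t ?m \<le> t i \<or> t i \<le> t l"
        using t_le[of ?m i] t_less[of i ?m] t_le[of i l] i m l by (cases "?m \<le> i"; auto)+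
      show ?thesis
        using innovation[OF lt i'(2)] l by (simp add: gain_def i'(1))
    qed
    also have "- ((if ?m \<le> i then ?K i ?m * Ri else 0\<^sub>m d d) * ?X) $$ (a, b)
      = (if i \<ge> ?m then - (?K i l * Ri) $$ (a, b) else 0)"
    proof (cases "?m \<le> i")
      case True
      have "?K i l = ?K i ?m * Ri * ?K ?m l"
        using True i l m by (intro markov_le t_le) auto
      then have "?K i ?m * Ri * ?X = ?K i l * Ri" by (simp add: mat_assoc)
      then show ?thesis using True by simp
    qed (use ab in \<open>simp add: left_mult_zero_mat[of _ d d]\<close>)
    finally show ?thesis .
  qed
  also have "(if i \<ge> l then (?K i l * Ri) $$ (a, b) else 0) + (if i \<ge> Suc l then - (?K i l * Ri) $$ (a, b) else 0)
    = (if i = l \<and> a = b then 1 else 0)"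
    using ab R_Ri[of "t l"] by (cases "i = l") auto
  finally show ?thesis .
qed

lemma precision_inverse:
  "is_inverse_mat (block_square d n (\<lambda>j l. K (t j) (t l))) (block_square d n (precision n t))"
  by (rule block_square_inverse[OF d_pos];
      (rule K_carrier | rule precision_carrier | rule kernel_mult_precision); assumption)

end

text \<open>Each local inverse is the precision matrix of two or three consecutive locations alone.
  Its last diagonal block lacks the term from the next location; hence \<open>M\<^sub>0\<close> is
  free, and \<open>E\<close> is tied to the global block only at \<open>j = n - 1\<close>, since
  \<open>Q (j + 1) (j + 1)\<close> in general also depends on \<open>t (j + 2)\<close>.\<close>

lemma precision_blocks:
  assumes t: "strict_mono_on {1..n} t"
  shows "\<exists>Q :: nat \<Rightarrow> nat \<Rightarrow> real mat.
          (\<forall>j\<in>{1..n}. \<forall>l\<in>{1..n}. Q j l \<in> carrier_mat d d) \<and>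
          is_inverse_mat (block_square d n (\<lambda>j l. K (t j) (t l)))
            (block_matrix d (map (\<lambda>j. map (\<lambda>l. Q j l) [1..<n + 1]) [1..<n + 1])) \<and>
          (\<forall>j\<in>{1..n}. \<forall>l\<in>{1..n}. j + 1 < l \<or> l + 1 < j \<longrightarrow> Q j l = 0\<^sub>m d d) \<and>
          (n \<ge> 2 \<longrightarrow>
             (\<exists>M\<^sub>0 \<in> carrier_mat d d.
                is_inverse_mat
                  (block_matrix d [[K (t 1) (t 1), K (t 1) (t 2)],
                                   [K (t 2) (t 1), K (t 2) (t 2)]])
                  (block_matrix d [[Q 1 1, Q 1 2],
                                   [Q 2 1, M\<^sub>0]]))) \<and>
          (\<forall>j\<in>{2..n - 1}.
             \<exists>M\<^sub>1 \<in> carrier_mat d d. \<exists>M\<^sub>2 \<in> carrier_mat d d. \<exists>E \<in> carrier_mat d d.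
                (j = n - 1 \<longrightarrow> E = Q (j + 1) (j + 1)) \<and>
                is_inverse_mat
                  (block_matrix d
                    [[K (t (j - 1)) (t (j - 1)), K (t (j - 1)) (t j), K (t (j - 1)) (t (j + 1))],
                     [K (t j) (t (j - 1)), K (t j) (t j), K (t j) (t (j + 1))],
                     [K (t (j + 1)) (t (j - 1)), K (t (j + 1)) (t j), K (t (j + 1)) (t (j + 1))]])
                  (block_matrix d
                    [[M\<^sub>1, M\<^sub>2, 0\<^sub>m d d],
                     [transpose_mat M\<^sub>2, Q j j, Q j (j + 1)],
                     [0\<^sub>m d d, Q (j + 1) j, E]]))"
proof (intro exI[of _ "precision n t"] conjI)
  have one_two: "[1..<2 + 1] = [1, 2 :: nat]" "[1..<3 + 1] = [1, 2, 3 :: nat]"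
    by (simp_all add: upt_rec numeral_eq_Suc)
  show "\<forall>j\<in>{1..n}. \<forall>l\<in>{1..n}. precision n t j l \<in> carrier_mat d d"
    using precision_carrier[OF t] by blast
  show "is_inverse_mat (block_square d n (\<lambda>j l. K (t j) (t l)))
    (block_matrix d (map (\<lambda>j. map (\<lambda>l. precision n t j l) [1..<n + 1]) [1..<n + 1]))"
    using precision_inverse[OF t] by (simp only: block_square_def)
  show "\<forall>j\<in>{1..n}. \<forall>l\<in>{1..n}. j + 1 < l \<or> l + 1 < j \<longrightarrow> precision n t j l = 0\<^sub>m d d"
    by (auto simp: precision_def)
  show "n \<ge> 2 \<longrightarrow> (\<exists>M\<^sub>0 \<in> carrier_mat d d.
    is_inverse_mat
      (block_matrix d [[K (t 1) (t 1), K (t 1) (t 2)], [K (t 2) (t 1), K (t 2) (t 2)]])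
      (block_matrix d [[precision n t 1 1, precision n t 1 2], [precision n t 2 1, M\<^sub>0]]))"
  proof (intro impI bexI[of _ "precision 2 t 2 2"])
    assume n: "n \<ge> 2"
    then have t2: "strict_mono_on {1..2} t" by (intro monotone_on_subset[OF t]) auto
    show "precision 2 t 2 2 \<in> carrier_mat d d" by (rule precision_carrier[OF t2]) auto
    have "precision n t 1 1 = precision 2 t 1 1" "precision n t 1 2 = precision 2 t 1 2"
      "precision n t 2 1 = precision 2 t 2 1"
      using n by (simp_all add: precision_def)
    then show "is_inverse_mat
      (block_matrix d [[K (t 1) (t 1), K (t 1) (t 2)], [K (t 2) (t 1), K (t 2) (t 2)]])
      (block_matrix d [[precision n t 1 1, precision n t 1 2], [precision n t 2 1, precision 2 t 2 2]])"
      using precision_inverse[OF t2] unfolding block_square_def one_two by simp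
  qed
  show "\<forall>j\<in>{2..n - 1}. \<exists>M\<^sub>1 \<in> carrier_mat d d. \<exists>M\<^sub>2 \<in> carrier_mat d d. \<exists>E \<in> carrier_mat d d.
    (j = n - 1 \<longrightarrow> E = precision n t (j + 1) (j + 1)) \<and>
    is_inverse_mat
      (block_matrix d
        [[K (t (j - 1)) (t (j - 1)), K (t (j - 1)) (t j), K (t (j - 1)) (t (j + 1))],
         [K (t j) (t (j - 1)), K (t j) (t j), K (t j) (t (j + 1))],
         [K (t (j + 1)) (t (j - 1)), K (t (j + 1)) (t j), K (t (j + 1)) (t (j + 1))]])
      (block_matrix d
        [[M\<^sub>1, M\<^sub>2, 0\<^sub>m d d],
         [transpose_mat M\<^sub>2, precision n t j j, precision n t j (j + 1)],
         [0\<^sub>m d d, precision n t (j + 1) j, E]])"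
  proof
    fix j assume j: "j \<in> {2..n - 1}"
    \<comment> \<open>Relabels the locations \<open>j - 1\<close>, \<open>j\<close>,
      \<open>j + 1\<close> as 1, 2, 3; the truncated subtraction is harmless because
      \<open>j \<ge> 2\<close>.\<close>
    define t' where "t' = (\<lambda>i. t (j - 2 + i))"
    have t'_simps: "t' 1 = t (j - 1)" "t' 2 = t j" "t' 3 = t (j + 1)"
      using j by (auto simp: t'_def numeral_eq_Suc Suc_diff_Suc)
    have t3: "strict_mono_on {1..3} t'"
      unfolding t'_def using j by (intro strict_mono_onI strict_mono_onD[OF t]) auto
    \<comment> \<open>Only index 1 is treated specially by \<open>gain\<close>, so these two survive
      the relabelling; the reset \<open>gain t' 1\<close> enters just the discarded block
      \<open>M\<^sub>1\<close>.\<close>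
    have g: "gain t' 2 = gain t j" "gain t' 3 = gain t (j + 1)"
      unfolding gain_def using j t'_simps by simp_all
    have p: "precision n t j j = precision 3 t' 2 2" "precision n t j (j + 1) = precision 3 t' 2 3"
      "precision n t (j + 1) j = precision 3 t' 3 2" "precision 3 t' 1 3 = 0\<^sub>m d d" "precision 3 t' 3 1 = 0\<^sub>m d d"
      using j g t'_simps by (auto simp: precision_def numeral_2_eq_2 numeral_3_eq_3)
    have E: "j = n - 1 \<longrightarrow> precision 3 t' 3 3 = precision n t (j + 1) (j + 1)"
      using j g by (auto simp: precision_def)
    have T: "transpose_mat (precision 3 t' 1 2) = precision 3 t' 2 1"
      using precision_transpose[OF t3, of 1] by (simp add: numeral_2_eq_2)
    have "is_inverse_mat
      (block_matrix d
        [[K (t (j - 1)) (t (j - 1)), K (t (j - 1)) (t j), K (t (j - 1)) (t (j + 1))],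
         [K (t j) (t (j - 1)), K (t j) (t j), K (t j) (t (j + 1))],
         [K (t (j + 1)) (t (j - 1)), K (t (j + 1)) (t j), K (t (j + 1)) (t (j + 1))]])
      (block_matrix d
        [[precision 3 t' 1 1, precision 3 t' 1 2, 0\<^sub>m d d],
         [transpose_mat (precision 3 t' 1 2), precision n t j j, precision n t j (j + 1)],
         [0\<^sub>m d d, precision n t (j + 1) j, precision 3 t' 3 3]])"
      unfolding p(1-3) T using precision_inverse[OF t3] unfolding block_square_def one_two
      by (simp only: list.map t'_simps p(4,5))
    moreover have "precision 3 t' 1 1 \<in> carrier_mat d d" "precision 3 t' 1 2 \<in> carrier_mat d d"
      "precision 3 t' 3 3 \<in> carrier_mat d d"
      by (auto intro!: precision_carrier[OF t3])
    ultimately show "\<exists>M\<^sub>1 \<in> carrier_mat d d. \<exists>M\<^sub>2 \<in> carrier_mat d d. \<exists>E \<in> carrier_mat d d.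
      (j = n - 1 \<longrightarrow> E = precision n t (j + 1) (j + 1)) \<and>
      is_inverse_mat
        (block_matrix d
          [[K (t (j - 1)) (t (j - 1)), K (t (j - 1)) (t j), K (t (j - 1)) (t (j + 1))],
           [K (t j) (t (j - 1)), K (t j) (t j), K (t j) (t (j + 1))],
           [K (t (j + 1)) (t (j - 1)), K (t (j + 1)) (t j), K (t (j + 1)) (t (j + 1))]])
        (block_matrix d
          [[M\<^sub>1, M\<^sub>2, 0\<^sub>m d d],
           [transpose_mat M\<^sub>2, precision n t j j, precision n t j (j + 1)],
           [0\<^sub>m d d, precision n t (j + 1) j, E]])"
      using E by blast
  qed
qed

end

section \<open>The kernel conditions for white noise and for covariance towers\<close>

lemma white_noise_kernel:
  assumes "C > 0"
  shows "markov_kernel 1 (\<lambda>s t. Matrix.mat 1 1 (\<lambda>_. if s = t then C else 0))"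
proof -
  define K where "K = (\<lambda>s t :: real. Matrix.mat 1 1 (\<lambda>_ :: nat \<times> nat. if s = t then C else (0 :: real)))"
  have c: "K s t \<in> carrier_mat 1 1" for s t by (simp add: K_def)
  have z: "K s t = 0\<^sub>m 1 1" if "s \<noteq> t" for s t using that by (auto simp: K_def)
  have det: "Determinant.det (K 0 0) \<noteq> 0"
    by (rule det_nonzeroI[OF c]) (use assms in \<open>auto simp: K_def\<close>)
  have i: "mat_inv 1 (K 0 0) \<in> carrier_mat 1 1" using mat_inv(1)[OF c det] .
  have "markov_kernel 1 K"
  proof
    show "Determinant.det (K 0 0 - K s t * mat_inv 1 (K 0 0) * K t s) \<noteq> 0" if "t < s" for s t
    proof -
      have "K 0 0 - K s t * mat_inv 1 (K 0 0) * K t s = K 0 0"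
        using that i c[of 0 0] by (auto simp: z intro!: eq_matI)
      then show ?thesis using det by simp
    qed
    show "K s t = K s q * mat_inv 1 (K 0 0) * K q t" if "t < q" "q < s" for s q t
      using that i by (auto simp: z)
  qed (use c det in \<open>auto simp: K_def\<close>)
  then show ?thesis by (simp only: K_def)
qed

context markov_tower begin

text \<open>The extension of \<open>f k\<close> from the half-line that is even or odd according to \<open>k\<close>: the derivatives
  of the function \<open>f 0 \<bar>h\<bar>\<close>, as long as the odd ones vanish at 0.\<close>

definition parity_ext :: "nat \<Rightarrow> real \<Rightarrow> real" where
  "parity_ext k h = (if h \<ge> 0 then f k h else (- 1) ^ k * f k (- h))"

lemma ext_minus: "k < 2 * d - 1 \<Longrightarrow> parity_ext k (- h) = (- 1) ^ k * parity_ext k h"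
  using odd_zero[of k] by (cases "h = 0"; cases "even k") (auto simp: parity_ext_def)

text \<open>Away from 0 each branch is smooth. At 0 the one-sided derivatives are
  \<open>f (Suc k) 0\<close> and the same value with the sign of the parity; they agree because an
  odd order \<open>Suc k\<close> is still below \<open>2 * d - 1\<close>, where the derivative
  vanishes.\<close>

lemma DERIV_ext:
  assumes k: "k < 2 * d - 2"
  shows "(parity_ext k has_real_derivative parity_ext (Suc k) h) (at h)"
proof -
  have pos: "(parity_ext k has_real_derivative f (Suc k) h) (at h within {0..})" if "h \<ge> 0" for h
    by (rule has_field_derivative_transform_within[OF has_field_derivative_at_within[OF deriv_tower_D[OF tower]], of 1])
      (use that in \<open>auto simp: parity_ext_def\<close>)
  have D: "((\<lambda>h. (- 1) ^ k * f k (- h)) has_real_derivative (- 1) ^ Suc k * f (Suc k) (- h)) (at h)" for h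
    by (auto intro!: derivative_eq_intros DERIV_chain2[where g = uminus, OF deriv_tower_D[OF tower]])
  have "f k 0 = (- 1) ^ k * f k 0" using odd_zero[of k] k by (cases "even k") auto
  then have e: "(- 1) ^ k * f k (- h) = parity_ext k h" if "h \<le> 0" for h
    using that by (cases "h = 0") (auto simp: parity_ext_def)
  have neg: "(parity_ext k has_real_derivative (- 1) ^ Suc k * f (Suc k) (- h)) (at h within {..0})" if "h \<le> 0" for h
    by (rule has_field_derivative_transform_within[OF has_field_derivative_at_within[OF D], of 1])
      (use that e in auto)
  consider "h > 0" | "h < 0" | "h = 0" by linarith
  then show ?thesis
  proof cases
    case 1
    then have "at h within {0..} = at h" by (intro at_within_interior) auto
    then show ?thesis using pos[of h] 1 by (simp add: parity_ext_def)
  next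
    case 2
    then have "at h within {..0} = at h" by (intro at_within_interior) auto
    then show ?thesis using neg[of h] 2 by (simp add: parity_ext_def)
  next
    case 3
    have "f (Suc k) 0 = (- 1) ^ Suc k * f (Suc k) 0"
      using odd_zero[of "Suc k"] k by (cases "even k") auto
    then have "(parity_ext k has_real_derivative f (Suc k) 0) (at 0 within {..0})"
      "(parity_ext k has_real_derivative f (Suc k) 0) (at 0 within {0..})"
      using neg[of 0] pos[of 0] by auto
    then have "(parity_ext k has_real_derivative f (Suc k) 0) (at 0)"
      unfolding has_field_derivative_iff
      by (rule Lim_Un_univ) auto
    then show ?thesis using 3 by (simp add: parity_ext_def)
  qed
qed

text \<open>Only derivatives in \<open>t\<close> contribute a sign, and a total order of at most
  \<open>2 * d - 2\<close> never meets the jump at lag 0.\<close>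

lemma deriv_ext:
  assumes "a + b < 2 * d - 1"
  shows "(deriv ^^ a) (\<lambda>s'. (deriv ^^ b) (\<lambda>t'. parity_ext 0 (s' - t')) t) s = (- 1) ^ b * parity_ext (a + b) (s - t)"
proof -
  have inner: "(deriv ^^ b) (\<lambda>t'. parity_ext 0 (s - t')) = (\<lambda>t'. (- 1) ^ b * parity_ext b (s - t'))" if "b < 2 * d - 1" for s b
    using that
  proof (induction b)
    case (Suc b)
    have "((\<lambda>t'. (- 1) ^ b * parity_ext b (s - t')) has_real_derivative (- 1) ^ Suc b * parity_ext (Suc b) (s - t)) (at t)" for t
      using Suc.prems
      by (auto intro!: derivative_eq_intros DERIV_chain2[where g = "\<lambda>t'. s - t'", OF DERIV_ext])
    then show ?case using Suc by (simp add: DERIV_imp_deriv ext)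
  qed simp
  have outer: "(deriv ^^ a) (\<lambda>s'. (- 1) ^ b * parity_ext b (s' - t)) = (\<lambda>s'. (- 1) ^ b * parity_ext (a + b) (s' - t))"
    if "a + b < 2 * d - 1" for a
    using that
  proof (induction a)
    case (Suc a)
    have "((\<lambda>s'. (- 1) ^ b * parity_ext (a + b) (s' - t)) has_real_derivative (- 1) ^ b * parity_ext (Suc a + b) (s - t)) (at s)" for s
      using Suc.prems
      by (auto intro!: derivative_eq_intros DERIV_chain2[where g = "\<lambda>s'. s' - t", OF DERIV_ext])
    then show ?case using Suc by (simp add: DERIV_imp_deriv ext)
  qed simp
  show ?thesis using assms by (simp add: inner outer)
qed

definition cov_kernel :: "real \<Rightarrow> real \<Rightarrow> real mat" where
  "cov_kernel s t = Matrix.mat d d (\<lambda>(a, b). (- 1) ^ b * parity_ext (a + b) (s - t))"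

lemma multi_cov_ext: "multi_cov d (parity_ext 0) s t = cov_kernel s t"
  unfolding multi_cov_def cov_kernel_def by (intro eq_matI) (auto simp: deriv_ext)

lemma cov_kernel_carrier [simp]: "cov_kernel s t \<in> carrier_mat d d"
  by (simp add: cov_kernel_def)

lemma cov_kernel_dim [simp]: "dim_row (cov_kernel s t) = d" "dim_col (cov_kernel s t) = d"
  by (simp_all add: cov_kernel_def)

lemma cov_kernel_index:
  "t \<le> s \<Longrightarrow> a < d \<Longrightarrow> b < d \<Longrightarrow> cov_kernel s t $$ (a, b) = (- 1) ^ b * f (a + b) (s - t)"
  by (simp add: cov_kernel_def parity_ext_def)

lemma cov_kernel_transpose: "transpose_mat (cov_kernel s t) = cov_kernel t s"
proof (intro eq_matI)
  fix a b assume "a < dim_row (cov_kernel t s)" "b < dim_col (cov_kernel t s)"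
  then have ab: "a < d" "b < d" by auto
  have "parity_ext (b + a) (s - t) = (- 1) ^ (b + a) * parity_ext (b + a) (t - s)"
    using ext_minus[of "b + a" "t - s"] ab by simp
  then show "transpose_mat (cov_kernel s t) $$ (a, b) = cov_kernel t s $$ (a, b)"
    using ab by (simp add: cov_kernel_def power_add add.commute mult.assoc[symmetric] flip: power_mult_distrib)
qed auto

lemma cov_kernel_diag: "cov_kernel t t = cov_kernel 0 0"
  by (simp add: cov_kernel_def)

lemma R_eq: "a < d \<Longrightarrow> b < d \<Longrightarrow> cov_kernel 0 0 $$ (a, b) = R a b"
  by (simp add: cov_kernel_index R_def)

lemma det_cov_kernel: "Determinant.det (cov_kernel 0 0) \<noteq> 0"
proof (rule det_nonzeroI)
  fix v b assume v: "\<And>a. a < d \<Longrightarrow> (\<Sum>b<d. cov_kernel 0 0 $$ (a, b) * v b) = 0" and b: "b < d"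
  show "v b = 0"
  proof (rule R_kernel[OF _ b])
    show "(\<Sum>b<d. R a b * v b) = 0" if "a < d" for a
    proof -
      have "(\<Sum>b<d. R a b * v b) = (\<Sum>b<d. cov_kernel 0 0 $$ (a, b) * v b)"
        using that by (intro sum.cong refl) (auto simp: R_eq)
      then show ?thesis using v[OF that] by simp
    qed
  qed
qed simp

definition Ri :: "nat \<Rightarrow> nat \<Rightarrow> real" where "Ri a b = mat_inv d (cov_kernel 0 0) $$ (a, b)"

lemma Ri_carrier: "mat_inv d (cov_kernel 0 0) \<in> carrier_mat d d"
  by (rule mat_inv[OF cov_kernel_carrier det_cov_kernel])

lemma Ri_sym: "a < d \<Longrightarrow> b < d \<Longrightarrow> Ri a b = Ri b a"
  using mat_inv_transpose[OF cov_kernel_carrier det_cov_kernel cov_kernel_transpose] Ri_carrier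
  unfolding Ri_def by (metis carrier_matD index_transpose_mat(1))

lemma R_Ri: "a < d \<Longrightarrow> b < d \<Longrightarrow> (\<Sum>c<d. R a c * Ri c b) = (if a = b then 1 else 0)"
proof -
  assume ab: "a < d" "b < d"
  have "(cov_kernel 0 0 * mat_inv d (cov_kernel 0 0)) $$ (a, b) = (\<Sum>c<d. R a c * Ri c b)"
    using ab Ri_carrier by (simp add: scalar_prod_def Ri_def R_eq lessThan_atLeast0)
  then show ?thesis
    using ab by (simp add: mat_inv(2)[OF cov_kernel_carrier det_cov_kernel])
qed

lemma triple_product:
  assumes "a < d" "b < d"
  shows "(cov_kernel s q * mat_inv d (cov_kernel 0 0) * cov_kernel q' t) $$ (a, b)
    = (\<Sum>c<d. \<Sum>e<d. cov_kernel s q $$ (a, c) * Ri c e * cov_kernel q' t $$ (e, b))"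
  using assms Ri_carrier
  by (simp add: scalar_prod_def Ri_def lessThan_atLeast0 sum_distrib_right)
    (rule sum.swap)

lemma cov_kernel_markov:
  assumes "t < q" "q < s"
  shows "cov_kernel s t = cov_kernel s q * mat_inv d (cov_kernel 0 0) * cov_kernel q t"
proof (rule eq_matI)
  fix a b assume "a < dim_row (cov_kernel s q * mat_inv d (cov_kernel 0 0) * cov_kernel q t)"
    "b < dim_col (cov_kernel s q * mat_inv d (cov_kernel 0 0) * cov_kernel q t)"
  then have ab: "a < d" "b < d" by auto
  \<comment> \<open>\<open>propagate\<close> is applied to the unit vector of index
    \<open>a\<close>, with the lag split at \<open>q\<close>.\<close>
  define y0 where "y0 = (\<lambda>k. \<Sum>a'<d. (if a' = a then 1 else 0) * f (a' + k) (s - q))"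
  have y0: "y0 k = f (a + k) (s - q)" for k
    unfolding y0_def using ab by (simp add: if_distrib[of "\<lambda>x. x * _"] cong: if_cong)
  have "f (a + b) (s - t) = (\<Sum>a'<d. (if a' = a then 1 else 0) * f (a' + b) ((s - q) + (q - t)))"
    using ab by (simp add: if_distrib[of "\<lambda>x. x * _"] cong: if_cong)
  also have "\<dots> = (\<Sum>c<d. (\<Sum>e<d. Ri c e * ((- 1) ^ e * y0 e)) * f (c + b) (q - t))"
    by (rule propagate[OF R_Ri]) (auto simp: y0_def)
  also have "\<dots> = (\<Sum>c<d. \<Sum>e<d. Ri c e * ((- 1) ^ e * f (a + e) (s - q)) * f (c + b) (q - t))"
    by (simp add: y0 sum_distrib_right)
  also have "\<dots> = (\<Sum>e<d. \<Sum>c<d. (- 1) ^ e * f (a + e) (s - q) * Ri e c * f (c + b) (q - t))"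
    by (subst sum.swap) (auto intro!: sum.cong simp: Ri_sym mult_ac)
  finally have "(- 1) ^ b * f (a + b) (s - t) =
    (\<Sum>e<d. \<Sum>c<d. cov_kernel s q $$ (a, e) * Ri e c * cov_kernel q t $$ (c, b))"
    using ab assms by (auto intro!: sum.cong simp: sum_distrib_left cov_kernel_index mult_ac)
  then show "cov_kernel s t $$ (a, b) = (cov_kernel s q * mat_inv d (cov_kernel 0 0) * cov_kernel q t) $$ (a, b)"
    unfolding triple_product[OF ab] using ab assms by (simp add: cov_kernel_index)
qed auto

text \<open>A kernel vector \<open>v\<close> makes the quadratic form of the Schur complement vanish
  at lag \<open>s - t\<close>; at lag 0 the complement itself is zero. Hence the form
  \<open>Q\<close> of \<open>schur_kernel\<close> takes the same value at both lags, which forces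
  \<open>v\<close> to be zero.\<close>

lemma det_schur:
  assumes "t < s"
  shows "Determinant.det (cov_kernel 0 0 - cov_kernel s t * mat_inv d (cov_kernel 0 0) * cov_kernel t s) \<noteq> 0"
    (is "Determinant.det (?S s) \<noteq> 0")
proof (rule det_nonzeroI)
  show "?S s \<in> carrier_mat d d" by (intro minus_carrier_mat mult_carrier_mat[of _ d d]) (auto simp: Ri_carrier)
  fix v b assume v: "\<And>a. a < d \<Longrightarrow> (\<Sum>b<d. ?S s $$ (a, b) * v b) = 0" and b: "b < d"
  define Y where "Y = (\<lambda>b x. (- 1) ^ b * (\<Sum>a<d. v a * f (a + b) x))"
  have form: "(\<Sum>a<d. \<Sum>b<d. v a * ?S s $$ (a, b) * v b)
    = (\<Sum>a<d. \<Sum>b<d. v a * R a b * v b) - (\<Sum>c<d. \<Sum>e<d. Ri c e * Y c (s - t) * Y e (s - t))"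
    if "t \<le> s" for s
  proof -
    have Y: "Y c (s - t) = (\<Sum>a<d. v a * cov_kernel s t $$ (a, c))" if "c < d" for c
      using that \<open>t \<le> s\<close> unfolding Y_def sum_distrib_left
      by (auto intro!: sum.cong simp: cov_kernel_index mult_ac)
    have T: "cov_kernel t s $$ (e, b) = cov_kernel s t $$ (b, e)" if "e < d" "b < d" for e b
      using that cov_kernel_transpose[of s t] index_transpose_mat(1)[of e "cov_kernel s t" b] by simp
    have "(\<Sum>c<d. \<Sum>e<d. Ri c e * Y c (s - t) * Y e (s - t))
      = (\<Sum>c<d. \<Sum>e<d. \<Sum>a<d. \<Sum>b<d. v a * (cov_kernel s t $$ (a, c) * Ri c e * cov_kernel t s $$ (e, b)) * v b)"
    proof (intro sum.cong refl)
      fix c e assume "c \<in> {..<d}" "e \<in> {..<d}"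
      then have ce: "c < d" "e < d" by auto
      have Y': "Y e (s - t) = (\<Sum>b<d. cov_kernel t s $$ (e, b) * v b)"
        unfolding Y[OF ce(2)] using ce by (intro sum.cong refl) (auto simp: T)
      show "Ri c e * Y c (s - t) * Y e (s - t)
        = (\<Sum>a<d. \<Sum>b<d. v a * (cov_kernel s t $$ (a, c) * Ri c e * cov_kernel t s $$ (e, b)) * v b)"
        unfolding Y' unfolding Y[OF ce(1)] by (simp add: sum_product sum_distrib_left mult_ac)
    qed
    also have "\<dots> = (\<Sum>c<d. \<Sum>a<d. \<Sum>e<d. \<Sum>b<d. v a * (cov_kernel s t $$ (a, c) * Ri c e * cov_kernel t s $$ (e, b)) * v b)"
      by (rule sum.cong[OF refl], rule sum.swap)
    also have "\<dots> = (\<Sum>a<d. \<Sum>c<d. \<Sum>b<d. \<Sum>e<d. v a * (cov_kernel s t $$ (a, c) * Ri c e * cov_kernel t s $$ (e, b)) * v b)"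
      by (subst sum.swap, rule sum.cong[OF refl], rule sum.cong[OF refl], rule sum.swap)
    also have "\<dots> = (\<Sum>a<d. \<Sum>b<d. \<Sum>c<d. \<Sum>e<d. v a * (cov_kernel s t $$ (a, c) * Ri c e * cov_kernel t s $$ (e, b)) * v b)"
      by (rule sum.cong[OF refl], rule sum.swap)
    also have "\<dots> = (\<Sum>a<d. \<Sum>b<d. v a * (cov_kernel s t * mat_inv d (cov_kernel 0 0) * cov_kernel t s) $$ (a, b) * v b)"
      by (auto intro!: sum.cong simp del: index_mult_mat simp: triple_product sum_distrib_left sum_distrib_right)
    finally have Q: "(\<Sum>c<d. \<Sum>e<d. Ri c e * Y c (s - t) * Y e (s - t))
      = (\<Sum>a<d. \<Sum>b<d. v a * (cov_kernel s t * mat_inv d (cov_kernel 0 0) * cov_kernel t s) $$ (a, b) * v b)" .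
    show ?thesis
      unfolding Q sum_subtractf[symmetric]
    proof (intro sum.cong refl)
      fix a b assume "a \<in> {..<d}" "b \<in> {..<d}"
      then have "?S s $$ (a, b)
        = R a b - (cov_kernel s t * mat_inv d (cov_kernel 0 0) * cov_kernel t s) $$ (a, b)"
        by (simp add: R_eq del: index_mult_mat(1))
      then show "v a * ?S s $$ (a, b) * v b = v a * R a b * v b
        - v a * (cov_kernel s t * mat_inv d (cov_kernel 0 0) * cov_kernel t s) $$ (a, b) * v b"
        by (simp only: right_diff_distrib left_diff_distrib)
    qed
  qed
  have z: "(\<Sum>a<d. \<Sum>b<d. v a * ?S s $$ (a, b) * v b) = 0"
  proof -
    have "(\<Sum>a<d. \<Sum>b<d. v a * ?S s $$ (a, b) * v b) = (\<Sum>a<d. v a * (\<Sum>b<d. ?S s $$ (a, b) * v b))"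
      by (simp only: sum_distrib_left mult.assoc)
    also have "\<dots> = 0" by (intro sum.neutral ballI) (simp only: lessThan_iff v mult_zero_right)
    finally show ?thesis .
  qed
  have t0: "?S t = 0\<^sub>m d d"
  proof -
    have "cov_kernel 0 0 * mat_inv d (cov_kernel 0 0) * cov_kernel 0 0 = cov_kernel 0 0"
      by (simp add: mat_inv(2)[OF cov_kernel_carrier det_cov_kernel] left_mult_one_mat[of _ d d])
    then show ?thesis by (simp add: cov_kernel_diag[of t])
  qed
  have z0: "(\<Sum>a<d. \<Sum>b<d. v a * ?S t $$ (a, b) * v b) = 0"
    unfolding t0 by simp
  have "(\<Sum>c<d. \<Sum>e<d. Ri c e * Y c (s - t) * Y e (s - t)) = (\<Sum>c<d. \<Sum>e<d. Ri c e * Y c 0 * Y e 0)"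
    using form[of s] form[of t] z z0 assms by simp
  from schur_kernel[OF R_Ri Ri_sym _ this[unfolded Y_def] b] show "v b = 0"
    using assms by simp
qed

lemma cov_kernel_markov_kernel: "markov_kernel d cov_kernel"
proof
  show "cov_kernel s t = cov_kernel s q * mat_inv d (cov_kernel 0 0) * cov_kernel q t"
    if "t < q" "q < s" for s q t
    using that by (rule cov_kernel_markov)
  show "Determinant.det (cov_kernel 0 0 - cov_kernel s t * mat_inv d (cov_kernel 0 0) * cov_kernel t s) \<noteq> 0"
    if "t < s" for s t
    using that by (rule det_schur)
qed (rule d_pos cov_kernel_carrier cov_kernel_diag cov_kernel_transpose det_cov_kernel)+

end

section \<open>The covariance functions of the approximation\<close>

text \<open>Differentiation conjugated by the exponential: the derivative of
  \<open>exp (- x) * poly p x\<close> is \<open>exp (- x) * poly (twist p) x\<close>.\<close>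

definition twist :: "real poly \<Rightarrow> real poly" where "twist p = pderiv p - p"

lemma twist_add: "(twist ^^ k) (p + q) = (twist ^^ k) p + (twist ^^ k) q"
  by (induction k arbitrary: p q) (simp_all add: twist_def pderiv_add)

lemma twist_smult: "(twist ^^ k) (Polynomial.smult c p) = Polynomial.smult c ((twist ^^ k) p)"
  by (induction k arbitrary: p) (simp_all add: twist_def pderiv_smult smult_diff_right)

definition exp_poly :: "real poly \<Rightarrow> nat \<Rightarrow> real \<Rightarrow> real" where
  "exp_poly p k x = exp (- x) * poly ((twist ^^ k) p) x"

lemma deriv_tower_exp_poly: "deriv_tower (exp_poly p)"
  unfolding deriv_tower_def exp_poly_def
  by (auto intro!: derivative_eq_intros simp: twist_def algebra_simps)

text \<open>\<open>D + 1\<close> acts on \<open>exp (- x) * poly p x\<close> as differentiation of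
  \<open>p\<close> alone, so \<open>j\<close> factors exhaust a polynomial of degree below
  \<open>j\<close>.\<close>

lemma annihilated_exp_poly:
  "(pderiv ^^ j) p = 0 \<Longrightarrow> annihilated (replicate j 1) (exp_poly p)"
proof (induction j arbitrary: p)
  case 0
  have "(twist ^^ k) 0 = 0" for k by (induction k) (simp_all add: twist_def)
  then show ?case using 0 by (simp add: exp_poly_def)
next
  case (Suc j)
  have "(twist ^^ Suc k) p + (twist ^^ k) p = (twist ^^ k) (pderiv p)" for k
    using twist_add[of k "twist p" p] by (simp add: funpow_swap1 twist_def)
  then have "exp_poly p (Suc k) x + 1 * exp_poly p k x = exp_poly (pderiv p) k x" for k x
    unfolding exp_poly_def by (metis distrib_left mult_1 poly_add)
  moreover have "annihilated (replicate j 1) (exp_poly (pderiv p))"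
    using Suc by (simp add: funpow_swap1)
  ultimately show ?case by simp
qed

lemma funpow_pderiv_eq_0: "degree p < j \<Longrightarrow> (pderiv ^^ j) p = (0 :: real poly)"
proof (induction j arbitrary: p)
  case (Suc j)
  have "(pderiv ^^ j) (pderiv p) = 0"
  proof (cases "degree p = 0")
    case True
    then have "pderiv p = 0" by (simp add: pderiv_eq_0_iff)
    moreover have "(pderiv ^^ j) (0 :: real poly) = 0" by (induction j) simp_all
    ultimately show ?thesis by simp
  next
    case False
    then show ?thesis using Suc.prems by (intro Suc.IH) (simp add: degree_pderiv)
  qed
  then show ?case by (simp add: funpow_swap1)
qed simp

lemma degree_rev_bessel: "degree (rev_bessel n) \<le> n"
proof (induction n rule: rev_bessel.induct)
  case (3 n)
  have "degree ([:0, 0, 1:] * rev_bessel n) \<le> Suc (Suc n)"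
    using degree_mult_le[of "[:0, 0, 1:]" "rev_bessel n"] 3(2) by simp
  moreover have "degree (Polynomial.smult (2 * real n + 3) (rev_bessel (Suc n))) \<le> Suc (Suc n)"
    using 3(1) by simp
  ultimately show ?case by (simp add: degree_add_le)
qed simp_all

text \<open>With the exponential restored this is the Bessel rule that
  \<open>x powr \<nu> * bessel_K \<nu> x\<close> has the derivative
  \<open>- (x powr \<nu> * bessel_K (\<nu> - 1) x)\<close>.\<close>

lemma twist_rev_bessel: "twist (rev_bessel (Suc n)) = - (pCons 0 (rev_bessel n))"
proof (induction n rule: rev_bessel.induct)
  case 1
  then show ?case by (simp add: twist_def pderiv_pCons one_pCons)
next
  case 2
  then show ?case by (simp add: twist_def pderiv_pCons one_pCons)
next
  case (3 n)
  let ?B = "rev_bessel"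
  have d1: "pderiv (?B (Suc (Suc n))) = ?B (Suc (Suc n)) - pCons 0 (?B (Suc n))"
    and d0: "pderiv (?B (Suc n)) = ?B (Suc n) - pCons 0 (?B n)"
  proof -
    have "q = p - r" if "q - p = - r" for p q r :: "real poly" using that by (simp add: diff_eq_eq)
    then show "pderiv (?B (Suc (Suc n))) = ?B (Suc (Suc n)) - pCons 0 (?B (Suc n))"
      "pderiv (?B (Suc n)) = ?B (Suc n) - pCons 0 (?B n)"
      using 3 unfolding twist_def by blast+
  qed
  have e: "?B (Suc (Suc (Suc n))) = Polynomial.smult (2 * real n + 5) (?B (Suc (Suc n))) + pCons 0 (pCons 0 (?B (Suc n)))"
    by (simp add: algebra_simps)
  have f: "?B (Suc (Suc n)) = Polynomial.smult (2 * real n + 3) (?B (Suc n)) + pCons 0 (pCons 0 (?B n))"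
    by (simp add: algebra_simps)
  show ?case
  proof (rule poly_eq_poly_eq_iff[THEN iffD1], rule ext)
    fix x
    have "poly (?B (Suc (Suc n))) x = (2 * real n + 3) * poly (?B (Suc n)) x + x * (x * poly (?B n) x)"
      by (subst f) simp
    then show "poly (twist (?B (Suc (Suc (Suc n))))) x = poly (- pCons 0 (?B (Suc (Suc n)))) x"
      unfolding e twist_def pderiv_add pderiv_smult pderiv_pCons d1 d0
      by (simp add: algebra_simps)
  qed
qed

lemma twist_twist_rev_bessel:
  "twist (twist (rev_bessel (Suc n))) = rev_bessel (Suc n) - Polynomial.smult (2 * real n + 2) (rev_bessel n)"
proof (cases n)
  case 0
  then show ?thesis by (simp add: twist_rev_bessel twist_def pderiv_pCons one_pCons pderiv_minus)
next
  case (Suc m)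
  have "twist (- (pCons 0 (rev_bessel (Suc m)))) = - rev_bessel (Suc m) - pCons 0 (twist (rev_bessel (Suc m)))"
    by (simp add: twist_def pderiv_pCons pderiv_minus)
  also have "\<dots> = - rev_bessel (Suc m) + pCons 0 (pCons 0 (rev_bessel m))"
    by (simp add: twist_rev_bessel)
  also have "pCons 0 (pCons 0 (rev_bessel m)) = rev_bessel (Suc n) - Polynomial.smult (2 * real m + 3) (rev_bessel n)"
    using Suc by simp
  finally have t: "twist (- (pCons 0 (rev_bessel n)))
    = - rev_bessel n + (rev_bessel (Suc n) - Polynomial.smult (2 * real m + 3) (rev_bessel n))"
    by (simp only: Suc)
  have "Polynomial.smult (2 * real n + 2) (rev_bessel n)
    = rev_bessel n + Polynomial.smult (2 * real m + 3) (rev_bessel n)"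
    using smult_add_left[of 1 "2 * real m + 3" "rev_bessel n"] by (simp add: Suc add_ac del: rev_bessel.simps)
  then show ?thesis unfolding twist_rev_bessel t by simp
qed

text \<open>The factor makes \<open>bessel_tower (n + 1)\<close> minus its second derivative exactly
  \<open>bessel_tower n\<close>: passing from \<open>n\<close> to \<open>n + 1\<close> multiplies
  the denominator by \<open>2 * n + 2\<close>, the constant in
  \<open>twist_twist_rev_bessel\<close>.\<close>

definition bessel_tower :: "nat \<Rightarrow> nat \<Rightarrow> real \<Rightarrow> real" where
  "bessel_tower n k x = 1 / (2 ^ n * fact n) * exp_poly (rev_bessel n) k x"

lemma deriv_tower_bessel_tower: "deriv_tower (bessel_tower n)"
  unfolding bessel_tower_def by (rule deriv_tower_scale[OF deriv_tower_exp_poly])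

lemma annihilated_bessel_tower: "annihilated (replicate (Suc n) 1) (bessel_tower n)"
  unfolding bessel_tower_def
  by (rule annihilated_scale, rule annihilated_exp_poly, rule funpow_pderiv_eq_0)
    (use degree_rev_bessel[of n] in simp)

lemma bessel_tower_second: "bessel_tower (Suc n) (Suc (Suc k)) x = bessel_tower (Suc n) k x - bessel_tower n k x"
proof -
  have "(twist ^^ Suc (Suc k)) (rev_bessel (Suc n)) = (twist ^^ k) (twist (twist (rev_bessel (Suc n))))"
    by (simp add: funpow_swap1)
  also have "\<dots> = (twist ^^ k) (rev_bessel (Suc n)) + Polynomial.smult (- (2 * real n + 2)) ((twist ^^ k) (rev_bessel n))"
    unfolding twist_twist_rev_bessel diff_conv_add_uminus smult_minus_left[symmetric] twist_add twist_smult ..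
  finally have "exp_poly (rev_bessel (Suc n)) (Suc (Suc k)) x
    = exp_poly (rev_bessel (Suc n)) k x - (2 * real n + 2) * exp_poly (rev_bessel n) k x"
    unfolding exp_poly_def by (simp add: algebra_simps)
  moreover have "1 / (2 ^ Suc n * fact (Suc n)) * (2 * real n + 2) = 1 / (2 ^ n * fact n :: real)"
    by (simp add: divide_simps)
  ultimately show ?thesis unfolding bessel_tower_def
    by (simp only: right_diff_distrib mult.assoc[symmetric])
qed

lemma bessel_tower_0_second: "bessel_tower 0 (Suc (Suc k)) x = bessel_tower 0 k x"
proof -
  have "(twist ^^ Suc (Suc k)) 1 = (twist ^^ k) (twist (twist 1))" by (simp add: funpow_swap1)
  also have "twist (twist 1) = 1" by (simp add: twist_def pderiv_minus)
  finally show ?thesis by (simp add: bessel_tower_def exp_poly_def)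
qed

lemma bessel_tower_first: "bessel_tower 0 1 0 = - 1" "bessel_tower (Suc n) 1 0 = 0"
  by (simp_all add: bessel_tower_def exp_poly_def twist_rev_bessel del: rev_bessel.simps(2,3))
    (simp add: twist_def)

text \<open>The hypothesis \<open>F (n + 1) - D\<^sup>2 F (n + 1) = F n\<close> expresses division of the spectral density by
  \<open>1 + w\<^sup>2\<close>.\<close>

lemma odd_derivs_at_0:
  fixes F :: "nat \<Rightarrow> nat \<Rightarrow> real \<Rightarrow> real"
  assumes "\<And>n k. F (Suc n) (Suc (Suc k)) 0 = F (Suc n) k 0 - F n k 0"
    and "F 0 1 0 = - 1" and "\<And>n. F (Suc n) 1 0 = 0"
  shows "q \<le> n \<Longrightarrow> F n (2 * q + 1) 0 = (if q < n then 0 else (- 1) ^ Suc n)"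
proof (induction n arbitrary: q)
  case 0
  then show ?case using assms(2) by simp
next
  case (Suc n)
  from Suc.prems show ?case
  proof (induction q)
    case 0
    then show ?case using assms(3) by simp
  next
    case (Suc q)
    \<comment> \<open>Lowering the order by two subtracts an odd derivative of \<open>F n\<close>,
      which is zero until \<open>q = n\<close> and there supplies the alternating sign of the next
      level.\<close>
    have "F (Suc n) (2 * Suc q + 1) 0 = F (Suc n) (2 * q + 1) 0 - F n (2 * q + 1) 0"
      using assms(1)[of n "2 * q + 1"] by simp
    then show ?case using Suc Suc.prems \<open>\<And>q. q \<le> n \<Longrightarrow> _\<close>[of q] by auto
  qed
qed

lemma markov_towerI:
  fixes F :: "nat \<Rightarrow> nat \<Rightarrow> real \<Rightarrow> real"
  assumes "\<And>n k. F (Suc n) (Suc (Suc k)) 0 = F (Suc n) k 0 - F n k 0"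
    and "F 0 1 0 = - 1" and "\<And>n. F (Suc n) 1 0 = 0"
    and "deriv_tower (F n)" "annihilated ls (F n)" "length ls = Suc n" and "C > 0" "\<kappa> > 0"
  shows "markov_tower (Suc n) (map ((*) \<kappa>) ls) (\<lambda>k x. C * \<kappa> ^ k * F n k (\<kappa> * x))"
proof
  show "deriv_tower (\<lambda>k x. C * \<kappa> ^ k * F n k (\<kappa> * x))"
    by (rule deriv_tower_dilate[OF assms(4)])
  show "annihilated (map ((*) \<kappa>) ls) (\<lambda>k x. C * \<kappa> ^ k * F n k (\<kappa> * x))"
    by (rule annihilated_dilate[OF assms(5)])
  show "length (map ((*) \<kappa>) ls) = Suc n" using assms(6) by simp
  note o = odd_derivs_at_0[of F, OF assms(1-3)]
  show "C * \<kappa> ^ k * F n k (\<kappa> * 0) = 0" if k: "odd k" "k < 2 * Suc n - 1" for k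
  proof -
    from k obtain q where "k = 2 * q + 1" by (elim oddE)
    then show ?thesis using o[of q n] k by simp
  qed
  have "F n (2 * Suc n - 1) 0 = (- 1) ^ Suc n" using o[of n n] by simp
  then have "(- 1) ^ Suc n * (C * \<kappa> ^ (2 * Suc n - 1) * F n (2 * Suc n - 1) (\<kappa> * 0))
    = C * \<kappa> ^ (2 * Suc n - 1) * ((- 1) ^ Suc n * (- 1) ^ Suc n)" by simp
  also have "(- 1) ^ Suc n * (- 1) ^ Suc n = (1 :: real)"
    by (simp only: power_mult_distrib[symmetric]) simp
  finally show "(- 1) ^ Suc n * (C * \<kappa> ^ (2 * Suc n - 1) * F n (2 * Suc n - 1) (\<kappa> * 0)) > 0"
    using assms(7,8) by simp
qed simp

text \<open>The recursion is the partial fraction identity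
  \<open>1 / (y^(n+1) (y - p)) = (1 / (y^n (y - p)) - 1 / y^(n+1)) / p\<close> of the spectral densities, where
  \<open>bessel_tower n\<close> belongs to \<open>1 / y^(n+1)\<close> and \<open>y = 1 + w\<^sup>2\<close>.\<close>

fun mixed_tower :: "real \<Rightarrow> nat \<Rightarrow> nat \<Rightarrow> real \<Rightarrow> real" where
  "mixed_tower p 0 k x = (- sqrt (1 - p)) ^ k * exp (- sqrt (1 - p) * x) / sqrt (1 - p)"
| "mixed_tower p (Suc n) k x = 1 / p * mixed_tower p n k x + (- 1 / p) * bessel_tower n k x"

lemma annihilated_append_right: "annihilated ms f \<Longrightarrow> annihilated (ms @ ls) f"
  by (induction ms arbitrary: f) (auto intro: annihilated_zero)

lemma mixed_tower:
  assumes "p < 0"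
  shows "deriv_tower (mixed_tower p n)"
    and "annihilated (replicate n 1 @ [sqrt (1 - p)]) (mixed_tower p n)"
proof -
  have l: "sqrt (1 - p) \<noteq> 0" using assms by simp
  show "deriv_tower (mixed_tower p n)"
  proof (induction n)
    case 0
    have "((\<lambda>x. (- sqrt (1 - p)) ^ k * exp (- sqrt (1 - p) * x) / sqrt (1 - p)) has_real_derivative
      (- sqrt (1 - p)) ^ Suc k * exp (- sqrt (1 - p) * x) / sqrt (1 - p)) (at x)" for k x
      by (rule derivative_eq_intros refl)+ (use l in \<open>simp_all add: field_simps\<close>)
    then show ?case by (simp add: deriv_tower_def del: power_Suc)
  next
    case (Suc n)
    have "mixed_tower p (Suc n) = (\<lambda>k x. 1 / p * mixed_tower p n k x + (- 1 / p) * bessel_tower n k x)"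
      by (intro ext) simp
    then show ?case
      by (simp only: deriv_tower_add[OF deriv_tower_scale[OF Suc] deriv_tower_scale[OF deriv_tower_bessel_tower]])
  qed
  show "annihilated (replicate n 1 @ [sqrt (1 - p)]) (mixed_tower p n)"
  proof (induction n)
    case (Suc n)
    have e: "mixed_tower p (Suc n) = (\<lambda>k x. 1 / p * mixed_tower p n k x + (- 1 / p) * bessel_tower n k x)"
      by (intro ext) simp
    have "annihilated (replicate (Suc n) 1 @ [sqrt (1 - p)]) (mixed_tower p n)"
      using annihilated_Cons[OF Suc, of 1] by simp
    moreover have "annihilated (replicate (Suc n) 1 @ [sqrt (1 - p)]) (bessel_tower n)"
      by (rule annihilated_append_right[OF annihilated_bessel_tower])
    ultimately show ?case
      unfolding e by (intro annihilated_add annihilated_scale)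
  qed (use l in \<open>simp add: field_simps\<close>)
qed

text \<open>By linearity only the first level needs a computation: there two derivatives multiply
  the exponential of rate \<open>sqrt (1 - p)\<close> by \<open>1 - p\<close> and
  \<open>bessel_tower 0\<close> by 1, and the excess \<open>- p\<close> is cancelled by the factor
  \<open>1 / p\<close>.\<close>

lemma mixed_tower_second:
  assumes "p < 0"
  shows "mixed_tower p (Suc n) (Suc (Suc k)) x = mixed_tower p (Suc n) k x - mixed_tower p n k x"
proof (induction n)
  case 0
  have *: "sqrt (1 - p) * sqrt (1 - p) = 1 - p" using assms by simp
  have "mixed_tower p 0 (Suc (Suc k)) x = (1 - p) * mixed_tower p 0 k x"
  proof -
    have g: "(- l) ^ Suc (Suc k) * e / l = q * ((- l) ^ k * e / l)" if "l * l = q" for l e q :: real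
      using that[symmetric] by simp
    show ?thesis unfolding mixed_tower.simps(1) by (rule g[OF *])
  qed
  then have "mixed_tower p (Suc 0) (Suc (Suc k)) x = 1 / p * ((1 - p) * mixed_tower p 0 k x) - 1 / p * bessel_tower 0 k x"
    by (simp add: bessel_tower_0_second del: mixed_tower.simps(1))
  also have "\<dots> = mixed_tower p (Suc 0) k x - mixed_tower p 0 k x"
    using assms by (simp add: field_simps del: mixed_tower.simps(1))
  finally show ?case .
next
  case (Suc n)
  have "mixed_tower p (Suc (Suc n)) (Suc (Suc k)) x
    = 1 / p * (mixed_tower p (Suc n) k x - mixed_tower p n k x) + (- 1 / p) * (bessel_tower (Suc n) k x - bessel_tower n k x)"
    by (simp only: mixed_tower.simps(2)[of _ "Suc n"] Suc bessel_tower_second)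
  also have "\<dots> = mixed_tower p (Suc (Suc n)) k x - (1 / p * mixed_tower p n k x + (- 1 / p) * bessel_tower n k x)"
    by (simp only: mixed_tower.simps(2)[of _ "Suc n"]) (simp add: algebra_simps)
  finally show ?case by (simp only: mixed_tower.simps(2)[of _ n])
qed

text \<open>Both exponentials are normalised to slope -1 at 0, so their difference at the first
  level has slope 0, which the recursion preserves.\<close>

lemma mixed_tower_first:
  assumes "p < 0"
  shows "mixed_tower p 0 1 0 = - 1" "mixed_tower p (Suc n) 1 0 = 0"
proof -
  show 0: "mixed_tower p 0 1 0 = - 1" using assms by simp
  show "mixed_tower p (Suc n) 1 0 = 0"
  proof (induction n)
    case 0
    show ?case unfolding mixed_tower.simps(2) \<open>mixed_tower p 0 1 0 = - 1\<close> bessel_tower_first by simp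
  next
    case (Suc n)
    show ?case unfolding mixed_tower.simps(2)[of _ "Suc n"] Suc bessel_tower_first by simp
  qed
qed

lemma mixed_tower_explicit:
  assumes "p < 0"
  shows "mixed_tower p N 0 x = 1 / p ^ N * mixed_tower p 0 0 x
    - (\<Sum>j=1..N. 1 / p ^ (N + 1 - j) * bessel_tower (j - 1) 0 x)"
proof (induction N)
  case (Suc N)
  have "(\<Sum>j=1..Suc N. 1 / p ^ (Suc N + 1 - j) * bessel_tower (j - 1) 0 x)
    = (\<Sum>j=1..N. 1 / p * (1 / p ^ (N + 1 - j) * bessel_tower (j - 1) 0 x)) + 1 / p * bessel_tower N 0 x"
  proof -
    have "(\<Sum>j=1..N. 1 / p ^ (Suc N + 1 - j) * bessel_tower (j - 1) 0 x)
      = (\<Sum>j=1..N. 1 / p * (1 / p ^ (N + 1 - j) * bessel_tower (j - 1) 0 x))"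
      by (intro sum.cong refl) (auto simp: Suc_diff_le)
    then show ?thesis by simp
  qed
  also have "\<dots> = 1 / p * (\<Sum>j=1..N. 1 / p ^ (N + 1 - j) * bessel_tower (j - 1) 0 x) + 1 / p * bessel_tower N 0 x"
    by (simp only: sum_distrib_left)
  finally have s: "(\<Sum>j=1..Suc N. 1 / p ^ (Suc N + 1 - j) * bessel_tower (j - 1) 0 x)
    = 1 / p * (\<Sum>j=1..N. 1 / p ^ (N + 1 - j) * bessel_tower (j - 1) 0 x) + 1 / p * bessel_tower N 0 x" .
  show ?case unfolding s mixed_tower.simps(2) Suc
    by (simp add: algebra_simps del: mixed_tower.simps(1))
qed simp

section \<open>Identification of the given covariance functions with towers\<close>

lemma matern_bessel_tower:
  assumes "\<kappa> > 0"
  shows "matern h (real (Suc n) - 1/2) \<kappa> (g / gamma_ratio (real (Suc n)))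
    = g * sqrt pi * bessel_tower n 0 (\<kappa> * \<bar>h\<bar>)"
  using matern_half_integer[OF assms, of h n g]
  by (simp add: bessel_tower_def exp_poly_def algebra_simps)

lemma matern_exponential:
  assumes "\<kappa> > 0"
  shows "matern h (1/2) \<kappa> g = g * exp (- (\<kappa> * \<bar>h\<bar>))"
proof -
  have "gamma_ratio 1 = 1 / sqrt pi" by (simp add: gamma_ratio_def Gamma_one_half_real)
  then show ?thesis
    using matern_half_integer[OF assms, of h 0 "g / sqrt pi"] by simp
qed

text \<open>As \<open>\<alpha>\<close> is not an integer, its ceiling exceeds its floor by one; the
  block then holds the derivatives of orders 0 to \<open>max_deriv_order\<close>.\<close>

lemma block_size_eq:
  assumes "\<alpha> > 1/2" "\<alpha> \<notin> \<nat>"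
  shows "block_size \<alpha> i = Suc (max_deriv_order \<alpha> i)"
proof -
  have "\<alpha> \<notin> \<int>"
  proof
    assume "\<alpha> \<in> \<int>"
    then obtain z where z: "\<alpha> = of_int z" by (elim Ints_cases)
    then have "\<alpha> = of_nat (nat z)" using assms(1) by simp
    then show False using assms(2) by (metis of_nat_in_Nats)
  qed
  then have "\<alpha> \<noteq> of_int \<lfloor>\<alpha>\<rfloor>" by (metis Ints_of_int)
  then have "\<lceil>\<alpha>\<rceil> = \<lfloor>\<alpha>\<rfloor> + 1" by (simp add: ceiling_altdef)
  moreover have "nat (max z 1) = Suc (nat (max (z - 1) 0))" "nat (z + 1) = Suc (nat z)" if "z \<ge> 0" for z :: int
    using that by arith+
  moreover have "\<lfloor>\<alpha>\<rfloor> \<ge> 0" using assms(1) by simp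
  ultimately show ?thesis
    unfolding block_size_def max_deriv_order_def by simp
qed

lemma approx_cov_tower:
  assumes "\<alpha> > 1/2" "\<kappa> > 0" "s2 > 0" "k > 0" "i > 0 \<Longrightarrow> c i > 0 \<and> p i < 0"
    and "\<alpha> \<notin> \<nat>" and "\<not> (\<alpha> < 1 \<and> i = 0)"
  shows "\<exists>f ls. markov_tower (block_size \<alpha> i) ls f \<and> (\<forall>h. approx_cov \<alpha> \<kappa> s2 k c p i h = f 0 \<bar>h\<bar>)"
proof -
  define N where "N = nat \<lfloor>\<alpha>\<rfloor>"
  \<comment> \<open>Common amplitude of all Matern terms once their Gamma values are
    cancelled.\<close>
  define G where "G = gamma_ratio \<alpha> * sqrt pi"
  have G: "G > 0"
    using assms(1) by (auto simp: G_def gamma_ratio_def intro!: mult_pos_pos divide_pos_pos Gamma_real_pos)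
  have M: "matern h (real j - 1/2) \<kappa> (gamma_ratio \<alpha> / gamma_ratio (real j))
    = G * bessel_tower (j - 1) 0 (\<kappa> * \<bar>h\<bar>)" if "j \<ge> 1" for h j
    using matern_bessel_tower[OF assms(2), of h "j - 1" "gamma_ratio \<alpha>"] that by (simp add: G_def)
  show ?thesis
  proof (cases "i = 0")
    case True
    then have a: "\<alpha> \<ge> 1" using assms by auto
    then have N: "N \<ge> 1" unfolding N_def by linarith
    have bs: "block_size \<alpha> i = Suc (N - 1)" using True a N unfolding block_size_def N_def by simp
    define f where "f = (\<lambda>l x. k * s2 * G * \<kappa> ^ l * bessel_tower (N - 1) l (\<kappa> * x))"
    have "markov_tower (Suc (N - 1)) (map ((*) \<kappa>) (replicate (Suc (N - 1)) 1)) f"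
      unfolding f_def
      by (rule markov_towerI[where F = bessel_tower])
        (use assms G in \<open>simp_all only: bessel_tower_second bessel_tower_first deriv_tower_bessel_tower
          annihilated_bessel_tower length_replicate mult_pos_pos\<close>)
    moreover have "approx_cov \<alpha> \<kappa> s2 k c p i h = f 0 \<bar>h\<bar>" for h
      using True a M[OF N, of h] by (simp add: approx_cov_def f_def Let_def N_def[symmetric])
    ultimately show ?thesis unfolding bs by blast
  next
    case False
    then have ci: "c i > 0" and pi: "p i < 0" using assms(5) by auto
    define l where "l = sqrt (1 - p i)"
    have l: "l > 0" using pi by (simp add: l_def)
    have bs: "block_size \<alpha> i = Suc N"
      using block_size_eq[OF assms(1,6), of i] False by (simp add: max_deriv_order_def N_def)
    define f where "f = (\<lambda>j x. c i * s2 * G * \<kappa> ^ j * mixed_tower (p i) N j (\<kappa> * x))"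
    have mt: "markov_tower (Suc N) (map ((*) \<kappa>) (replicate N 1 @ [sqrt (1 - p i)])) f"
      unfolding f_def
      by (rule markov_towerI[where F = "mixed_tower (p i)", OF mixed_tower_second[OF pi]
            mixed_tower_first(1)[OF pi] mixed_tower_first(2)[OF pi] mixed_tower[OF pi]])
        (use assms(2,3) G ci in simp_all)
    have E: "matern h (1/2) (\<kappa> * l) (gamma_ratio \<alpha> * sqrt pi / l) = G * mixed_tower (p i) 0 0 (\<kappa> * \<bar>h\<bar>)" for h
      using matern_exponential[of "\<kappa> * l" h] assms(2) l by (simp add: G_def l_def mult_ac)
    have ac: "approx_cov \<alpha> \<kappa> s2 k c p i h = c i * s2 * (1 / p i ^ N * (G * mixed_tower (p i) 0 0 (\<kappa> * \<bar>h\<bar>)) -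
               (\<Sum>j=1..N. 1 / p i ^ (N + 1 - j) * (G * bessel_tower (j - 1) 0 (\<kappa> * \<bar>h\<bar>))))" for h
    proof -
      have "(\<Sum>j=1..N. 1 / p i ^ (N + 1 - j) * matern h (real j - 1/2) \<kappa> (gamma_ratio \<alpha> / gamma_ratio (real j)))
        = (\<Sum>j=1..N. 1 / p i ^ (N + 1 - j) * (G * bessel_tower (j - 1) 0 (\<kappa> * \<bar>h\<bar>)))"
        by (intro sum.cong refl) (simp only: M atLeastAtMost_iff)
      \<comment> \<open>The separate formula for \<open>\<alpha> < 1\<close> is the general one with
        an empty sum and \<open>p i ^ 0 = 1\<close>.\<close>
      moreover have "N = 0" if "\<alpha> < 1" using that unfolding N_def by linarith
      ultimately show ?thesis
        using False unfolding approx_cov_def Let_def N_def[symmetric] l_def[symmetric] E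
        by (auto simp del: mixed_tower.simps)
    qed
    have "approx_cov \<alpha> \<kappa> s2 k c p i h = f 0 \<bar>h\<bar>" for h
    proof -
      have S: "(\<Sum>j=1..N. 1 / p i ^ (N + 1 - j) * (G * bessel_tower (j - 1) 0 (\<kappa> * \<bar>h\<bar>)))
        = G * (\<Sum>j=1..N. 1 / p i ^ (N + 1 - j) * bessel_tower (j - 1) 0 (\<kappa> * \<bar>h\<bar>))"
        unfolding sum_distrib_left by (intro sum.cong refl) simp
      have "C * (q * (G * E) - G * T) = C * G * 1 * (q * E - T)" for C q E T
        by (simp add: right_diff_distrib)
      then show ?thesis unfolding ac f_def S mixed_tower_explicit[OF pi, of N] power_0 .
    qed
    then show ?thesis unfolding bs using mt by blast
  qed
qed

section \<open>Gaussian processes and mean-square derivatives\<close>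

context prob_space begin

section \<open>Mean-square calculus\<close>

abbreviation "sq \<equiv> square_integrable_rv M"

lemma sq_measurable [measurable_dest]: "sq X \<Longrightarrow> X \<in> borel_measurable M"
  by (simp add: square_integrable_rv_def)

lemma sq_integrable_power2: "sq X \<Longrightarrow> integrable M (\<lambda>\<omega>. (X \<omega>)\<^sup>2)"
  by (simp add: square_integrable_rv_def)

lemma sq_integrable: "sq X \<Longrightarrow> integrable M X"
  unfolding square_integrable_rv_def by (blast intro: square_integrable_imp_integrable)

lemma sq_integrable_mult:
  assumes "sq X" "sq Y"
  shows "integrable M (\<lambda>\<omega>. X \<omega> * Y \<omega>)"
proof (rule Bochner_Integration.integrable_bound)
  show "integrable M (\<lambda>\<omega>. (X \<omega>)\<^sup>2 + (Y \<omega>)\<^sup>2)"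
    using assms by (intro Bochner_Integration.integrable_add sq_integrable_power2)
  show "(\<lambda>\<omega>. X \<omega> * Y \<omega>) \<in> borel_measurable M"
    using assms[THEN sq_measurable] by measurable
  have "\<bar>x * y\<bar> \<le> x\<^sup>2 + y\<^sup>2" for x y :: real
  proof -
    have "2 * (\<bar>x\<bar> * \<bar>y\<bar>) \<le> x\<^sup>2 + y\<^sup>2" using sum_squares_bound[of "\<bar>x\<bar>" "\<bar>y\<bar>"] by simp
    moreover have "0 \<le> \<bar>x\<bar> * \<bar>y\<bar>" by simp
    ultimately show ?thesis unfolding abs_mult by linarith
  qed
  then show "AE \<omega> in M. norm (X \<omega> * Y \<omega>) \<le> norm ((X \<omega>)\<^sup>2 + (Y \<omega>)\<^sup>2)" by simp
qed

lemma sq_lincomb: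
  assumes "sq X" "sq Y"
  shows "sq (\<lambda>\<omega>. a * X \<omega> + b * Y \<omega>)"
proof -
  have "(\<lambda>\<omega>. (a * X \<omega> + b * Y \<omega>)\<^sup>2)
    = (\<lambda>\<omega>. a\<^sup>2 * (X \<omega>)\<^sup>2 + b\<^sup>2 * (Y \<omega>)\<^sup>2 + 2 * a * b * (X \<omega> * Y \<omega>))"
    by (auto simp: power2_eq_square algebra_simps)
  then have "integrable M (\<lambda>\<omega>. (a * X \<omega> + b * Y \<omega>)\<^sup>2)"
    using sq_integrable_power2[OF assms(1)] sq_integrable_power2[OF assms(2)] sq_integrable_mult[OF assms]
    by simp
  then show ?thesis using assms[THEN sq_measurable] unfolding square_integrable_rv_def by simp
qed

lemma sq_diff: "sq X \<Longrightarrow> sq Y \<Longrightarrow> sq (\<lambda>\<omega>. X \<omega> - Y \<omega>)"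
  using sq_lincomb[of X Y 1 "- 1"] by simp

lemma sq_const: "sq (\<lambda>\<omega>. c)"
  by (simp add: square_integrable_rv_def)

lemma L2_Cauchy_Schwarz:
  assumes "sq X" "sq Y"
  shows "(\<integral>\<omega>. X \<omega> * Y \<omega> \<partial>M)\<^sup>2 \<le> (\<integral>\<omega>. (X \<omega>)\<^sup>2 \<partial>M) * (\<integral>\<omega>. (Y \<omega>)\<^sup>2 \<partial>M)"
proof -
  let ?A = "\<integral>\<omega>. (X \<omega>)\<^sup>2 \<partial>M" and ?B = "\<integral>\<omega>. X \<omega> * Y \<omega> \<partial>M" and ?C = "\<integral>\<omega>. (Y \<omega>)\<^sup>2 \<partial>M"
  have q: "0 \<le> ?A - 2 * c * ?B + c\<^sup>2 * ?C" for c
  proof -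
    have "0 \<le> (\<integral>\<omega>. (X \<omega> - c * Y \<omega>)\<^sup>2 \<partial>M)" by simp
    also have "(\<lambda>\<omega>. (X \<omega> - c * Y \<omega>)\<^sup>2) = (\<lambda>\<omega>. (X \<omega>)\<^sup>2 - 2 * c * (X \<omega> * Y \<omega>) + c\<^sup>2 * (Y \<omega>)\<^sup>2)"
      by (auto simp: power2_eq_square algebra_simps)
    finally show ?thesis
      using sq_integrable_power2[OF assms(1)] sq_integrable_power2[OF assms(2)] sq_integrable_mult[OF assms]
      by simp
  qed
  show ?thesis
  proof (cases "?C = 0")
    case True
    have "?B = 0"
    proof (rule ccontr)
      assume "?B \<noteq> 0"
      \<comment> \<open>When the second moment of \<open>Y\<close> is zero, the expression is linear
        in \<open>c\<close>; this choice gives -1.\<close>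
      then show False using q[of "(?A + 1) / (2 * ?B)"] True by simp
    qed
    then show ?thesis using True by simp
  next
    case False
    moreover have "?C \<ge> 0" by simp
    ultimately have C: "?C > 0" by linarith
    have "0 \<le> (?A - 2 * (?B / ?C) * ?B + (?B / ?C)\<^sup>2 * ?C) * ?C"
      using q[of "?B / ?C"] C by (intro mult_nonneg_nonneg) auto
    also have "\<dots> = ?A * ?C - ?B\<^sup>2" using C by (simp add: power2_eq_square field_simps)
    finally show ?thesis by simp
  qed
qed

text \<open>Continuity of the inner product, from Cauchy-Schwarz. Square integrability is asked only
  eventually, since difference quotients are controlled only for \<open>s\<close> in the index
  set.\<close>

lemma L2_tendsto_mult:
  assumes Z: "\<forall>\<^sub>F s in F. sq (Z s)" and "sq Y" "sq X"
    and lim: "((\<lambda>s. \<integral>\<omega>. (Z s \<omega> - Y \<omega>)\<^sup>2 \<partial>M) \<longlongrightarrow> 0) F"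
  shows "((\<lambda>s. \<integral>\<omega>. Z s \<omega> * X \<omega> \<partial>M) \<longlongrightarrow> (\<integral>\<omega>. Y \<omega> * X \<omega> \<partial>M)) F"
proof -
  let ?b = "\<lambda>s. sqrt ((\<integral>\<omega>. (Z s \<omega> - Y \<omega>)\<^sup>2 \<partial>M) * (\<integral>\<omega>. (X \<omega>)\<^sup>2 \<partial>M))"
  have "(?b \<longlongrightarrow> sqrt (0 * (\<integral>\<omega>. (X \<omega>)\<^sup>2 \<partial>M))) F"
    by (intro tendsto_intros lim)
  then have b: "(?b \<longlongrightarrow> 0) F" by simp
  have "\<forall>\<^sub>F s in F. norm ((\<integral>\<omega>. Z s \<omega> * X \<omega> \<partial>M) - (\<integral>\<omega>. Y \<omega> * X \<omega> \<partial>M)) \<le> ?b s"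
    using Z
  proof eventually_elim
    case (elim s)
    have "(\<integral>\<omega>. Z s \<omega> * X \<omega> \<partial>M) - (\<integral>\<omega>. Y \<omega> * X \<omega> \<partial>M) = (\<integral>\<omega>. (Z s \<omega> - Y \<omega>) * X \<omega> \<partial>M)"
      using sq_integrable_mult[OF elim assms(3)] sq_integrable_mult[OF assms(2,3)]
      by (simp add: left_diff_distrib)
    moreover have "\<bar>\<dots>\<bar> \<le> ?b s"
      using L2_Cauchy_Schwarz[OF sq_diff[OF elim assms(2)] assms(3)] by (intro real_le_rsqrt) simp
    ultimately show ?case by simp
  qed
  then have "((\<lambda>s. (\<integral>\<omega>. Z s \<omega> * X \<omega> \<partial>M) - (\<integral>\<omega>. Y \<omega> * X \<omega> \<partial>M)) \<longlongrightarrow> 0) F"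
    by (rule Lim_null_comparison[OF _ b])
  then show ?thesis by (simp add: LIM_zero_iff)
qed

lemma L2_tendsto_power2:
  assumes Z: "\<forall>\<^sub>F s in F. sq (Z s)" and Y: "sq Y"
    and lim: "((\<lambda>s. \<integral>\<omega>. (Z s \<omega> - Y \<omega>)\<^sup>2 \<partial>M) \<longlongrightarrow> 0) F"
  shows "((\<lambda>s. \<integral>\<omega>. (Z s \<omega>)\<^sup>2 \<partial>M) \<longlongrightarrow> (\<integral>\<omega>. (Y \<omega>)\<^sup>2 \<partial>M)) F"
proof -
  let ?f = "\<lambda>s. (\<integral>\<omega>. (Z s \<omega> - Y \<omega>)\<^sup>2 \<partial>M) + 2 * (\<integral>\<omega>. Z s \<omega> * Y \<omega> \<partial>M) - (\<integral>\<omega>. (Y \<omega>)\<^sup>2 \<partial>M)"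
  have "(?f \<longlongrightarrow> 0 + 2 * (\<integral>\<omega>. Y \<omega> * Y \<omega> \<partial>M) - (\<integral>\<omega>. (Y \<omega>)\<^sup>2 \<partial>M)) F"
    by (intro tendsto_intros lim L2_tendsto_mult[OF Z Y Y lim])
  then have "(?f \<longlongrightarrow> (\<integral>\<omega>. (Y \<omega>)\<^sup>2 \<partial>M)) F" by (simp add: power2_eq_square)
  moreover have "\<forall>\<^sub>F s in F. ?f s = (\<integral>\<omega>. (Z s \<omega>)\<^sup>2 \<partial>M)"
    using Z
  proof eventually_elim
    case (elim s)
    have "(\<lambda>\<omega>. (Z s \<omega> - Y \<omega>)\<^sup>2) = (\<lambda>\<omega>. (Z s \<omega>)\<^sup>2 - 2 * (Z s \<omega> * Y \<omega>) + (Y \<omega>)\<^sup>2)"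
      by (auto simp: power2_eq_square algebra_simps)
    then show ?case
      using sq_integrable_power2[OF elim] sq_integrable_power2[OF Y] sq_integrable_mult[OF elim Y] by simp
  qed
  ultimately show ?thesis by (rule Lim_transform_eventually)
qed

text \<open>Stated through the characteristic function with the second moment as variance: the
  degenerate law needs no separate case, and every ingredient is continuous under mean-square
  convergence.\<close>

definition centered_normal :: "('a \<Rightarrow> real) \<Rightarrow> bool" where
  "centered_normal X \<longleftrightarrow> sq X \<and> (\<integral>\<omega>. X \<omega> \<partial>M) = 0 \<and>
     (\<forall>t. (\<integral>\<omega>. iexp (t * X \<omega>) \<partial>M) = of_real (exp (- (t\<^sup>2 * (\<integral>\<omega>. (X \<omega>)\<^sup>2 \<partial>M)) / 2)))"

lemma iexp_lipschitz: "cmod (iexp x - iexp y) \<le> \<bar>x - y\<bar>"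
proof -
  have "iexp x - iexp y = iexp y * (iexp (x - y) - 1)"
    by (simp add: algebra_simps flip: exp_add)
  then have "cmod (iexp x - iexp y) = cmod (iexp (x - y) - 1)"
    by (simp add: norm_mult)
  also have "\<dots> \<le> \<bar>x - y\<bar>" using iexp_approx1[of "x - y" 0] by simp
  finally show ?thesis .
qed

lemma integrable_iexp: "X \<in> borel_measurable M \<Longrightarrow> integrable M (\<lambda>\<omega>. iexp (t * X \<omega>))"
  by (intro integrable_const_bound[where B = 1]) auto

text \<open>Means and second moments converge, and \<open>iexp\<close> is Lipschitz, so the
  characteristic functions converge to the one with the limiting variance.\<close>

lemma centered_normal_limit:
  assumes Z: "\<And>n :: nat. centered_normal (Z n)" and X: "sq X"
    and lim: "(\<lambda>n. \<integral>\<omega>. (Z n \<omega> - X \<omega>)\<^sup>2 \<partial>M) \<longlonglongrightarrow> 0"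
  shows "centered_normal X"
proof -
  have sqZ: "sq (Z n)" for n using Z by (simp add: centered_normal_def)
  have Zn: "\<forall>\<^sub>F n in sequentially. sq (Z n)" using sqZ by simp
  have "(\<lambda>n. \<integral>\<omega>. Z n \<omega> * 1 \<partial>M) \<longlonglongrightarrow> (\<integral>\<omega>. X \<omega> * 1 \<partial>M)"
    by (rule L2_tendsto_mult[OF Zn X sq_const lim])
  moreover have "(\<integral>\<omega>. Z n \<omega> * 1 \<partial>M) = 0" for n using Z by (simp add: centered_normal_def)
  ultimately have mean: "(\<integral>\<omega>. X \<omega> \<partial>M) = 0" by (simp add: LIMSEQ_const_iff)
  have char: "(\<integral>\<omega>. iexp (t * X \<omega>) \<partial>M) = of_real (exp (- (t\<^sup>2 * (\<integral>\<omega>. (X \<omega>)\<^sup>2 \<partial>M)) / 2))" for t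
  proof (rule LIMSEQ_unique)
    have "(\<lambda>n. complex_of_real (exp (- (t\<^sup>2 * (\<integral>\<omega>. (Z n \<omega>)\<^sup>2 \<partial>M)) / 2)))
      \<longlonglongrightarrow> of_real (exp (- (t\<^sup>2 * (\<integral>\<omega>. (X \<omega>)\<^sup>2 \<partial>M)) / 2))"
      by (intro tendsto_intros L2_tendsto_power2[OF Zn X lim]) simp
    then show "(\<lambda>n. \<integral>\<omega>. iexp (t * Z n \<omega>) \<partial>M) \<longlonglongrightarrow> of_real (exp (- (t\<^sup>2 * (\<integral>\<omega>. (X \<omega>)\<^sup>2 \<partial>M)) / 2))"
      using Z by (simp add: centered_normal_def)
    have "(\<lambda>n. \<bar>t\<bar> * sqrt (\<integral>\<omega>. (Z n \<omega> - X \<omega>)\<^sup>2 \<partial>M)) \<longlonglongrightarrow> \<bar>t\<bar> * sqrt 0"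
      by (intro tendsto_intros lim)
    then have b: "(\<lambda>n. \<bar>t\<bar> * sqrt (\<integral>\<omega>. (Z n \<omega> - X \<omega>)\<^sup>2 \<partial>M)) \<longlonglongrightarrow> 0" by simp
    have "norm ((\<integral>\<omega>. iexp (t * Z n \<omega>) \<partial>M) - (\<integral>\<omega>. iexp (t * X \<omega>) \<partial>M))
      \<le> \<bar>t\<bar> * sqrt (\<integral>\<omega>. (Z n \<omega> - X \<omega>)\<^sup>2 \<partial>M)" for n
    proof -
      note D = sq_diff[OF sqZ[of n] X]
      have i: "integrable M (\<lambda>\<omega>. iexp (t * Z n \<omega>))" "integrable M (\<lambda>\<omega>. iexp (t * X \<omega>))"
        by (rule integrable_iexp[OF sq_measurable[OF sqZ]], rule integrable_iexp[OF sq_measurable[OF X]])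
      have "norm ((\<integral>\<omega>. iexp (t * Z n \<omega>) \<partial>M) - (\<integral>\<omega>. iexp (t * X \<omega>) \<partial>M))
        = norm (\<integral>\<omega>. iexp (t * Z n \<omega>) - iexp (t * X \<omega>) \<partial>M)"
        using i by simp
      also have "\<dots> \<le> (\<integral>\<omega>. \<bar>t\<bar> * \<bar>Z n \<omega> - X \<omega>\<bar> \<partial>M)"
      proof (rule order_trans[OF integral_norm_bound], rule integral_mono)
        show "integrable M (\<lambda>\<omega>. cmod (iexp (t * Z n \<omega>) - iexp (t * X \<omega>)))"
          using i by (intro integrable_norm Bochner_Integration.integrable_diff)
        show "integrable M (\<lambda>\<omega>. \<bar>t\<bar> * \<bar>Z n \<omega> - X \<omega>\<bar>)" using sq_integrable[OF D] by simp
        show "cmod (iexp (t * Z n \<omega>) - iexp (t * X \<omega>)) \<le> \<bar>t\<bar> * \<bar>Z n \<omega> - X \<omega>\<bar>" for \<omega>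
          using iexp_lipschitz[of "t * Z n \<omega>" "t * X \<omega>"]
          by (simp add: abs_mult flip: right_diff_distrib)
      qed
      also have "\<dots> = \<bar>t\<bar> * (\<integral>\<omega>. \<bar>Z n \<omega> - X \<omega>\<bar> \<partial>M)" by simp
      also have "(\<integral>\<omega>. \<bar>Z n \<omega> - X \<omega>\<bar> \<partial>M) \<le> sqrt (\<integral>\<omega>. (Z n \<omega> - X \<omega>)\<^sup>2 \<partial>M)"
      proof (rule real_le_rsqrt)
        have "sq (\<lambda>\<omega>. \<bar>Z n \<omega> - X \<omega>\<bar>)" using D
          by (auto simp: square_integrable_rv_def intro: borel_measurable_abs)
        from L2_Cauchy_Schwarz[OF this sq_const[of 1]]
        show "(\<integral>\<omega>. \<bar>Z n \<omega> - X \<omega>\<bar> \<partial>M)\<^sup>2 \<le> (\<integral>\<omega>. (Z n \<omega> - X \<omega>)\<^sup>2 \<partial>M)"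
          by (simp add: prob_space)
      qed
      finally show ?thesis by (simp add: mult_left_mono)
    qed
    then have "(\<lambda>n. (\<integral>\<omega>. iexp (t * Z n \<omega>) \<partial>M) - (\<integral>\<omega>. iexp (t * X \<omega>) \<partial>M)) \<longlonglongrightarrow> 0"
      by (intro Lim_null_comparison[OF _ b] always_eventually) blast
    then show "(\<lambda>n. \<integral>\<omega>. iexp (t * Z n \<omega>) \<partial>M) \<longlonglongrightarrow> (\<integral>\<omega>. iexp (t * X \<omega>) \<partial>M)"
      by (simp add: LIM_zero_iff)
  qed
  show ?thesis using X mean char by (simp add: centered_normal_def)
qed

lemma char_std_normal_rv:
  assumes "distributed M lborel X std_normal_density"
  shows "(\<integral>\<omega>. iexp (t * X \<omega>) \<partial>M) = of_real (exp (- t\<^sup>2 / 2))"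
proof -
  have X: "X \<in> measurable M lborel" and d: "distr M lborel X = std_normal_distribution"
    using assms by (simp_all add: distributed_def)
  have "(\<integral>\<omega>. iexp (t * X \<omega>) \<partial>M) = (\<integral>x. iexp (t * x) \<partial>(distr M lborel X))"
    using X by (subst integral_distr) auto
  also have "\<dots> = char std_normal_distribution t" by (simp add: d char_def)
  finally show ?thesis by (simp add: char_std_normal_distribution)
qed

lemma normal_rv_imp_centered_normal:
  assumes "normal_rv M X" and mean: "(\<integral>\<omega>. X \<omega> \<partial>M) = 0"
  shows "centered_normal X"
proof -
  have X [measurable]: "X \<in> borel_measurable M" using assms(1) by (simp add: normal_rv_def)
  from assms(1) obtain \<mu> where "(AE \<omega> in M. X \<omega> = \<mu>) \<or> (\<exists>s>0. distributed M lborel X (normal_density \<mu> s))"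
    by (auto simp: normal_rv_def)
  then show ?thesis
  proof
    assume ae: "AE \<omega> in M. X \<omega> = \<mu>"
    then have "(\<integral>\<omega>. X \<omega> \<partial>M) = (\<integral>\<omega>. \<mu> \<partial>M)" by (intro integral_cong_AE) auto
    then have "\<mu> = 0" using mean by (simp add: prob_space)
    with ae have ae: "AE \<omega> in M. X \<omega> = 0" by simp
    have s: "AE \<omega> in M. (X \<omega>)\<^sup>2 = 0" using ae by auto
    have "integrable M (\<lambda>\<omega>. (X \<omega>)\<^sup>2) = integrable M (\<lambda>\<omega>. 0 :: real)"
      using s by (intro integrable_cong_AE) auto
    then have "sq X" by (simp add: square_integrable_rv_def)
    moreover have "(\<integral>\<omega>. (X \<omega>)\<^sup>2 \<partial>M) = (\<integral>\<omega>. 0 \<partial>M)"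
      using s by (intro integral_cong_AE) auto
    moreover have "(\<integral>\<omega>. iexp (t * X \<omega>) \<partial>M) = (\<integral>\<omega>. 1 \<partial>M)" for t
      using ae by (intro integral_cong_AE) auto
    ultimately show ?thesis using mean by (simp add: centered_normal_def prob_space)
  next
    assume "\<exists>s>0. distributed M lborel X (normal_density \<mu> s)"
    then obtain s where s: "s > 0" and D: "distributed M lborel X (normal_density \<mu> s)" by blast
    have "\<mu> = 0" using normal_distributed_expectation[OF s D] mean by simp
    note D = D[unfolded this]
    have "integrable M (\<lambda>\<omega>. (X \<omega>)\<^sup>2)"
      using distributed_integrable[OF D, of "\<lambda>x. x\<^sup>2"] integrable_normal_moment[OF s, of 0 2] by simp
    then have "sq X" by (simp add: square_integrable_rv_def)
    moreover have v: "(\<integral>\<omega>. (X \<omega>)\<^sup>2 \<partial>M) = s\<^sup>2"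
      using normal_distributed_variance[OF s D] mean by simp
    moreover have "(\<integral>\<omega>. iexp (t * X \<omega>) \<partial>M) = of_real (exp (- (t\<^sup>2 * s\<^sup>2) / 2))" for t
    proof -
      have "distributed M lborel (\<lambda>\<omega>. (X \<omega> - 0) / s) std_normal_density"
        using D normal_standard_normal_convert[OF s] by blast
      from char_std_normal_rv[OF this, of "t * s"] show ?thesis
        using s by (simp add: power_mult_distrib)
    qed
    ultimately show ?thesis using mean by (simp add: centered_normal_def)
  qed
qed

text \<open>Zero second moment gives a constant almost surely; otherwise the standardised variable
  has the characteristic function of the standard normal law, and Levy's uniqueness theorem supplies
  the density.\<close>

lemma centered_normal_imp_normal_rv:
  assumes "centered_normal X"
  shows "normal_rv M X"
proof -
  have sqX: "sq X" using assms by (simp add: centered_normal_def)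
  then have X [measurable]: "X \<in> borel_measurable M" by (rule sq_measurable)
  let ?V = "\<integral>\<omega>. (X \<omega>)\<^sup>2 \<partial>M"
  show ?thesis
  proof (cases "?V = 0")
    case True
    then have "AE \<omega> in M. (X \<omega>)\<^sup>2 = 0"
      using integral_nonneg_eq_0_iff_AE[OF sq_integrable_power2[OF sqX]] by simp
    then have "AE \<omega> in M. X \<omega> = 0" by auto
    then show ?thesis using X unfolding normal_rv_def by blast
  next
    case False
    moreover have "?V \<ge> 0" by simp
    ultimately have V: "?V > 0" by linarith
    define s where "s = sqrt ?V"
    have s: "s > 0" "s\<^sup>2 = ?V" using V by (simp_all add: s_def)
    define Y where "Y = (\<lambda>\<omega>. (X \<omega> - 0) / s)"
    have Y [measurable]: "Y \<in> borel_measurable M" unfolding Y_def by simp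
    have "char (distr M borel Y) t = char std_normal_distribution t" for t
    proof -
      have "char (distr M borel Y) t = (\<integral>\<omega>. iexp (t * Y \<omega>) \<partial>M)"
        unfolding char_def by (subst integral_distr) auto
      also have "\<dots> = (\<integral>\<omega>. iexp ((t / s) * X \<omega>) \<partial>M)" by (simp add: Y_def)
      also have "\<dots> = of_real (exp (- ((t / s)\<^sup>2 * ?V) / 2))"
        using assms unfolding centered_normal_def by blast
      also have "(t / s)\<^sup>2 * ?V = t\<^sup>2" using s(1) unfolding s(2)[symmetric] by (simp add: power_divide)
      finally show ?thesis by (simp add: char_std_normal_distribution)
    qed
    then have "distr M borel Y = std_normal_distribution"
      by (intro Levy_uniqueness real_distribution_distr real_dist_normal_dist ext) auto
    moreover have "distr M lborel Y = distr M borel Y" by (intro distr_cong) auto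
    ultimately have "distributed M lborel Y std_normal_density"
      by (simp add: distributed_def)
    then have "distributed M lborel X (normal_density 0 s)"
      using normal_standard_normal_convert[OF s(1), of X 0] unfolding Y_def by blast
    then show ?thesis using X s(1) unfolding normal_rv_def by blast
  qed
qed

text \<open>Mean-square derivatives lie in the closed linear span of the process, and every element of that
  span is centered normal.\<close>

definition finite_combinations :: "real set \<Rightarrow> (real \<Rightarrow> 'a \<Rightarrow> real) \<Rightarrow> ('a \<Rightarrow> real) set" where
  "finite_combinations I u = {\<lambda>\<omega>. \<Sum>t\<in>T. a t * u t \<omega> | T a. finite T \<and> T \<subseteq> I}"

definition gaussian_space :: "real set \<Rightarrow> (real \<Rightarrow> 'a \<Rightarrow> real) \<Rightarrow> ('a \<Rightarrow> real) set" where
  "gaussian_space I u =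
     {X. sq X \<and> (\<forall>e>0. \<exists>Y\<in>finite_combinations I u. (\<integral>\<omega>. (X \<omega> - Y \<omega>)\<^sup>2 \<partial>M) < e)}"

lemma finite_combinations_lincomb:
  assumes "X \<in> finite_combinations I u" "Y \<in> finite_combinations I u"
  shows "(\<lambda>\<omega>. c * X \<omega> + d * Y \<omega>) \<in> finite_combinations I u"
proof -
  from assms obtain S a T b where X: "X = (\<lambda>\<omega>. \<Sum>t\<in>S. a t * u t \<omega>)" "finite S" "S \<subseteq> I"
    and Y: "Y = (\<lambda>\<omega>. \<Sum>t\<in>T. b t * u t \<omega>)" "finite T" "T \<subseteq> I"
    unfolding finite_combinations_def by blast
  define e where "e = (\<lambda>t. (if t \<in> S then c * a t else 0) + (if t \<in> T then d * b t else 0))"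
  have "c * X \<omega> + d * Y \<omega> = (\<Sum>t\<in>S \<union> T. e t * u t \<omega>)" for \<omega>
  proof -
    have "(\<Sum>t\<in>S \<union> T. (if t \<in> S then c * a t else 0) * u t \<omega>) = (\<Sum>t\<in>S. (if t \<in> S then c * a t else 0) * u t \<omega>)"
      using X Y by (intro sum.mono_neutral_right) auto
    moreover have "(\<Sum>t\<in>S \<union> T. (if t \<in> T then d * b t else 0) * u t \<omega>) = (\<Sum>t\<in>T. (if t \<in> T then d * b t else 0) * u t \<omega>)"
      using X Y by (intro sum.mono_neutral_right) auto
    ultimately show ?thesis
      unfolding X(1) Y(1) e_def distrib_right sum.distrib
      by (simp add: sum_distrib_left mult.assoc)
  qed
  then show ?thesis
    unfolding finite_combinations_def using X(2,3) Y(2,3) by (intro CollectI exI[of _ "S \<union> T"] exI[of _ e]) auto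
qed

text \<open>Substitute for the triangle inequality; its factor 2 is what the margins
  \<open>e / 4\<close> below pay for.\<close>

lemma sq_sum_bound:
  assumes "sq X" "sq Y" "sq Z" "\<And>\<omega>. Z \<omega> = c * X \<omega> + d * Y \<omega>"
  shows "(\<integral>\<omega>. (Z \<omega>)\<^sup>2 \<partial>M) \<le> 2 * c\<^sup>2 * (\<integral>\<omega>. (X \<omega>)\<^sup>2 \<partial>M) + 2 * d\<^sup>2 * (\<integral>\<omega>. (Y \<omega>)\<^sup>2 \<partial>M)"
proof -
  have "(\<integral>\<omega>. (Z \<omega>)\<^sup>2 \<partial>M) \<le> (\<integral>\<omega>. 2 * c\<^sup>2 * (X \<omega>)\<^sup>2 + 2 * d\<^sup>2 * (Y \<omega>)\<^sup>2 \<partial>M)"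
  proof (rule integral_mono)
    show "(Z \<omega>)\<^sup>2 \<le> 2 * c\<^sup>2 * (X \<omega>)\<^sup>2 + 2 * d\<^sup>2 * (Y \<omega>)\<^sup>2" for \<omega>
      using zero_le_power2[of "c * X \<omega> - d * Y \<omega>"] unfolding assms(4)
      by (simp add: power2_eq_square algebra_simps)
  qed (use assms(1-3)[THEN sq_integrable_power2] in auto)
  then show ?thesis
    using assms(1,2)[THEN sq_integrable_power2] by simp
qed

lemma gaussian_space_sq: "X \<in> gaussian_space I u \<Longrightarrow> sq X"
  by (simp add: gaussian_space_def)

context
  fixes I :: "real set" and u :: "real \<Rightarrow> 'a \<Rightarrow> real"
  assumes u: "\<And>ts. set ts \<subseteq> I \<Longrightarrow> centered_gaussian_vector M (map u ts)"
begin

lemma finite_combinations_centered_normal: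
  assumes "X \<in> finite_combinations I u"
  shows "centered_normal X"
proof -
  from assms obtain T a where X: "X = (\<lambda>\<omega>. \<Sum>t\<in>T. a t * u t \<omega>)" and T: "finite T" "T \<subseteq> I"
    unfolding finite_combinations_def by blast
  have cn: "centered_normal (u t)" if "t \<in> I" for t
  proof -
    have g: "centered_gaussian_vector M (map u [t])" using u[of "[t]"] that by simp
    have "\<forall>a :: nat \<Rightarrow> real. normal_rv M (\<lambda>\<omega>. a 0 * u t \<omega>)"
      using g by (simp add: centered_gaussian_vector_def gaussian_vector_def)
    from spec[OF this, of "\<lambda>_. 1"] have "normal_rv M (u t)" by simp
    moreover have "(\<integral>\<omega>. u t \<omega> \<partial>M) = 0" using g by (simp add: centered_gaussian_vector_def)
    ultimately show ?thesis by (rule normal_rv_imp_centered_normal)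
  qed
  define ts where "ts = sorted_list_of_set T"
  have ts: "set ts = T" "distinct ts" using T by (simp_all add: ts_def)
  have "normal_rv M (\<lambda>\<omega>. \<Sum>j<length (map u ts). a (ts ! j) * (map u ts ! j) \<omega>)"
    using u[of ts] ts(1) T(2) by (simp only: centered_gaussian_vector_def gaussian_vector_def)
  moreover have "(\<Sum>j<length (map u ts). a (ts ! j) * (map u ts ! j) \<omega>) = X \<omega>" for \<omega>
  proof -
    have "(\<Sum>j<length (map u ts). a (ts ! j) * (map u ts ! j) \<omega>) = (\<Sum>j<length ts. (\<lambda>t. a t * u t \<omega>) (ts ! j))"
      by simp
    also have "\<dots> = (\<Sum>t\<in>T. a t * u t \<omega>)"
      by (rule sum.reindex_bij_betw) (use bij_betw_nth[OF ts(2) refl ts(1)[symmetric]] in simp)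
    finally show ?thesis by (simp add: X)
  qed
  ultimately have "normal_rv M X" by simp
  moreover have "(\<integral>\<omega>. X \<omega> \<partial>M) = 0"
  proof -
    have "(\<integral>\<omega>. X \<omega> \<partial>M) = (\<Sum>t\<in>T. \<integral>\<omega>. a t * u t \<omega> \<partial>M)"
      unfolding X using T(2) cn
      by (intro Bochner_Integration.integral_sum) (auto simp: centered_normal_def intro!: sq_integrable)
    also have "\<dots> = 0"
      using T(2) cn by (intro sum.neutral) (auto simp: centered_normal_def)
    finally show ?thesis .
  qed
  ultimately show ?thesis by (rule normal_rv_imp_centered_normal)
qed

lemma finite_combinations_sq: "X \<in> finite_combinations I u \<Longrightarrow> sq X"
  using finite_combinations_centered_normal by (simp add: centered_normal_def)

lemma gaussian_space_base: "t \<in> I \<Longrightarrow> u t \<in> gaussian_space I u"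
proof -
  assume t: "t \<in> I"
  have "u t = (\<lambda>\<omega>. \<Sum>s\<in>{t}. 1 * u s \<omega>)" by simp
  then have "u t \<in> finite_combinations I u"
    unfolding finite_combinations_def using t by (intro CollectI exI[of _ "{t}"] exI[of _ "\<lambda>_. 1"]) auto
  then show ?thesis
    unfolding gaussian_space_def using finite_combinations_sq by (auto intro!: bexI[of _ "u t"])
qed

lemma gaussian_space_zero: "(\<lambda>\<omega>. 0) \<in> gaussian_space I u"
proof -
  have "(\<lambda>\<omega>. 0) \<in> finite_combinations I u"
    unfolding finite_combinations_def by (intro CollectI exI[of _ "{}"]) auto
  then show ?thesis
    unfolding gaussian_space_def using sq_const[of 0] by (auto intro!: bexI[of _ "\<lambda>\<omega>. 0"])
qed

lemma gaussian_space_lincomb: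
  assumes X: "X \<in> gaussian_space I u" and Y: "Y \<in> gaussian_space I u"
  shows "(\<lambda>\<omega>. c * X \<omega> + d * Y \<omega>) \<in> gaussian_space I u"
  unfolding gaussian_space_def
proof (intro CollectI conjI allI impI)
  note sX = gaussian_space_sq[OF X] and sY = gaussian_space_sq[OF Y]
  show "sq (\<lambda>\<omega>. c * X \<omega> + d * Y \<omega>)" by (rule sq_lincomb[OF sX sY])
  fix e :: real assume e: "e > 0"
  define e' where "e' = e / (4 * (c\<^sup>2 + d\<^sup>2 + 1))"
  have cd: "c\<^sup>2 + d\<^sup>2 + 1 > 0" by (intro add_nonneg_pos) auto
  have e': "e' > 0" using e cd by (simp add: e'_def)
  from X e' obtain X' where X': "X' \<in> finite_combinations I u" "(\<integral>\<omega>. (X \<omega> - X' \<omega>)\<^sup>2 \<partial>M) < e'"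
    unfolding gaussian_space_def by blast
  from Y e' obtain Y' where Y': "Y' \<in> finite_combinations I u" "(\<integral>\<omega>. (Y \<omega> - Y' \<omega>)\<^sup>2 \<partial>M) < e'"
    unfolding gaussian_space_def by blast
  note sX' = finite_combinations_sq[OF X'(1)] and sY' = finite_combinations_sq[OF Y'(1)]
  let ?Z = "\<lambda>\<omega>. c * X' \<omega> + d * Y' \<omega>"
  have "(\<integral>\<omega>. (c * X \<omega> + d * Y \<omega> - ?Z \<omega>)\<^sup>2 \<partial>M)
    \<le> 2 * c\<^sup>2 * (\<integral>\<omega>. (X \<omega> - X' \<omega>)\<^sup>2 \<partial>M) + 2 * d\<^sup>2 * (\<integral>\<omega>. (Y \<omega> - Y' \<omega>)\<^sup>2 \<partial>M)"
    by (rule sq_sum_bound[OF sq_diff[OF sX sX'] sq_diff[OF sY sY'] sq_diff[OF sq_lincomb[OF sX sY] sq_lincomb[OF sX' sY']]])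
      (simp add: algebra_simps)
  also have "\<dots> \<le> 2 * c\<^sup>2 * e' + 2 * d\<^sup>2 * e'"
    using X'(2) Y'(2) by (intro add_mono mult_left_mono) auto
  also have "\<dots> \<le> 2 * ((c\<^sup>2 + d\<^sup>2 + 1) * e')" using e' by (simp add: algebra_simps)
  also have "(c\<^sup>2 + d\<^sup>2 + 1) * e' = e / 4"
  proof -
    have "K * (e / (4 * K)) = e / 4" if "K > 0" for K using that by simp
    from this[OF cd] show ?thesis unfolding e'_def .
  qed
  also have "2 * (e / 4) < e" using e by simp
  finally show "\<exists>Z\<in>finite_combinations I u. (\<integral>\<omega>. (c * X \<omega> + d * Y \<omega> - Z \<omega>)\<^sup>2 \<partial>M) < e"
    by (rule bexI[OF _ finite_combinations_lincomb[OF X'(1) Y'(1)]])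
qed

lemma gaussian_space_sum:
  "finite J \<Longrightarrow> (\<And>j. j \<in> J \<Longrightarrow> X j \<in> gaussian_space I u) \<Longrightarrow> (\<lambda>\<omega>. \<Sum>j\<in>J. a j * X j \<omega>) \<in> gaussian_space I u"
proof (induction J rule: finite_induct)
  case (insert j J)
  then have "(\<lambda>\<omega>. a j * X j \<omega> + 1 * (\<Sum>j\<in>J. a j * X j \<omega>)) \<in> gaussian_space I u"
    by (intro gaussian_space_lincomb) auto
  then show ?case using insert by simp
qed (simp add: gaussian_space_zero)

lemma gaussian_space_closed:
  assumes X: "sq X" and lim: "\<And>e. e > 0 \<Longrightarrow> \<exists>Z\<in>gaussian_space I u. (\<integral>\<omega>. (Z \<omega> - X \<omega>)\<^sup>2 \<partial>M) < e"
  shows "X \<in> gaussian_space I u"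
  unfolding gaussian_space_def
proof (intro CollectI conjI allI impI)
  fix e :: real assume "e > 0"
  then have e: "e / 4 > 0" by simp
  from lim[OF e] obtain Z where Z: "Z \<in> gaussian_space I u" "(\<integral>\<omega>. (Z \<omega> - X \<omega>)\<^sup>2 \<partial>M) < e / 4" by blast
  from Z(1) e obtain Y where Y: "Y \<in> finite_combinations I u" "(\<integral>\<omega>. (Z \<omega> - Y \<omega>)\<^sup>2 \<partial>M) < e / 4"
    unfolding gaussian_space_def by blast
  note sZ = gaussian_space_sq[OF Z(1)] and sY = finite_combinations_sq[OF Y(1)]
  have "(\<integral>\<omega>. (X \<omega> - Y \<omega>)\<^sup>2 \<partial>M)
    \<le> 2 * (- 1)\<^sup>2 * (\<integral>\<omega>. (Z \<omega> - X \<omega>)\<^sup>2 \<partial>M) + 2 * 1\<^sup>2 * (\<integral>\<omega>. (Z \<omega> - Y \<omega>)\<^sup>2 \<partial>M)"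
    by (rule sq_sum_bound[OF sq_diff[OF sZ X] sq_diff[OF sZ sY] sq_diff[OF X sY]]) simp
  then show "\<exists>Y\<in>finite_combinations I u. (\<integral>\<omega>. (X \<omega> - Y \<omega>)\<^sup>2 \<partial>M) < e"
    using Z(2) Y by (intro bexI[of _ Y]) auto
qed (rule X)

lemma gaussian_space_centered_normal:
  assumes "X \<in> gaussian_space I u"
  shows "centered_normal X"
proof -
  have "\<exists>Y\<in>finite_combinations I u. (\<integral>\<omega>. (X \<omega> - Y \<omega>)\<^sup>2 \<partial>M) < inverse (real (Suc n))" for n
    using assms unfolding gaussian_space_def by (auto simp del: of_nat_Suc)
  then obtain Y where Y: "\<And>n. Y n \<in> finite_combinations I u"
    "\<And>n. (\<integral>\<omega>. (X \<omega> - Y n \<omega>)\<^sup>2 \<partial>M) < inverse (real (Suc n))" by metis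
  have "(\<lambda>n. \<integral>\<omega>. (Y n \<omega> - X \<omega>)\<^sup>2 \<partial>M) \<longlonglongrightarrow> 0"
  proof (rule tendsto_sandwich[OF _ _ tendsto_const LIMSEQ_inverse_real_of_nat])
    show "\<forall>\<^sub>F n in sequentially. (\<integral>\<omega>. (Y n \<omega> - X \<omega>)\<^sup>2 \<partial>M) \<le> inverse (real (Suc n))"
      using Y(2) by (simp add: power2_commute[of "Y _ _"] less_imp_le del: of_nat_Suc)
  qed simp
  from centered_normal_limit[OF finite_combinations_centered_normal[OF Y(1)] gaussian_space_sq[OF assms] this]
  show ?thesis .
qed

text \<open>Difference quotients lie in the space by linearity; as \<open>t\<close> is a limit point
  of the index set, some come arbitrarily close to \<open>Y t\<close>, and the space is
  closed.\<close>

lemma gaussian_space_ms_derivative: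
  assumes X: "\<And>s. s \<in> I \<Longrightarrow> X s \<in> gaussian_space I u" and D: "has_ms_derivative M I X Y" and t: "t \<in> I"
  shows "Y t \<in> gaussian_space I u"
proof (rule gaussian_space_closed)
  from D t have Y: "sq (Y t)" and lt: "t islimpt I"
    and lim: "((\<lambda>s. \<integral>\<omega>. ((X s \<omega> - X t \<omega>) / (s - t) - Y t \<omega>)\<^sup>2 \<partial>M) \<longlongrightarrow> 0) (at t within I)"
    by (auto simp: has_ms_derivative_def)
  show "sq (Y t)" by (rule Y)
  fix e :: real assume "e > 0"
  then have "\<forall>\<^sub>F s in at t within I. (\<integral>\<omega>. ((X s \<omega> - X t \<omega>) / (s - t) - Y t \<omega>)\<^sup>2 \<partial>M) < e"
    by (rule order_tendstoD(2)[OF lim])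
  moreover have "\<forall>\<^sub>F s in at t within I. s \<in> I" by (simp add: eventually_at_filter)
  ultimately have "\<forall>\<^sub>F s in at t within I. s \<in> I \<and> (\<integral>\<omega>. ((X s \<omega> - X t \<omega>) / (s - t) - Y t \<omega>)\<^sup>2 \<partial>M) < e"
    by eventually_elim simp
  then obtain s where s: "s \<in> I" "(\<integral>\<omega>. ((X s \<omega> - X t \<omega>) / (s - t) - Y t \<omega>)\<^sup>2 \<partial>M) < e"
    using eventually_happens'[of "at t within I"] lt by (auto simp: trivial_limit_within)
  have "(\<lambda>\<omega>. 1 / (s - t) * X s \<omega> + (- 1 / (s - t)) * X t \<omega>) \<in> gaussian_space I u"
    by (intro gaussian_space_lincomb X s t)
  then have "(\<lambda>\<omega>. (X s \<omega> - X t \<omega>) / (s - t)) \<in> gaussian_space I u"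
    by (simp add: diff_divide_distrib)
  with s(2) show "\<exists>Z\<in>gaussian_space I u. (\<integral>\<omega>. (Z \<omega> - Y t \<omega>)\<^sup>2 \<partial>M) < e"
    by (rule bexI[of _ "\<lambda>\<omega>. (X s \<omega> - X t \<omega>) / (s - t)"])
qed

lemma gaussian_space_vector:
  assumes "\<And>X. X \<in> set Xs \<Longrightarrow> X \<in> gaussian_space I u"
  shows "centered_gaussian_vector M Xs"
proof -
  have "normal_rv M (\<lambda>\<omega>. \<Sum>j<length Xs. a j * (Xs ! j) \<omega>)" for a
    using assms by (intro centered_normal_imp_normal_rv gaussian_space_centered_normal gaussian_space_sum) auto
  moreover have "X \<in> borel_measurable M" "(\<integral>\<omega>. X \<omega> \<partial>M) = 0" if "X \<in> set Xs" for X
    using gaussian_space_centered_normal[OF assms[OF that]] sq_measurable by (auto simp: centered_normal_def)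
  ultimately show ?thesis
    by (simp add: centered_gaussian_vector_def gaussian_vector_def)
qed

end

text \<open>Mean-square convergence passes through the inner product with a fixed \<open>Z\<close>.
  Both limits are taken within \<open>I\<close>, where they are unique since \<open>t\<close> is a
  limit point.\<close>

lemma ms_derivative_mult:
  assumes D: "has_ms_derivative M I X Y" and Z: "sq Z" and t: "t \<in> I"
    and g: "\<And>s. s \<in> I \<Longrightarrow> (\<integral>\<omega>. X s \<omega> * Z \<omega> \<partial>M) = g s"
    and g': "(g has_real_derivative g') (at t)"
  shows "(\<integral>\<omega>. Y t \<omega> * Z \<omega> \<partial>M) = g'"
proof (rule tendsto_unique)
  from D t have Y: "sq (Y t)" and lt: "t islimpt I" and X: "\<And>s. s \<in> I \<Longrightarrow> sq (X s)"
    and lim: "((\<lambda>s. \<integral>\<omega>. ((X s \<omega> - X t \<omega>) / (s - t) - Y t \<omega>)\<^sup>2 \<partial>M) \<longlongrightarrow> 0) (at t within I)"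
    by (auto simp: has_ms_derivative_def)
  show "at t within I \<noteq> bot" using lt by (simp add: trivial_limit_within)
  have ev: "\<forall>\<^sub>F s in at t within I. s \<in> I" by (simp add: eventually_at_filter)
  show "((\<lambda>s. \<integral>\<omega>. (X s \<omega> - X t \<omega>) / (s - t) * Z \<omega> \<partial>M) \<longlongrightarrow> (\<integral>\<omega>. Y t \<omega> * Z \<omega> \<partial>M)) (at t within I)"
  proof (rule L2_tendsto_mult[OF _ Y Z lim])
    show "\<forall>\<^sub>F s in at t within I. sq (\<lambda>\<omega>. (X s \<omega> - X t \<omega>) / (s - t))"
      using ev
    proof eventually_elim
      case (elim s)
      have "sq (\<lambda>\<omega>. 1 / (s - t) * X s \<omega> + (- 1 / (s - t)) * X t \<omega>)"
        by (intro sq_lincomb X elim t)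
      then show ?case by (simp add: diff_divide_distrib)
    qed
  qed
  have "((\<lambda>s. (g s - g t) / (s - t)) \<longlongrightarrow> g') (at t within I)"
    using has_field_derivative_at_within[OF g'] by (simp add: has_field_derivative_iff)
  moreover have "\<forall>\<^sub>F s in at t within I. (g s - g t) / (s - t) = (\<integral>\<omega>. (X s \<omega> - X t \<omega>) / (s - t) * Z \<omega> \<partial>M)"
    using ev
  proof eventually_elim
    case (elim s)
    have "(\<integral>\<omega>. (X s \<omega> - X t \<omega>) / (s - t) * Z \<omega> \<partial>M) = (\<integral>\<omega>. (X s \<omega> * Z \<omega> - X t \<omega> * Z \<omega>) / (s - t) \<partial>M)"
      by (simp add: left_diff_distrib)
    also have "\<dots> = (g s - g t) / (s - t)"
      using sq_integrable_mult[OF X[OF elim] Z] sq_integrable_mult[OF X[OF t] Z] by (simp add: g elim t)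
    finally show ?case ..
  qed
  ultimately show "((\<lambda>s. \<integral>\<omega>. (X s \<omega> - X t \<omega>) / (s - t) * Z \<omega> \<partial>M) \<longlongrightarrow> g') (at t within I)"
    by (rule Lim_transform_eventually)
qed

text \<open>Each mean-square derivative is moved onto the covariance function: \<open>b\<close> of
  them in \<open>t\<close>, tested against \<open>D 0 s\<close>, and then \<open>a\<close> in
  \<open>s\<close>. Only orders up to \<open>2 * L\<close> occur, so the jump of the next odd
  derivative is never met.\<close>

lemma ms_derivatives_moments:
  fixes D :: "nat \<Rightarrow> real \<Rightarrow> 'a \<Rightarrow> real" and e :: "nat \<Rightarrow> real \<Rightarrow> real"
  assumes sqD: "\<And>l s. l \<le> L \<Longrightarrow> s \<in> I \<Longrightarrow> sq (D l s)"
    and D: "\<And>l. l < L \<Longrightarrow> has_ms_derivative M I (D l) (D (Suc l))"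
    and cov0: "\<And>s t. s \<in> I \<Longrightarrow> t \<in> I \<Longrightarrow> (\<integral>\<omega>. D 0 s \<omega> * D 0 t \<omega> \<partial>M) = e 0 (s - t)"
    and e: "\<And>k x. k < 2 * L \<Longrightarrow> (e k has_real_derivative e (Suc k) x) (at x)"
    and ab: "a \<le> L" "b \<le> L" and st: "s \<in> I" "t \<in> I"
  shows "(\<integral>\<omega>. D a s \<omega> * D b t \<omega> \<partial>M) = (- 1) ^ b * e (a + b) (s - t)"
proof -
  have first: "(\<integral>\<omega>. D b t \<omega> * D 0 s \<omega> \<partial>M) = (- 1) ^ b * e b (s - t)" if "b \<le> L" "s \<in> I" "t \<in> I" for b s t
    using that
  proof (induction b arbitrary: t)
    case 0
    then show ?case using cov0[of s t] by (simp add: mult.commute)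
  next
    case (Suc b)
    show ?case
    proof (rule ms_derivative_mult[OF D sqD])
      show "b < L" "0 \<le> L" "s \<in> I" "t \<in> I" using Suc.prems by auto
      show "(\<integral>\<omega>. D b t' \<omega> * D 0 s \<omega> \<partial>M) = (- 1) ^ b * e b (s - t')" if "t' \<in> I" for t'
        using Suc that by simp
      show "((\<lambda>t'. (- 1) ^ b * e b (s - t')) has_real_derivative (- 1) ^ Suc b * e (Suc b) (s - t)) (at t)"
        using Suc.prems(1) by (auto intro!: derivative_eq_intros DERIV_chain2[where g = "\<lambda>t'. s - t'", OF e])
    qed
  qed
  show ?thesis
    using ab(1) st(1)
  proof (induction a arbitrary: s)
    case 0
    then show ?case using first[OF ab(2) 0(2) st(2)] by (simp add: mult.commute)
  next
    case (Suc a)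
    show ?case
    proof (rule ms_derivative_mult[OF D sqD])
      show "a < L" "b \<le> L" "t \<in> I" "s \<in> I" using Suc.prems ab st by auto
      show "(\<integral>\<omega>. D a s' \<omega> * D b t \<omega> \<partial>M) = (- 1) ^ b * e (a + b) (s' - t)" if "s' \<in> I" for s'
        using Suc that by simp
      show "((\<lambda>s'. (- 1) ^ b * e (a + b) (s' - t)) has_real_derivative (- 1) ^ b * e (Suc a + b) (s - t)) (at s)"
        using Suc.prems(1) ab(2)
        by (auto intro!: derivative_eq_intros DERIV_chain2[where g = "\<lambda>s'. s' - t", OF e])
    qed
  qed
qed

end

section \<open>The precision matrix of the approximation\<close>

lemma concat_uniform:
  assumes "\<And>xs. xs \<in> set xss \<Longrightarrow> length xs = d"
  shows "length (concat xss) = length xss * d"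
    and "x < length xss * d \<Longrightarrow> concat xss ! x = xss ! (x div d) ! (x mod d)"
proof -
  show "length (concat xss) = length xss * d"
    using assms by (induction xss) auto
  show "x < length xss * d \<Longrightarrow> concat xss ! x = xss ! (x div d) ! (x mod d)"
    using assms
  proof (induction xss arbitrary: x)
    case (Cons xs xss)
    then have xs: "length xs = d" by simp
    show ?case
    proof (cases "x < d")
      case True
      then show ?thesis by (simp add: nth_append xs)
    next
      case False
      then have "x - d < length xss * d" and d: "d > 0" using Cons.prems(1) by (auto intro: gr0I)
      then have "concat xss ! (x - d) = xss ! ((x - d) div d) ! ((x - d) mod d)"
        using Cons.prems(2) by (intro Cons.IH) auto
      then show ?thesis using False d by (simp add: nth_append xs le_div_geq le_mod_geq)
    qed
  qed simp
qed

lemma concatenated_vector_nth: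
  shows "length (concatenated_vector n L t D) = n * Suc L"
    and "x < n * Suc L \<Longrightarrow>
      concatenated_vector n L t D ! x = D (x mod Suc L) (t (x div Suc L + 1))"
proof -
  let ?xss = "map (\<lambda>j. map (\<lambda>l. D l (t j)) [0..<L + 1]) [1..<n + 1]"
  have u: "length xs = Suc L" if "xs \<in> set ?xss" for xs using that by auto
  have l: "length ?xss = n" by simp
  show "length (concatenated_vector n L t D) = n * Suc L"
    unfolding concatenated_vector_def using concat_uniform(1)[of ?xss "Suc L", OF u] l by simp
  assume x: "x < n * Suc L"
  then have "x div Suc L < n" by (simp add: less_mult_imp_div_less del: mult_Suc_right)
  then have "?xss ! (x div Suc L) ! (x mod Suc L) = D (x mod Suc L) (t (x div Suc L + 1))"
    by (simp del: upt_Suc)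
  then show "concatenated_vector n L t D ! x = D (x mod Suc L) (t (x div Suc L + 1))"
    unfolding concatenated_vector_def using concat_uniform(2)[of ?xss "Suc L", OF u] l x by simp
qed

context prob_space begin

text \<open>\<open>e\<close> stands for the derivatives of the covariance function and
  \<open>r\<close> for the blocks built from them. In this form white noise fits in: with
  \<open>L = 0\<close> nothing has to be differentiated.\<close>

lemma concatenated_vector_precision:
  fixes t :: "nat \<Rightarrow> real"
  assumes csg: "centered_stationary_gaussian_process M I u \<rho>"
    and D0: "\<And>s. s \<in> I \<Longrightarrow> D 0 s = u s"
    and D: "\<And>l. l < L \<Longrightarrow> has_ms_derivative M I (D l) (D (Suc l))"
    and tI: "\<And>j. j \<in> {1..n} \<Longrightarrow> t j \<in> I" and t: "strict_mono_on {1..n} t"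
    and e: "e 0 = \<rho>" "\<And>k x. k < 2 * L \<Longrightarrow> (e k has_real_derivative e (Suc k) x) (at x)"
    and r: "\<And>s t a b. a < Suc L \<Longrightarrow> b < Suc L \<Longrightarrow> r s t $$ (a, b) = (- 1) ^ b * e (a + b) (s - t)"
    and K: "markov_kernel (Suc L) r"
  shows "centered_gaussian_vector M (concatenated_vector n L t D)"
    and "cov_matrix M (concatenated_vector n L t D) = block_square (Suc L) n (\<lambda>j l. r (t j) (t l))"
proof -
  let ?U = "concatenated_vector n L t D"
  have u: "centered_gaussian_vector M (map u ts)" if "set ts \<subseteq> I" for ts
    using csg that by (simp add: centered_stationary_gaussian_process_def)
  have DG: "D l s \<in> gaussian_space I u" if "l \<le> L" "s \<in> I" for l s
    using that
  proof (induction l arbitrary: s)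
    case 0
    then show ?case using gaussian_space_base[OF u] by (simp add: D0)
  next
    case (Suc l)
    then show ?case by (intro gaussian_space_ms_derivative[OF u _ D]) auto
  qed
  have idx: "x mod Suc L \<le> L" "t (x div Suc L + 1) \<in> I" if "x < n * Suc L" for x
  proof -
    have "x mod Suc L < Suc L" by (rule mod_less_divisor) simp
    then show "x mod Suc L \<le> L" by simp
    have "x div Suc L < n" using that by (simp add: less_mult_imp_div_less del: mult_Suc_right)
    then show "t (x div Suc L + 1) \<in> I" by (intro tI) simp
  qed
  have UG: "X \<in> gaussian_space I u" if "X \<in> set ?U" for X
  proof -
    from that obtain x where "x < n * Suc L" "X = ?U ! x"
      by (auto simp: in_set_conv_nth concatenated_vector_nth(1))
    then show ?thesis using DG idx by (simp add: concatenated_vector_nth(2))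
  qed
  show "centered_gaussian_vector M ?U"
    by (rule gaussian_space_vector[OF u UG])
  have cn: "centered_normal (D l s)" if "l \<le> L" "s \<in> I" for l s
    by (rule gaussian_space_centered_normal[OF u DG[OF that]])
  have cov: "covariance M (D a s) (D b s') = (\<integral>\<omega>. D a s \<omega> * D b s' \<omega> \<partial>M)"
    if "a \<le> L" "b \<le> L" "s \<in> I" "s' \<in> I" for a b s s'
    using cn[of a s] cn[of b s'] that by (simp add: covariance_def centered_normal_def)
  have mom: "(\<integral>\<omega>. D a s \<omega> * D b s' \<omega> \<partial>M) = (- 1) ^ b * e (a + b) (s - s')"
    if "a \<le> L" "b \<le> L" "s \<in> I" "s' \<in> I" for a b s s'
  proof (rule ms_derivatives_moments[where D = D and L = L and I = I and e = e, OF _ D _ e(2) that])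
    show "sq (D l s)" if "l \<le> L" "s \<in> I" for l s
      using cn[OF that] by (simp add: centered_normal_def)
    show "(\<integral>\<omega>. D 0 s \<omega> * D 0 s' \<omega> \<partial>M) = e 0 (s - s')" if "s \<in> I" "s' \<in> I" for s s'
      using csg that cov[of 0 0 s s']
      by (simp add: e(1) D0 centered_stationary_gaussian_process_def)
  qed
  show "cov_matrix M ?U = block_square (Suc L) n (\<lambda>j l. r (t j) (t l))"
  proof (rule eq_matI)
    fix x y assume "x < dim_row (block_square (Suc L) n (\<lambda>j l. r (t j) (t l)))"
      "y < dim_col (block_square (Suc L) n (\<lambda>j l. r (t j) (t l)))"
    then have xy: "x < n * Suc L" "y < n * Suc L" by (simp_all del: mult_Suc_right)
    have "cov_matrix M ?U $$ (x, y)
      = covariance M (D (x mod Suc L) (t (x div Suc L + 1))) (D (y mod Suc L) (t (y div Suc L + 1)))"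
      using xy by (simp add: cov_matrix_def concatenated_vector_nth del: mult_Suc_right)
    also have "\<dots> = r (t (x div Suc L + 1)) (t (y div Suc L + 1)) $$ (x mod Suc L, y mod Suc L)"
      using idx[OF xy(1)] idx[OF xy(2)] by (simp add: cov mom r)
    also have "\<dots> = block_square (Suc L) n (\<lambda>j l. r (t j) (t l)) $$ (x, y)"
      by (rule block_square_index[OF xy, symmetric])
    finally show "cov_matrix M ?U $$ (x, y) = block_square (Suc L) n (\<lambda>j l. r (t j) (t l)) $$ (x, y)" .
  qed (simp_all add: cov_matrix_def concatenated_vector_nth(1) del: mult_Suc_right)
qed

end

lemma multi_cov_white_noise:
  "multi_cov 1 (\<lambda>h. if h = 0 then C else 0) = (\<lambda>s t. Matrix.mat 1 1 (\<lambda>_. if s = t then C else 0))"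
  by (intro HOL.ext eq_matI) (auto simp: multi_cov_def)

lemma approx_cov_kernel:
  fixes \<alpha> \<kappa> s2 k :: real and c p :: "nat \<Rightarrow> real" and i :: nat
  defines "\<rho> \<equiv> approx_cov \<alpha> \<kappa> s2 k c p i"
  assumes "\<alpha> > 1/2" "\<alpha> \<notin> \<nat>" "\<kappa> > 0" "s2 > 0" "k > 0" "i > 0 \<Longrightarrow> c i > 0 \<and> p i < 0"
    and L: "block_size \<alpha> i = Suc L"
  shows "\<exists>e. e 0 = \<rho> \<and> (\<forall>k<2 * L. \<forall>x. (e k has_real_derivative e (Suc k) x) (at x)) \<and>
      (\<forall>s t. \<forall>a<Suc L. \<forall>b<Suc L. multi_cov (Suc L) \<rho> s t $$ (a, b) = (- 1) ^ b * e (a + b) (s - t))"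
    and "markov_kernel (Suc L) (multi_cov (Suc L) \<rho>)"
proof -
  have "(\<exists>e. e 0 = \<rho> \<and> (\<forall>k<2 * L. \<forall>x. (e k has_real_derivative e (Suc k) x) (at x)) \<and>
      (\<forall>s t. \<forall>a<Suc L. \<forall>b<Suc L. multi_cov (Suc L) \<rho> s t $$ (a, b) = (- 1) ^ b * e (a + b) (s - t))) \<and>
      markov_kernel (Suc L) (multi_cov (Suc L) \<rho>)"
  proof (cases "\<alpha> < 1 \<and> i = 0")
    case True
    then have "\<lfloor>\<alpha>\<rfloor> < 1" by (simp add: floor_less_iff)
    then have L0: "L = 0" using L True by (simp add: block_size_def max_def)
    define C where "C = k * s2 * (gamma_ratio \<alpha> * sqrt (4 * pi) / \<kappa>)"
    have "gamma_ratio \<alpha> > 0"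
      using assms(2) by (auto simp: gamma_ratio_def intro!: divide_pos_pos Gamma_real_pos)
    then have C: "C > 0" using assms(4-6) by (simp add: C_def)
    have \<rho>: "\<rho> = (\<lambda>h. if h = 0 then C else 0)"
      using True by (auto simp: \<rho>_def approx_cov_def C_def Let_def)
    have "markov_kernel (Suc L) (multi_cov (Suc L) \<rho>)"
      unfolding L0 \<rho> using white_noise_kernel[OF C] multi_cov_white_noise[of C] by simp
    moreover have "multi_cov (Suc L) \<rho> s t $$ (a, b) = (- 1) ^ b * \<rho> (s - t)" if "a < Suc L" "b < Suc L" for s t a b
      using that L0 by (simp add: multi_cov_def)
    \<comment> \<open>For \<open>L = 0\<close> only order 0 is ever read, so the constant sequence
      is a witness.\<close>
    ultimately show ?thesis using L0 by (intro conjI exI[of _ "\<lambda>_. \<rho>"]) auto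
  next
    case False
    from approx_cov_tower[where c = c and p = p and i = i, OF assms(2,4-7,3) this] L obtain f ls
      where f: "markov_tower (Suc L) ls f" and \<rho>f: "\<And>h. \<rho> h = f 0 \<bar>h\<bar>"
      unfolding \<rho>_def by metis
    interpret markov_tower "Suc L" ls f by (rule f)
    have \<rho>: "\<rho> = parity_ext 0" by (auto simp: \<rho>f parity_ext_def)
    have "(parity_ext k has_real_derivative parity_ext (Suc k) x) (at x)" if "k < 2 * L" for k x
      using that by (intro DERIV_ext) simp
    moreover have "multi_cov (Suc L) \<rho> = cov_kernel"
      unfolding \<rho> by (intro HOL.ext multi_cov_ext)
    moreover have "cov_kernel s t $$ (a, b) = (- 1) ^ b * parity_ext (a + b) (s - t)" if "a < Suc L" "b < Suc L" for s t a b
      using that by (simp add: cov_kernel_def)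
    ultimately show ?thesis
      using cov_kernel_markov_kernel \<rho> by (intro conjI exI[of _ parity_ext]) auto
  qed
  then show "\<exists>e. e 0 = \<rho> \<and> (\<forall>k<2 * L. \<forall>x. (e k has_real_derivative e (Suc k) x) (at x)) \<and>
      (\<forall>s t. \<forall>a<Suc L. \<forall>b<Suc L. multi_cov (Suc L) \<rho> s t $$ (a, b) = (- 1) ^ b * e (a + b) (s - t))"
    and "markov_kernel (Suc L) (multi_cov (Suc L) \<rho>)" by blast+
qed

theorem proposition6:
  fixes I :: "real set" and \<alpha> \<kappa> \<sigma> :: real and m n :: nat
    and a b :: "nat \<Rightarrow> real"
    and k :: real and c p :: "nat \<Rightarrow> real"
    and M :: "'a measure" and u :: "nat \<Rightarrow> real \<Rightarrow> 'a \<Rightarrow> real"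
    and D :: "nat \<Rightarrow> nat \<Rightarrow> real \<Rightarrow> 'a \<Rightarrow> real"
    and t :: "nat \<Rightarrow> real"
  assumes "is_interval I"
    and "\<alpha> > 1/2" and "\<alpha> \<notin> \<nat>" and "\<kappa> > 0" and "\<sigma>\<^sup>2 > 0"
    and "best_rational_approx (frac \<alpha>) m a b"
    and "partial_fractions m a b k c p"
    and "k > 0" and "\<forall>i\<in>{1..m}. c i > 0 \<and> p i < 0"
    and "prob_space M"
    and "\<forall>i\<le>m. centered_stationary_gaussian_process M I (u i) (approx_cov \<alpha> \<kappa> (\<sigma>\<^sup>2) k c p i)"
    and "independent_processes M I {0..m} u"
    and "\<forall>i\<le>m. \<forall>s\<in>I. D i 0 s = u i s"
    and "\<forall>i\<le>m. \<forall>l<max_deriv_order \<alpha> i. has_ms_derivative M I (D i l) (D i (Suc l))"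
    and "\<forall>j\<in>{1..n}. t j \<in> I" and "strict_mono_on {1..n} t"
  shows "\<forall>i\<le>m.
    (let d = block_size \<alpha> i;
         r = multi_cov d (approx_cov \<alpha> \<kappa> (\<sigma>\<^sup>2) k c p i);
         U = concatenated_vector n (max_deriv_order \<alpha> i) t (D i)
     in centered_gaussian_vector M U \<and>
       (\<exists>Q :: nat \<Rightarrow> nat \<Rightarrow> real mat.
          (\<forall>j\<in>{1..n}. \<forall>l\<in>{1..n}. Q j l \<in> carrier_mat d d) \<and>
          is_inverse_mat (cov_matrix M U)
            (block_matrix d (map (\<lambda>j. map (\<lambda>l. Q j l) [1..<n + 1]) [1..<n + 1])) \<and>
          (\<forall>j\<in>{1..n}. \<forall>l\<in>{1..n}. j + 1 < l \<or> l + 1 < j \<longrightarrow> Q j l = 0\<^sub>m d d) \<and>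
          (n \<ge> 2 \<longrightarrow>
             (\<exists>M\<^sub>0 \<in> carrier_mat d d.
                is_inverse_mat
                  (block_matrix d [[r (t 1) (t 1), r (t 1) (t 2)],
                                   [r (t 2) (t 1), r (t 2) (t 2)]])
                  (block_matrix d [[Q 1 1, Q 1 2],
                                   [Q 2 1, M\<^sub>0]]))) \<and>
          (\<forall>j\<in>{2..n - 1}.
             \<exists>M\<^sub>1 \<in> carrier_mat d d. \<exists>M\<^sub>2 \<in> carrier_mat d d. \<exists>E \<in> carrier_mat d d.
                (j = n - 1 \<longrightarrow> E = Q (j + 1) (j + 1)) \<and>
                is_inverse_mat
                  (block_matrix d
                    [[r (t (j - 1)) (t (j - 1)), r (t (j - 1)) (t j), r (t (j - 1)) (t (j + 1))],
                     [r (t j) (t (j - 1)), r (t j) (t j), r (t j) (t (j + 1))],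
                     [r (t (j + 1)) (t (j - 1)), r (t (j + 1)) (t j), r (t (j + 1)) (t (j + 1))]])
                  (block_matrix d
                    [[M\<^sub>1, M\<^sub>2, 0\<^sub>m d d],
                     [transpose_mat M\<^sub>2, Q j j, Q j (j + 1)],
                     [0\<^sub>m d d, Q (j + 1) j, E]]))))"
  (is "\<forall>i\<le>m. ?P i")
proof (intro allI impI)
  fix i assume i: "i \<le> m"
  interpret prob_space M by (rule assms(10))
  let ?L = "max_deriv_order \<alpha> i"
  let ?\<rho> = "approx_cov \<alpha> \<kappa> (\<sigma>\<^sup>2) k c p i"
  have bs: "block_size \<alpha> i = Suc ?L" by (rule block_size_eq[OF assms(2,3)])
  have cp: "i > 0 \<Longrightarrow> c i > 0 \<and> p i < 0" using assms(9) i by simp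
  note kernel = approx_cov_kernel[where c = c and p = p and i = i, OF assms(2-5,8) cp bs]
  from kernel(1) obtain e where e: "e 0 = ?\<rho>"
    "\<And>k x. k < 2 * ?L \<Longrightarrow> (e k has_real_derivative e (Suc k) x) (at x)"
    "\<And>s t a b. a < Suc ?L \<Longrightarrow> b < Suc ?L \<Longrightarrow>
      multi_cov (Suc ?L) ?\<rho> s t $$ (a, b) = (- 1) ^ b * e (a + b) (s - t)"
    by blast
  have csg: "centered_stationary_gaussian_process M I (u i) ?\<rho>" using assms(11) i by blast
  have D0: "D i 0 s = u i s" if "s \<in> I" for s using assms(13) i that by blast
  have D: "has_ms_derivative M I (D i l) (D i (Suc l))" if "l < ?L" for l using assms(14) i that by blast
  have tI: "t j \<in> I" if "j \<in> {1..n}" for j using assms(15) that by blast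
  note D_precision = concatenated_vector_precision[where D = "D i" and L = ?L and n = n and t = t,
      OF csg D0 D tI assms(16) e kernel(2)]
  have U: "centered_gaussian_vector M (concatenated_vector n ?L t (D i))"
    by (rule D_precision(1))
  have cov: "cov_matrix M (concatenated_vector n ?L t (D i))
    = block_square (Suc ?L) n (\<lambda>j l. multi_cov (Suc ?L) ?\<rho> (t j) (t l))"
    by (rule D_precision(2))
  show "?P i"
    unfolding Let_def bs cov
    by (rule conjI[OF U markov_kernel.precision_blocks[OF kernel(2) assms(16)]])
qed

end
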